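(* Assume: (F) $F_0$ has bounded support $\mathcal{S}_0=[0,M_0]$ and is strictly increasing on $\mathcal{S}_0$ with density $f_0$, strictly staying away from zero on $\mathcal{S}_0$; (G) $G$ has support $[0,\infty)$, is strictly increasing on $\mathcal{S}_0$ with density $g$ staying away from zero on $\mathcal{S}_0$, and $g'$ is bounded on $\mathcal{S}_0$. Let $\lambda_0=f_0/(1-F_0)$. Fix $t>0$ such that $F_0(t)<1$, $f_0''$ is continuous at $t$, $f_0''(t)\ne0$, and $(1-F_0(t))f_0''(t)+f_0(t)f_0'(t)\neq0$. Let $h=cn^{-1/7}$ ($c>0$) be the bandwidth used to compute $\hat\lambda_n^{\mathrm{SM}}$. Then, as $n\to\infty$, $$n^{2/7}\big(\hat\lambda_n^{\mathrm{SM}}(t)-\lambda_0(t)\big)\rightsquigarrow\mathcal{N}(\mu_{\lambda,\mathrm{SM}},\sigma^2_{\lambda,\mathrm{SM}}),$$ where $$\mu_{\lambda,\mathrm{SM}}=\frac{\tfrac12c^2m_2(k)}{1-F_0(t)}\Big(f_0''(t)+\frac{f_0(t)f_0'(t)}{1-F_0(t)}\Big),\qquad\sigma^2_{\lambda,\mathrm{SM}}=\frac{F_0(t)}{c^3g(t)(1-F_0(t))}\int k'(u)^2\,du.$$ For fixed $t$, the aMSE-optimal bandwidth for $\hat\lambda_n^{\mathrm{SM}}(t)$ is $h_{n,\lambda,\mathrm{SM}}=c_{\lambda,\mathrm{SM}}n^{-1/7}$, where $$c_{\lambda,\mathrm{SM}}=\Big\{3\frac{F_0(t)}{g(t)(1-F_0(t))}\int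 k'(u)^2\,du\Big\}^{1/7}\Big\{\frac{m_2^2(k)}{(1-F_0(t))^2}\Big(f_0''(t)+\frac{f_0(t)f_0'(t)}{1-F_0(t)}\Big)^2\Big\}^{-1/7};$$ that is, $c_{\lambda,\mathrm{SM}}$ minimizes the asymptotic mean squared error $\mu_{\lambda,\mathrm{SM}}^2+\sigma_{\lambda,\mathrm{SM}}^2$ over $c>0$.
   Context: Current status model: $X_1,X_2,\dots$ are i.i.d. with distribution function $F_0$ on $[0,\infty)$, and, independently, $T_1,T_2,\dots$ are i.i.d. with distribution function $G$ on $[0,\infty)$ having Lebesgue density $g$. One observes $(T_i,\Delta_i)$, $1\le i\le n$, with $\Delta_i=1_{\{X_i\le T_i\}}$. The (nonparametric) maximum likelihood estimator $\hat F_n$ maximizes $\frac1n\sum_{i=1}^n\{\Delta_i\log F(T_i)+(1-\Delta_i)\log(1-F(T_i))\}$ over all distribution functions $F$. Explicitly: let $T_{(1)}<\dots<T_{(n)}$ be the ordered $T_i$ and $\Delta_{(i)}$ the indicator associated with $T_{(i)}$; let $P_0=(0,0)$, $P_i=(i/n,\frac1n\sum_{j\le i}\Delta_{(j)})$. Then $\hat F_n(T_{(i)})$ is the left derivative at $P_i$ of the greatest convex minorant of the points $P_0,\dots,P_n$; elsewhere $\hat F_n$ is the right-continuous step function determined by these values (equal to $0$ on $[0,T_{(1)})$). Kernel: $k$ is a probability density with support $[-1,1]$, symmetric and twice continuously differentiable on $\mathbb{R}$; $m_2(k)=\int u^2k(u)\,du$; $K(t)=\int_{-\infty}^tk(u)\,du$,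 $K_h(u)=K(u/h)$, $k_h(u)=h^{-1}k(u/h)$. The smoothed maximum likelihood estimators are $\hat F_n^{\mathrm{SM}}(t)=\int K_h(t-u)\,d\hat F_n(u)$, $\hat f_n^{\mathrm{SM}}(t)=\int k_h(t-u)\,d\hat F_n(u)$ and $\hat\lambda_n^{\mathrm{SM}}(t)=\hat f_n^{\mathrm{SM}}(t)/(1-\hat F_n^{\mathrm{SM}}(t))$, all with the same bandwidth $h$. The symbol $\rightsquigarrow$ denotes convergence in distribution. *)

theory Defs
  imports "HOL-Probability.Probability"
begin

section \<open>Distribution functions and convergence in distribution\<close>

text \<open>The support of a distribution function, as its set of points of increase.\<close>

definition cdf_support :: "(real \<Rightarrow> real) \<Rightarrow> real set" where
  "cdf_support F = {x. \<forall>\<epsilon>>0. F (x - \<epsilon>) < F (x + \<epsilon>)}"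

definition has_density :: "(real \<Rightarrow> real) \<Rightarrow> (real \<Rightarrow> real) \<Rightarrow> bool" where
  "has_density F f \<longleftrightarrow>
     f \<in> borel_measurable borel \<and> (\<forall>x. 0 \<le> f x) \<and>
     interval_measure F = density lborel (\<lambda>x. ennreal (f x))"

text \<open>Measurability is part of the notion: \<^term>\<open>distr\<close> is only meaningful for
  random variables.\<close>

definition conv_in_distribution ::
    "'a measure \<Rightarrow> (nat \<Rightarrow> 'a \<Rightarrow> real) \<Rightarrow> real measure \<Rightarrow> bool" where
  "conv_in_distribution M Y \<nu> \<longleftrightarrow>
     (\<forall>n. Y n \<in> borel_measurable M) \<and> weak_conv_m (\<lambda>n. distr M borel (Y n)) \<nu>"

text \<open>The second argument is the variance.\<close>

definition normal_law :: "real \<Rightarrow> real \<Rightarrow> real measure" where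
  "normal_law \<mu> v = density lborel (\<lambda>x. ennreal (normal_density \<mu> (sqrt v) x))"


section \<open>The current status model\<close>

text \<open>The observation with number \<open>i + 1\<close> is built from \<open>X i\<close> and \<open>T i\<close>, so that
  the first \<open>n\<close> observations have the indices \<open>0, \<dots>, n - 1\<close>.\<close>

definition current_status_model ::
    "'a measure \<Rightarrow> (nat \<Rightarrow> 'a \<Rightarrow> real) \<Rightarrow> (nat \<Rightarrow> 'a \<Rightarrow> real) \<Rightarrow>
     (real \<Rightarrow> real) \<Rightarrow> (real \<Rightarrow> real) \<Rightarrow> bool" where
  "current_status_model M X T F0 G \<longleftrightarrow>
     prob_space M \<and>
     prob_space.indep_vars M (\<lambda>_. borel) X UNIV \<and>
     prob_space.indep_vars M (\<lambda>_. borel) T UNIV \<and>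
     prob_space.indep_var M
       (PiM UNIV (\<lambda>_::nat. borel)) (\<lambda>\<omega> i. X i \<omega>)
       (PiM UNIV (\<lambda>_::nat. borel)) (\<lambda>\<omega> i. T i \<omega>) \<and>
     (\<forall>i. cdf (distr M borel (X i)) = F0) \<and>
     (\<forall>i. cdf (distr M borel (T i)) = G) \<and>
     (\<forall>x<0. F0 x = 0) \<and> (\<forall>x<0. G x = 0)"

definition condition_F :: "(real \<Rightarrow> real) \<Rightarrow> (real \<Rightarrow> real) \<Rightarrow> real \<Rightarrow> bool" where
  "condition_F F0 f0 M0 \<longleftrightarrow>
     cdf_support F0 = {0..M0} \<and>
     strict_mono_on {0..M0} F0 \<and>
     has_density F0 f0 \<and>
     (\<exists>\<epsilon>>0. \<forall>x\<in>{0..M0}. \<epsilon> \<le> f0 x)"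

text \<open>The derivative of \<open>g\<close> on \<open>[0, M0]\<close> is one-sided at the two end points.\<close>

definition condition_G :: "(real \<Rightarrow> real) \<Rightarrow> (real \<Rightarrow> real) \<Rightarrow> real \<Rightarrow> bool" where
  "condition_G G g M0 \<longleftrightarrow>
     cdf_support G = {0..} \<and>
     strict_mono_on {0..M0} G \<and>
     has_density G g \<and>
     (\<exists>\<epsilon>>0. \<forall>x\<in>{0..M0}. \<epsilon> \<le> g x) \<and>
     (\<exists>g'. (\<forall>x\<in>{0..M0}. (g has_real_derivative g' x) (at x within {0..M0})) \<and>
           bounded (g' ` {0..M0}))"


section \<open>The maximum likelihood estimator\<close>

text \<open>In this section and the next, \<open>\<tau>\<close> and \<open>\<delta>\<close> are a realisation of the
  observation times and of the indicators; only their values at \<open>0, \<dots>, n - 1\<close> matter.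
  The list below contains the indices of the observations by increasing observation time.
  Ties, which have probability zero in the model, are broken by the index.\<close>

definition obs_order :: "nat \<Rightarrow> (nat \<Rightarrow> real) \<Rightarrow> nat list" where
  "obs_order n \<tau> = sort_key \<tau> [0..<n]"

text \<open>The order statistic \<open>T\<^sub>(\<^sub>i\<^sub>)\<close> and the indicator \<open>\<Delta>\<^sub>(\<^sub>i\<^sub>)\<close> that belongs to it,
  for \<open>1 \<le> i \<le> n\<close>.\<close>

definition order_stat :: "nat \<Rightarrow> (nat \<Rightarrow> real) \<Rightarrow> nat \<Rightarrow> real" where
  "order_stat n \<tau> i = \<tau> (obs_order n \<tau> ! (i - 1))"

definition ordered_ind :: "nat \<Rightarrow> (nat \<Rightarrow> real) \<Rightarrow> (nat \<Rightarrow> real) \<Rightarrow> nat \<Rightarrow> real" where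
  "ordered_ind n \<tau> \<delta> i = \<delta> (obs_order n \<tau> ! (i - 1))"

text \<open>The ordinate of the point \<open>P\<^sub>i\<close>, whose abscissa is \<open>i / n\<close>.\<close>

definition cusum :: "nat \<Rightarrow> (nat \<Rightarrow> real) \<Rightarrow> (nat \<Rightarrow> real) \<Rightarrow> nat \<Rightarrow> real" where
  "cusum n \<tau> \<delta> i = (\<Sum>j=1..i. ordered_ind n \<tau> \<delta> j) / real n"

text \<open>The greatest convex minorant on \<open>[0, 1]\<close> of the points \<open>(i / n, y i)\<close>,
  \<open>0 \<le> i \<le> n\<close>.\<close>

definition gcm :: "nat \<Rightarrow> (nat \<Rightarrow> real) \<Rightarrow> real \<Rightarrow> real" where
  "gcm n y x =
     Sup {\<phi> x |\<phi>. convex_on {0..1} \<phi> \<and> (\<forall>i\<le>n. \<phi> (real i / real n) \<le> y i)}"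

definition mle_at :: "nat \<Rightarrow> (nat \<Rightarrow> real) \<Rightarrow> (nat \<Rightarrow> real) \<Rightarrow> nat \<Rightarrow> real" where
  "mle_at n \<tau> \<delta> i =
     vector_derivative (gcm n (cusum n \<tau> \<delta>)) (at_left (real i / real n))"

text \<open>The maximum likelihood estimator vanishes to the left of \<open>T\<^sub>(\<^sub>1\<^sub>)\<close> and is constant
  on each \<open>[T\<^sub>(\<^sub>i\<^sub>), T\<^sub>(\<^sub>i\<^sub>+\<^sub>1\<^sub>))\<close> and on \<open>[T\<^sub>(\<^sub>n\<^sub>), \<infinity>)\<close>. Its total mass may be less than one.\<close>

definition mle :: "nat \<Rightarrow> (nat \<Rightarrow> real) \<Rightarrow> (nat \<Rightarrow> real) \<Rightarrow> real \<Rightarrow> real" where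
  "mle n \<tau> \<delta> x =
     (let I = {i \<in> {1..n}. order_stat n \<tau> i \<le> x}
      in if I = {} then 0 else mle_at n \<tau> \<delta> (Max I))"


section \<open>The smoothed maximum likelihood estimators\<close>

definition smoothing_kernel :: "(real \<Rightarrow> real) \<Rightarrow> bool" where
  "smoothing_kernel k \<longleftrightarrow>
     (\<forall>u. 0 \<le> k u) \<and> (k has_integral 1) UNIV \<and>
     closure {u. k u \<noteq> 0} = {-1..1} \<and>
     (\<forall>u. k (- u) = k u) \<and>
     (\<forall>u. k differentiable (at u)) \<and>
     (\<forall>u. deriv k differentiable (at u)) \<and>
     continuous_on UNIV (deriv (deriv k))"

definition second_moment :: "(real \<Rightarrow> real) \<Rightarrow> real" where
  "second_moment k = (LBINT u. u\<^sup>2 * k u)"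

definition int_kernel :: "(real \<Rightarrow> real) \<Rightarrow> real \<Rightarrow> real" where
  "int_kernel k x = (LBINT u:{..x}. k u)"

definition smle_F :: "(real \<Rightarrow> real) \<Rightarrow> real \<Rightarrow> nat \<Rightarrow> (nat \<Rightarrow> real) \<Rightarrow> (nat \<Rightarrow> real) \<Rightarrow> real \<Rightarrow> real"
  where "smle_F k h n \<tau> \<delta> t =
     (LINT u|interval_measure (mle n \<tau> \<delta>). int_kernel k ((t - u) / h))"

definition smle_f :: "(real \<Rightarrow> real) \<Rightarrow> real \<Rightarrow> nat \<Rightarrow> (nat \<Rightarrow> real) \<Rightarrow> (nat \<Rightarrow> real) \<Rightarrow> real \<Rightarrow> real"
  where "smle_f k h n \<tau> \<delta> t =
     (LINT u|interval_measure (mle n \<tau> \<delta>). k ((t - u) / h) / h)"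

definition smle_hazard ::
    "(real \<Rightarrow> real) \<Rightarrow> real \<Rightarrow> nat \<Rightarrow> (nat \<Rightarrow> real) \<Rightarrow> (nat \<Rightarrow> real) \<Rightarrow> real \<Rightarrow> real"
  where "smle_hazard k h n \<tau> \<delta> t = smle_f k h n \<tau> \<delta> t / (1 - smle_F k h n \<tau> \<delta> t)"

definition hazard :: "(real \<Rightarrow> real) \<Rightarrow> (real \<Rightarrow> real) \<Rightarrow> real \<Rightarrow> real" where
  "hazard F f t = f t / (1 - F t)"


section \<open>Asymptotic bias and variance of the hazard estimator\<close>

definition mu_hazard ::
    "(real \<Rightarrow> real) \<Rightarrow> (real \<Rightarrow> real) \<Rightarrow> (real \<Rightarrow> real) \<Rightarrow> real \<Rightarrow> real \<Rightarrow> real" where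
  "mu_hazard k F0 f0 t c =
     (1 / 2 * c\<^sup>2 * second_moment k) / (1 - F0 t) *
     (deriv (deriv f0) t + f0 t * deriv f0 t / (1 - F0 t))"

definition var_hazard ::
    "(real \<Rightarrow> real) \<Rightarrow> (real \<Rightarrow> real) \<Rightarrow> (real \<Rightarrow> real) \<Rightarrow> real \<Rightarrow> real \<Rightarrow> real" where
  "var_hazard k F0 g t c =
     F0 t / (c ^ 3 * g t * (1 - F0 t)) * (LBINT u. (deriv k u)\<^sup>2)"

definition amse_hazard ::
    "(real \<Rightarrow> real) \<Rightarrow> (real \<Rightarrow> real) \<Rightarrow> (real \<Rightarrow> real) \<Rightarrow> (real \<Rightarrow> real) \<Rightarrow> real \<Rightarrow> real \<Rightarrow> real"
  where "amse_hazard k F0 f0 g t c = (mu_hazard k F0 f0 t c)\<^sup>2 + var_hazard k F0 g t c"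

definition c_hazard ::
    "(real \<Rightarrow> real) \<Rightarrow> (real \<Rightarrow> real) \<Rightarrow> (real \<Rightarrow> real) \<Rightarrow> (real \<Rightarrow> real) \<Rightarrow> real \<Rightarrow> real"
  where "c_hazard k F0 f0 g t =
     (3 * (F0 t / (g t * (1 - F0 t))) * (LBINT u. (deriv k u)\<^sup>2)) powr (1 / 7) *
     ((second_moment k)\<^sup>2 / (1 - F0 t)\<^sup>2 *
        (deriv (deriv f0) t + f0 t * deriv f0 t / (1 - F0 t))\<^sup>2) powr (- 1 / 7)"

definition bandwidth :: "real \<Rightarrow> nat \<Rightarrow> real" where
  "bandwidth c n = c * real n powr (- 1 / 7)"

text \<open>A bandwidth sequence is aMSE-optimal if it is of the form \<open>c n\<^sup>-\<^sup>1\<^sup>/\<^sup>7\<close>, with a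
  \<open>c > 0\<close> that minimises the asymptotic mean squared error.\<close>

definition amse_optimal_bandwidth ::
    "(real \<Rightarrow> real) \<Rightarrow> (real \<Rightarrow> real) \<Rightarrow> (real \<Rightarrow> real) \<Rightarrow> (real \<Rightarrow> real) \<Rightarrow> real \<Rightarrow>
     (nat \<Rightarrow> real) \<Rightarrow> bool"
  where "amse_optimal_bandwidth k F0 f0 g t h \<longleftrightarrow>
     (\<exists>c. h = bandwidth c \<and> is_arg_min (amse_hazard k F0 f0 g t) (\<lambda>c. c > 0) c)"

end

theory Submission
  imports Defs "HOL-Real_Asymp.Real_Asymp"
begin


text \<open>Write \<open>F\<close> for the maximum likelihood estimator, \<open>F0\<close> for the true distribution function, \<open>P\<close> for the law of the
observation times and \<open>h = c n\<^sup>-\<^sup>1\<^sup>/\<^sup>7\<close>. Since \<open>n\<^sup>2\<^sup>/\<^sup>7 = c\<^sup>2 / h\<^sup>2\<close>, everything of smaller order than \<open>h\<^sup>2\<close> is negligible.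

\<^bold>\<open>Linearisation.\<close> Integration by parts turns the smoothed estimators into \<open>(1/h) \<integral> k'(w) F(t - h w) dw\<close> and
\<open>\<integral> k(w) F(t - h w) dw\<close>. With \<open>F0\<close> in place of \<open>F\<close> these integrals produce the bias (\<open>bias_f\<close>, \<open>bias_F\<close>, a
Taylor expansion). The difference for the density is \<open>\<integral> \<theta> (F - F0) dP\<close> with the weight \<open>\<theta>\<close> proportional to
\<open>k'((t - u)/h) / (h\<^sup>2 g(u))\<close>. Up to the term \<open>residual \<theta>\<close> it equals the average of \<open>\<theta>(T\<^sub>i) (\<Delta>\<^sub>i - F0(T\<^sub>i))\<close>, a sum of
independent centred variables to which the central limit theorem for triangular arrays applies. The smoothed
distribution function only contributes its bias, because \<open>F - F0\<close> is of smaller order than \<open>h\<^sup>2\<close> uniformly near \<open>t\<close>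
(\<open>mle_rate\<close>). The hazard rate then follows by linearising the quotient.

\<^bold>\<open>The residual.\<close> Summation by parts (\<open>residual_lipschitz\<close>) reduces \<open>residual \<theta>\<close> to the residuals of indicators of
intervals \<open>(a, v]\<close>. Such a residual is the sum of two terms. The first is the integral of \<open>F - F0\<close> over \<open>(a, v]\<close>
against the difference between \<open>P\<close> and the empirical measure; as \<open>F\<close> and \<open>F0\<close> are monotone and vary by \<open>O(h)\<close> only,
a layer cake argument bounds it by \<open>h\<close> times the deviation of the empirical measure on intervals. The second is the
distance between the cumulative sum diagram and its greatest convex minorant. On a linear piece of the minorant \<open>F\<close> is
constant; as \<open>F0\<close> increases with positive slope and \<open>F\<close> is close to \<open>F0\<close>, linear pieces are short, so this distance is
after division by \<open>n\<close>, nearly of order \<open>n\<^sup>-\<^sup>2\<^sup>/\<^sup>3\<close> (\<open>cusum_gap_bound\<close>). 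

\<^bold>\<open>The random input.\<close> All bounds above are deterministic consequences of one event: for every interval \<open>A\<close>, both
the number of observation times in \<open>A\<close> and the sum of \<open>\<Delta>\<^sub>i - F0(T\<^sub>i)\<close> over them deviate from their means by at most
\<open>\<kappa> (sqrt(n P(A)) + 1)\<close> (locale \<open>sample_modulus\<close>). A Bernstein type inequality for the unions of consecutive cells of
a partition into \<open>n\<close> cells of equal probability shows that this event has probability tending to one even if \<open>\<kappa>\<close> grows
as slowly as a small power of \<open>n\<close> (\<open>prob_good\<close>, \<open>sample_modulus_good\<close>).\<close>

section \<open>The greatest convex minorant of a cumulative sum diagram\<close>

lemma gcm_bdd_above:
  assumes n: "n > 0" and x: "x \<in> {0..1}"
  shows "bdd_above {\<phi> x |\<phi>. convex_on {0..1} \<phi> \<and> (\<forall>i\<le>n. \<phi> (real i / real n) \<le> y i)}"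
proof (rule bdd_aboveI, safe)
  fix \<phi> :: "real \<Rightarrow> real" assume c: "convex_on {0..1} \<phi>" and b: "\<forall>i\<le>n. \<phi> (real i / real n) \<le> y i"
  have "\<phi> ((1 - x) *\<^sub>R 0 + x *\<^sub>R 1) \<le> (1 - x) * \<phi> 0 + x * \<phi> 1"
    using x by (intro convex_onD[OF c]) auto
  also have "\<dots> \<le> (1 - x) * y 0 + x * y n"
    using x b[rule_format, of 0] b[rule_format, of n] n
    by (intro add_mono mult_left_mono) auto
  finally show "\<phi> x \<le> (1 - x) * y 0 + x * y n" by simp
qed

lemma gcm_upper:
  assumes n: "n > 0" and x: "x \<in> {0..1}" and "convex_on {0..1} \<phi>" "\<And>i. i \<le> n \<Longrightarrow> \<phi> (real i / real n) \<le> y i"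
  shows "\<phi> x \<le> gcm n y x"
  unfolding gcm_def by (rule cSup_upper[OF _ gcm_bdd_above[OF n x]]) (use assms in blast)

text \<open>Lower bounds for the minorant are obtained by exhibiting a suitable line under the points.\<close>

lemma affine_le_gcm:
  assumes n: "n > 0" and x: "x \<in> {0..1}" and "\<And>i. i \<le> n \<Longrightarrow> \<alpha> + \<beta> * (real i / real n) \<le> y i"
  shows "\<alpha> + \<beta> * x \<le> gcm n y x"
proof -
  have "convex_on {0..1} (\<lambda>x::real. \<alpha> + \<beta> * x)"
    by (rule convex_onI) (auto simp: algebra_simps)
  from gcm_upper[OF n x this, of y] assms show ?thesis by blast
qed

lemma gcm_least:
  assumes n: "n > 0" and "\<And>\<phi>. convex_on {0..1} \<phi> \<Longrightarrow> (\<And>i. i \<le> n \<Longrightarrow> \<phi> (real i / real n) \<le> y i) \<Longrightarrow> \<phi> x \<le> u"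
  shows "gcm n y x \<le> u"
  unfolding gcm_def
proof (rule cSup_least)
  have "convex_on {0..1} (\<lambda>x::real. Min (y ` {..n}))"
    by (rule convex_onI) (auto simp: algebra_simps)
  then show "{\<phi> x |\<phi>. convex_on {0..1} \<phi> \<and> (\<forall>i\<le>n. \<phi> (real i / real n) \<le> y i)} \<noteq> {}"
    by (auto intro!: exI[of _ "\<lambda>x. Min (y ` {..n})"])
qed (use assms in blast)

lemma gcm_le_points:
  assumes "n > 0" "i \<le> n" shows "gcm n y (real i / real n) \<le> y i"
  using assms by (intro gcm_least) auto

lemma convex_on_gcm:
  assumes n: "n > 0" shows "convex_on {0..1} (gcm n y)"
proof (rule convex_onI)
  fix s x z :: real assume s: "0 < s" "s < 1" and x: "x \<in> {0..1}" and z: "z \<in> {0..1}"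
  show "gcm n y ((1 - s) *\<^sub>R x + s *\<^sub>R z) \<le> (1 - s) * gcm n y x + s * gcm n y z"
  proof (rule gcm_least[OF n])
    fix \<phi> :: "real \<Rightarrow> real" assume c: "convex_on {0..1} \<phi>" and b: "\<And>i. i \<le> n \<Longrightarrow> \<phi> (real i / real n) \<le> y i"
    have "\<phi> ((1 - s) *\<^sub>R x + s *\<^sub>R z) \<le> (1 - s) * \<phi> x + s * \<phi> z"
      using s x z by (intro convex_onD[OF c]) auto
    also have "\<dots> \<le> (1 - s) * gcm n y x + s * gcm n y z"
      using s gcm_upper[OF n x c b] gcm_upper[OF n z c b] by (intro add_mono mult_left_mono) auto
    finally show "\<phi> ((1 - s) *\<^sub>R x + s *\<^sub>R z) \<le> (1 - s) * gcm n y x + s * gcm n y z" .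
  qed
qed simp

text \<open>Everything about the minorant is read off from its increments between neighbouring
  abscissae, which are, up to the factor \<open>n\<close>, its left derivatives.\<close>

definition gcm_step :: "nat \<Rightarrow> (nat \<Rightarrow> real) \<Rightarrow> nat \<Rightarrow> real" where
  "gcm_step n y i = gcm n y (real i / real n) - gcm n y (real (i - 1) / real n)"

lemma gcm_step_mono_Suc:
  assumes "0 < i" "i < n" shows "gcm_step n y i \<le> gcm_step n y (Suc i)"
proof -
  have "gcm n y ((1 - 1/2) *\<^sub>R (real (i-1) / n) + (1/2) *\<^sub>R (real (Suc i) / n))
      \<le> (1 - 1/2) * gcm n y (real (i-1) / n) + (1/2) * gcm n y (real (Suc i) / n)"
    using assms by (intro convex_onD[OF convex_on_gcm]) auto
  also have "(1 - 1/2) *\<^sub>R (real (i-1) / n) + (1/2) *\<^sub>R (real (Suc i) / n) = real i / n"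
    using assms by (simp add: field_simps of_nat_diff)
  finally show ?thesis by (simp add: gcm_step_def)
qed

lemma gcm_step_mono:
  assumes "0 < i" "i \<le> j" "j \<le> n" shows "gcm_step n y i \<le> gcm_step n y j"
  using assms(2,3)
proof (induction j rule: dec_induct)
  case (step j)
  then show ?case using gcm_step_mono_Suc[of j n y] assms by auto
qed simp

lemma gcm_diff_sum:
  assumes "i \<le> j"
  shows "gcm n y (real j / real n) - gcm n y (real i / real n) = (\<Sum>l\<in>{i<..j}. gcm_step n y l)"
  using assms
proof (induction j rule: dec_induct)
  case (step j)
  have "{i<..Suc j} = insert (Suc j) {i<..j}" using step by auto
  then show ?case using step by (simp add: gcm_step_def)
qed simp

text \<open>Convexity in the form in which it is used: the increments are monotone, so a line through a vertex
  whose slope lies between the two neighbouring increments stays below the minorant.\<close>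

lemma gcm_support_line:
  assumes i: "i \<le> n" and k: "k \<le> n"
    and up: "i < n \<Longrightarrow> s \<le> gcm_step n y (Suc i)" and lo: "0 < i \<Longrightarrow> gcm_step n y i \<le> s"
  shows "gcm n y (real i / real n) + (real k - real i) * s \<le> gcm n y (real k / real n)"
proof (cases "i \<le> k")
  case True
  have "(real k - real i) * s = (\<Sum>l\<in>{i<..k}. s)" using True by (simp add: of_nat_diff)
  also have "\<dots> \<le> (\<Sum>l\<in>{i<..k}. gcm_step n y l)"
  proof (rule sum_mono)
    fix l assume "l \<in> {i<..k}"
    then show "s \<le> gcm_step n y l"
      using up gcm_step_mono[of "Suc i" l n y] k by force
  qed
  finally show ?thesis using gcm_diff_sum[OF True, of n y] by linarith
next
  case False
  have "(\<Sum>l\<in>{k<..i}. gcm_step n y l) \<le> (\<Sum>l\<in>{k<..i}. s)"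
  proof (rule sum_mono)
    fix l assume "l \<in> {k<..i}"
    then show "gcm_step n y l \<le> s"
      using lo gcm_step_mono[of l i n y] i by force
  qed
  also have "\<dots> = (real i - real k) * s" using False by (simp add: of_nat_diff)
  finally show ?thesis using gcm_diff_sum[of k i n y] False by (simp add: algebra_simps)
qed

text \<open>The line that extends the piece between two neighbouring abscissae supports the minorant there, hence lies
below all points; so the minorant is not smaller than this line, and by convexity not larger.\<close>

lemma gcm_affine_between:
  assumes i: "0 < i" "i \<le> n" and x: "real (i - 1) / real n \<le> x" "x \<le> real i / real n"
  shows "gcm n y x = gcm n y (real i / real n) + (x - real i / real n) * (real n * gcm_step n y i)"
    (is "_ = ?l x")
proof (rule antisym)
  have n: "n > 0" using i by simp
  have x01: "x \<in> {0..1}" using x i by (auto intro: order_trans[OF _ x(1)] order_trans[OF x(2)])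
  have "(gcm n y (real i / n) - real i * gcm_step n y i) + (real n * gcm_step n y i) * x \<le> gcm n y x"
  proof (rule affine_le_gcm[OF n x01])
    fix k assume k: "k \<le> n"
    have "gcm n y (real i / n) + (real k - real i) * gcm_step n y i \<le> gcm n y (real k / n)"
      by (rule gcm_support_line[OF i(2) k]) (use i gcm_step_mono_Suc in auto)
    also have "\<dots> \<le> y k" by (rule gcm_le_points[OF n k])
    finally show "gcm n y (real i / n) - real i * gcm_step n y i + real n * gcm_step n y i * (real k / n) \<le> y k"
      using n by (simp add: algebra_simps)
  qed
  then show "?l x \<le> gcm n y x" using n by (simp add: algebra_simps)
  define s where "s = real n * x - real (i - 1)"
  have s: "0 \<le> s" "s \<le> 1" using x n i by (auto simp: s_def field_simps of_nat_diff)
  have "gcm n y ((1 - s) *\<^sub>R (real (i-1) / n) + s *\<^sub>R (real i / n))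
      \<le> (1 - s) * gcm n y (real (i-1) / n) + s * gcm n y (real i / n)"
    using s i by (intro convex_onD[OF convex_on_gcm[OF n]]) auto
  also have "(1 - s) *\<^sub>R (real (i-1) / n) + s *\<^sub>R (real i / n) = x"
    using n i by (simp add: s_def field_simps of_nat_diff)
  also have "(1 - s) * gcm n y (real (i-1) / n) + s * gcm n y (real i / n) = ?l x"
    using n i by (simp add: s_def gcm_step_def field_simps of_nat_diff)
  finally show "gcm n y x \<le> ?l x" .
qed

lemma left_derivative_gcm:
  assumes i: "0 < i" "i \<le> n"
  shows "vector_derivative (gcm n y) (at_left (real i / real n)) = real n * gcm_step n y i"
proof (rule vector_derivative_within)
  let ?x = "real i / real n" and ?l = "\<lambda>x. gcm n y (real i / real n) + (x - real i / real n) * (real n * gcm_step n y i)"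
  show "at_left ?x \<noteq> bot" by simp
  have "(?l has_vector_derivative real n * gcm_step n y i) (at_left ?x)"
    unfolding has_real_derivative_iff_has_vector_derivative[symmetric] by (auto intro!: derivative_eq_intros)
  moreover have "\<forall>\<^sub>F x in nhds ?x. x \<in> {..<?x} \<longrightarrow> gcm n y x = ?l x"
    unfolding eventually_nhds_metric
  proof (intro exI[of _ "1 / real n"] conjI allI impI)
    show "0 < 1 / real n" using i by simp
    fix x assume x: "dist x ?x < 1 / real n" "x \<in> {..<?x}"
    have "real (i - 1) / n = ?x - 1 / n" using i by (simp add: of_nat_diff field_simps)
    moreover have "\<bar>x - ?x\<bar> < 1 / real n" "x < ?x" using x unfolding dist_real_def by auto
    ultimately have "real (i - 1) / n \<le> x" "x \<le> ?x" by linarith+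
    then show "gcm n y x = ?l x" by (rule gcm_affine_between[OF i])
  qed
  ultimately show "(gcm n y has_vector_derivative real n * gcm_step n y i) (at_left ?x)"
    by (subst has_vector_derivative_cong_ev[where g="?l"]) auto
qed

text \<open>At the two ends a sufficiently steep line through the end point passes below all other points.\<close>

lemma gcm_left_end:
  assumes n: "n > 0" shows "gcm n y 0 = y 0"
proof (rule antisym)
  show "gcm n y 0 \<le> y 0" using gcm_le_points[OF n, of 0 y] by simp
  \<comment> \<open>The abscissae are \<open>1 / n\<close> apart, so this slope suffices to get below all points.\<close>
  define K where "K = real n * (\<Sum>i\<le>n. \<bar>y i\<bar> + \<bar>y 0\<bar>)"
  have "y 0 + (- K) * 0 \<le> gcm n y 0"
  proof (rule affine_le_gcm[OF n])
    fix i assume i: "i \<le> n"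
    show "y 0 + (- K) * (real i / n) \<le> y i"
    proof (cases "i = 0")
      case False
      have "\<bar>y i\<bar> + \<bar>y 0\<bar> \<le> (\<Sum>i\<le>n. \<bar>y i\<bar> + \<bar>y 0\<bar>)"
        by (rule member_le_sum) (use i in auto)
      also have "\<dots> \<le> real i * (\<Sum>i\<le>n. \<bar>y i\<bar> + \<bar>y 0\<bar>)"
        using False by (intro order_trans[OF _ mult_right_mono[of 1 "real i"]]) (auto intro: sum_nonneg)
      also have "\<dots> = K * (real i / n)" using n by (simp add: K_def)
      finally show ?thesis by linarith
    qed simp
  qed simp
  then show "y 0 \<le> gcm n y 0" by simp
qed

lemma gcm_right_end:
  assumes n: "n > 0" shows "gcm n y 1 = y n"
proof (rule antisym)
  show "gcm n y 1 \<le> y n" using gcm_le_points[OF n, of n y] n by simp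
  define K where "K = real n * (\<Sum>i\<le>n. \<bar>y i\<bar> + \<bar>y n\<bar>)"
  have "(y n - K) + K * 1 \<le> gcm n y 1"
  proof (rule affine_le_gcm[OF n])
    fix i assume i: "i \<le> n"
    show "(y n - K) + K * (real i / n) \<le> y i"
    proof (cases "i = n")
      case False
      have "\<bar>y i\<bar> + \<bar>y n\<bar> \<le> (\<Sum>i\<le>n. \<bar>y i\<bar> + \<bar>y n\<bar>)"
        by (rule member_le_sum) (use i in auto)
      also have "\<dots> \<le> real (n - i) * (\<Sum>i\<le>n. \<bar>y i\<bar> + \<bar>y n\<bar>)"
        using False i by (intro order_trans[OF _ mult_right_mono[of 1 "real (n - i)"]]) (auto intro: sum_nonneg)
      also have "\<dots> = K - K * (real i / n)" using n i by (simp add: K_def of_nat_diff field_simps)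
      finally show ?thesis by linarith
    qed (use n in simp)
  qed simp
  then show "y n \<le> gcm n y 1" by simp
qed

text \<open>Away from the points the minorant has no kink: otherwise a line of intermediate slope through
  a point slightly above the vertex would still lie below all points.\<close>

lemma gcm_no_kink:
  assumes i: "0 < i" "i < n" and below: "gcm n y (real i / real n) < y i"
  shows "gcm_step n y (Suc i) = gcm_step n y i"
proof (rule ccontr)
  assume "gcm_step n y (Suc i) \<noteq> gcm_step n y i"
  with gcm_step_mono_Suc[OF i, of y] have lt: "gcm_step n y i < gcm_step n y (Suc i)" by simp
  define u where "u = (gcm_step n y (Suc i) - gcm_step n y i) / 2"
  define s where "s = gcm_step n y i + u"
  define d where "d = min u (y i - gcm n y (real i / n))"
  have "0 < u" using lt by (simp add: u_def)
  then have d: "0 < d" "d \<le> u" using below by (simp_all add: d_def)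
  have "d \<le> y i - gcm n y (real i / n)" unfolding d_def by (rule min.cobounded2)
  then have d': "gcm n y (real i / n) + d \<le> y i" by linarith
  have n: "n > 0" using i by simp
  have "(gcm n y (real i / n) + d - real i * s) + (real n * s) * (real i / n) \<le> gcm n y (real i / n)"
  proof (rule affine_le_gcm[OF n])
    show "real i / n \<in> {0..1}" using i by simp
    fix k assume k: "k \<le> n"
    show "(gcm n y (real i / n) + d - real i * s) + (real n * s) * (real k / n) \<le> y k"
    proof (cases "k = i")
      case True then show ?thesis using d' n by simp
    next
      case False
      have "gcm n y (real i / n) + d + (real k - real i) * s \<le> gcm n y (real k / n)"
      proof (cases "i < k")
        case True
        have "gcm n y (real i / n) + (real k - real i) * (s + u) \<le> gcm n y (real k / n)"
          by (rule gcm_support_line) (use i k lt in \<open>auto simp: s_def u_def field_simps\<close>)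
        moreover have "d \<le> (real k - real i) * u"
          using True d by (intro order_trans[OF _ mult_right_mono[of 1 "real k - real i"]]) auto
        ultimately show ?thesis by (simp add: algebra_simps)
      next
        case f: False
        have "gcm n y (real i / n) + (real k - real i) * (s - u) \<le> gcm n y (real k / n)"
          by (rule gcm_support_line) (use i k lt in \<open>auto simp: s_def u_def field_simps\<close>)
        moreover have "d \<le> (real i - real k) * u"
          using f False d by (intro order_trans[OF _ mult_right_mono[of 1 "real i - real k"]]) auto
        ultimately show ?thesis by (simp add: algebra_simps)
      qed
      also have "\<dots> \<le> y k" by (rule gcm_le_points[OF n k])
      finally show ?thesis using n by (simp add: algebra_simps)
    qed
  qed
  then show False using d n by simp
qed

text \<open>The blocks are the linear pieces: between two neighbouring points touched by the minorant there is no
  kink.\<close>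

lemma gcm_block:
  assumes i: "0 < i" "i \<le> n"
  obtains a b where "a < i" "i \<le> b" "b \<le> n"
    "gcm n y (real a / real n) = y a" "gcm n y (real b / real n) = y b"
    "\<And>j. a < j \<Longrightarrow> j \<le> b \<Longrightarrow> gcm_step n y j = gcm_step n y i"
proof -
  have n: "n > 0" using i by simp
  define A where "A = {a. a < i \<and> gcm n y (real a / n) = y a}"
  define B where "B = {b. i \<le> b \<and> b \<le> n \<and> gcm n y (real b / n) = y b}"
  have fA: "finite A" and "0 \<in> A" using i gcm_left_end[OF n] by (auto simp: A_def)
  have fB: "finite B" and "n \<in> B" using i gcm_right_end[OF n] n by (auto simp: B_def)
  have A: "Max A \<in> A" using fA \<open>0 \<in> A\<close> by (intro Max_in) auto
  have B: "Min B \<in> B" using fB \<open>n \<in> B\<close> by (intro Min_in) auto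
  have nt: "gcm n y (real j / n) < y j" if "Max A < j" "j < Min B" for j
  proof -
    have "j \<notin> A" using that Max_ge[OF fA, of j] by auto
    moreover have "j \<notin> B" using that Min_le[OF fB, of j] by auto
    moreover have "j \<le> n" using that B by (auto simp: B_def)
    ultimately show ?thesis using gcm_le_points[OF n, of j y] by (auto simp: A_def B_def)
  qed
  have step: "gcm_step n y j = gcm_step n y (Suc (Max A))" if "Suc (Max A) \<le> j" "j \<le> Min B" for j
    using that
  proof (induction j rule: dec_induct)
    case (step j)
    then show ?case using gcm_no_kink[of j n y] nt[of j] B by (auto simp: B_def)
  qed simp
  show ?thesis
  proof (rule that[of "Max A" "Min B"])
    fix j assume "Max A < j" "j \<le> Min B"
    then show "gcm_step n y j = gcm_step n y i"
      using step[of j] step[of i] A B by (auto simp: A_def B_def)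
  qed (use A B in \<open>auto simp: A_def B_def\<close>)
qed


text \<open>At the left end of a block the minorant touches the points and afterwards it has at least the slope of the
block, while all points lie above it; this bounds averages from the left end from below, and averages up to
the right end from above.\<close>

lemma gcm_block_bounds:
  assumes i: "0 < i" "i \<le> n"
  obtains a b where "a < i" "i \<le> b" "b \<le> n"
    "gcm n y (real a / real n) = y a"
    "\<And>j. a < j \<Longrightarrow> j \<le> b \<Longrightarrow> gcm_step n y j = gcm_step n y i"
    "\<And>m. a \<le> m \<Longrightarrow> m \<le> n \<Longrightarrow> gcm_step n y i * (real m - real a) \<le> y m - y a"
    "\<And>m. m \<le> b \<Longrightarrow> y b - y m \<le> gcm_step n y i * (real b - real m)"
proof -
  have n: "n > 0" using i by simp
  from gcm_block[OF i, of y] obtain a b where ab: "a < i" "i \<le> b" "b \<le> n"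
    "gcm n y (real a / real n) = y a" "gcm n y (real b / real n) = y b"
    and st: "\<And>j. a < j \<Longrightarrow> j \<le> b \<Longrightarrow> gcm_step n y j = gcm_step n y i" by blast
  have A: "gcm n y (real a / n) + (real m - real a) * gcm_step n y i \<le> gcm n y (real m / n)"
    if "m \<le> n" for m
    by (rule gcm_support_line) (use ab that st[of "Suc a"] gcm_step_mono[of a i n y] in auto)
  have B: "gcm n y (real b / n) + (real m - real b) * gcm_step n y i \<le> gcm n y (real m / n)"
    if "m \<le> n" for m
    by (rule gcm_support_line) (use ab that st[of b] gcm_step_mono[of i "Suc b" n y] in auto)
  note P = gcm_le_points[OF n, of _ y]
  have m: "gcm_step n y i * (real m - real a) \<le> y m - y a"
      "y b - y m \<le> gcm_step n y i * (real b - real m)" if "m \<le> n" for m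
  proof -
    show "gcm_step n y i * (real m - real a) \<le> y m - y a"
      using A[OF that] P[OF that] ab by (simp add: mult.commute)
    show "y b - y m \<le> gcm_step n y i * (real b - real m)"
      using B[OF that] P[OF that] ab by (simp add: algebra_simps)
  qed
  show ?thesis by (rule that[OF ab(1-4) st]) (use m ab in auto)
qed

text \<open>The two ends of the block around \<open>i\<close> attain the maximum and the minimum. The formula serves to show
  that the estimator is measurable.\<close>

lemma gcm_step_max_min:
  assumes i: "0 < i" "i \<le> n"
  shows "gcm_step n y i =
    Max ((\<lambda>a. Min ((\<lambda>m. (y m - y a) / (real m - real a)) ` {i..n})) ` {..<i})" (is "_ = ?R")
proof -
  obtain a b where ab: "a < i" "i \<le> b" "b \<le> n"
    and lo: "\<And>m. a \<le> m \<Longrightarrow> m \<le> n \<Longrightarrow> gcm_step n y i * (real m - real a) \<le> y m - y a"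
    and up: "\<And>m. m \<le> b \<Longrightarrow> y b - y m \<le> gcm_step n y i * (real b - real m)"
    using gcm_block_bounds[OF i, of y] by metis
  show ?thesis
  proof (rule antisym)
    have "gcm_step n y i \<le> Min ((\<lambda>m. (y m - y a) / (real m - real a)) ` {i..n})"
      using ab lo by (intro Min.boundedI) (auto simp: field_simps)
    also have "\<dots> \<le> ?R" using ab by (intro Max_ge) auto
    finally show "gcm_step n y i \<le> ?R" .
    show "?R \<le> gcm_step n y i"
    proof (rule Max.boundedI)
      fix z assume "z \<in> (\<lambda>a. Min ((\<lambda>m. (y m - y a) / (real m - real a)) ` {i..n})) ` {..<i}"
      then obtain a' where a': "a' < i" and z: "z = Min ((\<lambda>m. (y m - y a') / (real m - real a')) ` {i..n})" by auto
      have "z \<le> (y b - y a') / (real b - real a')" unfolding z using ab by (intro Min_le) auto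
      also have "\<dots> \<le> gcm_step n y i" using up[of a'] a' ab by (simp add: field_simps)
      finally show "z \<le> gcm_step n y i" .
    qed (use i in auto)
  qed
qed

section \<open>The maximum likelihood estimator as a function of time\<close>

text \<open>The index at which the estimator at \<open>x\<close> reads off the
slope of the minorant, so that sums over order statistics become sums over observation times.\<close>

definition num_le :: "nat \<Rightarrow> (nat \<Rightarrow> real) \<Rightarrow> real \<Rightarrow> nat" where
  "num_le n \<tau> x = card {i. i < n \<and> \<tau> i \<le> x}"

lemma down_closed_nat_set:
  fixes S :: "nat set"
  assumes "finite S" "\<And>i j. i \<in> S \<Longrightarrow> j < i \<Longrightarrow> j \<in> S"
  shows "S = {..<card S}"
proof (cases "S = {}")
  case False
  have "S = {..Max S}"
    using assms Max_in[OF assms(1) False] by (auto simp: le_less) (metis Max_ge less_le_not_le linorder_neqE_nat)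
  then have "S = {..<Suc (Max S)}" by (simp add: lessThan_Suc_atMost)
  then show ?thesis by (metis card_lessThan)
qed simp

lemma obs_order_simps [simp]:
  "length (obs_order n \<tau>) = n" "set (obs_order n \<tau>) = {..<n}" "distinct (obs_order n \<tau>)"
  by (auto simp: obs_order_def)

lemma obs_order_sorted:
  assumes "l \<le> m" "m < n" shows "\<tau> (obs_order n \<tau> ! l) \<le> \<tau> (obs_order n \<tau> ! m)"
  using sorted_nth_mono[of "map \<tau> (obs_order n \<tau>)" l m] assms by (simp add: obs_order_def)

lemma obs_order_bij: "bij_betw (\<lambda>l. obs_order n \<tau> ! l) {..<n} {..<n}"
  by (rule bij_betw_nth) auto

lemma obs_order_less: "l < n \<Longrightarrow> obs_order n \<tau> ! l < n"
  using obs_order_bij[of n \<tau>] by (auto simp: bij_betw_def)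

lemma sum_obs_order: "(\<Sum>i<n. F i) = (\<Sum>l<n. F (obs_order n \<tau> ! l))"
  by (rule sum.reindex_bij_betw[OF obs_order_bij, symmetric])

text \<open>Along the sorted list the times up to \<open>x\<close> form an initial segment, also in the presence of ties.\<close>

lemma less_num_le_iff:
  assumes "l < n" shows "l < num_le n \<tau> x \<longleftrightarrow> \<tau> (obs_order n \<tau> ! l) \<le> x"
proof -
  define S where "S = {l. l < n \<and> \<tau> (obs_order n \<tau> ! l) \<le> x}"
  have "S = {..<card S}"
  proof (rule down_closed_nat_set)
    fix i j assume "i \<in> S" "j < i"
    then show "j \<in> S" using obs_order_sorted[of j i n \<tau>] by (auto simp: S_def)
  qed (simp add: S_def)
  moreover have "card S = num_le n \<tau> x"
    unfolding num_le_def
  proof (rule bij_betw_same_card)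
    show "bij_betw (\<lambda>l. obs_order n \<tau> ! l) S {i. i < n \<and> \<tau> i \<le> x}"
      using obs_order_bij[of n \<tau>] unfolding bij_betw_def S_def
      by (auto simp: inj_on_def image_iff)
  qed
  ultimately show ?thesis using assms by (auto simp: S_def)
qed

lemma num_le_le: "num_le n \<tau> x \<le> n"
  unfolding num_le_def using card_mono[of "{..<n}" "{i. i < n \<and> \<tau> i \<le> x}"] by auto

lemma num_le_mono: "x \<le> z \<Longrightarrow> num_le n \<tau> x \<le> num_le n \<tau> z"
  unfolding num_le_def by (intro card_mono) auto

lemma mle_eq_num_le: "mle n \<tau> \<delta> x = (if num_le n \<tau> x = 0 then 0 else mle_at n \<tau> \<delta> (num_le n \<tau> x))"
proof -
  have "{i \<in> {1..n}. order_stat n \<tau> i \<le> x} = {1..num_le n \<tau> x}"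
    using less_num_le_iff[of "_ - 1" n \<tau> x] num_le_le[of n \<tau> x]
    by (auto simp: order_stat_def) (metis Suc_le_eq Suc_pred diff_less le_eq_less_or_eq less_one not_less zero_less_one order_less_le_trans)+
  moreover have "Max {1..m} = m" if "m > 0" for m :: nat using that by (intro Max_eqI) auto
  ultimately show ?thesis by (simp add: mle_def Let_def del: One_nat_def)
qed

lemma mle_at_eq_step:
  "0 < i \<Longrightarrow> i \<le> n \<Longrightarrow> mle_at n \<tau> \<delta> i = real n * gcm_step n (cusum n \<tau> \<delta>) i"
  unfolding mle_at_def by (rule left_derivative_gcm)

lemma cusum_eq: "cusum n \<tau> \<delta> i = (\<Sum>l<i. \<delta> (obs_order n \<tau> ! l)) / real n"
proof -
  have "(\<Sum>j=1..i. ordered_ind n \<tau> \<delta> j) = (\<Sum>l<i. \<delta> (obs_order n \<tau> ! l))"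
    unfolding ordered_ind_def
    by (rule sum.reindex_bij_witness[where i = Suc and j = "\<lambda>j. j - 1"]) auto
  then show ?thesis by (simp add: cusum_def)
qed

lemma cusum_diff:
  assumes "a \<le> m" "n > 0"
  shows "real n * (cusum n \<tau> \<delta> m - cusum n \<tau> \<delta> a) = (\<Sum>l\<in>{a..<m}. \<delta> (obs_order n \<tau> ! l))"
proof -
  have "{..<m} = {..<a} \<union> {a..<m}" using assms by auto
  then have "(\<Sum>l<m. \<delta> (obs_order n \<tau> ! l)) = (\<Sum>l<a. \<delta> (obs_order n \<tau> ! l)) + (\<Sum>l\<in>{a..<m}. \<delta> (obs_order n \<tau> ! l))"
    by (simp add: sum.union_disjoint ivl_disj_int)
  then show ?thesis using assms by (simp add: cusum_eq field_simps)
qed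

lemma mle_at_bounds:
  assumes i: "0 < i" "i \<le> n" and \<delta>: "\<And>i. i < n \<Longrightarrow> 0 \<le> \<delta> i \<and> \<delta> i \<le> 1"
  shows "0 \<le> mle_at n \<tau> \<delta> i" "mle_at n \<tau> \<delta> i \<le> 1"
proof -
  let ?y = "cusum n \<tau> \<delta>"
  have n: "n > 0" using i by simp
  obtain a b where ab: "a < i" "i \<le> b" "b \<le> n"
    and lo: "\<And>m. a \<le> m \<Longrightarrow> m \<le> n \<Longrightarrow> gcm_step n ?y i * (real m - real a) \<le> ?y m - ?y a"
    and up: "\<And>m. m \<le> b \<Longrightarrow> ?y b - ?y m \<le> gcm_step n ?y i * (real b - real m)"
    using gcm_block_bounds[OF i, of ?y] by metis
  note \<delta>' = \<delta>[OF obs_order_less]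
  have "0 \<le> (\<Sum>l\<in>{(i-1)..<b}. \<delta> (obs_order n \<tau> ! l))"
    using ab \<delta>' by (intro sum_nonneg) auto
  also have "\<dots> = real n * (?y b - ?y (i - 1))"
    by (rule cusum_diff[symmetric]) (use ab n in auto)
  also have "\<dots> \<le> real n * (gcm_step n ?y i * (real b - real (i - 1)))"
    using ab by (intro mult_left_mono up) auto
  also have "\<dots> = mle_at n \<tau> \<delta> i * (real b - real (i - 1))" using i by (simp add: mle_at_eq_step)
  finally show "0 \<le> mle_at n \<tau> \<delta> i" using ab i by (auto simp: zero_le_mult_iff of_nat_diff)
  have "mle_at n \<tau> \<delta> i * (real i - real a) = real n * (gcm_step n ?y i * (real i - real a))"
    using i by (simp add: mle_at_eq_step)
  also have "\<dots> \<le> real n * (?y i - ?y a)" using ab i by (intro mult_left_mono lo) auto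
  also have "\<dots> = (\<Sum>l\<in>{a..<i}. \<delta> (obs_order n \<tau> ! l))" by (rule cusum_diff) (use ab n in auto)
  also have "\<dots> \<le> (\<Sum>l\<in>{a..<i}. 1)" using ab i \<delta>' by (intro sum_mono) auto
  also have "\<dots> = 1 * (real i - real a)" using ab by (simp add: of_nat_diff)
  finally show "mle_at n \<tau> \<delta> i \<le> 1" using ab by (subst (asm) mult_le_cancel_right) auto
qed

lemma mle_bounds:
  assumes "\<And>i. i < n \<Longrightarrow> 0 \<le> \<delta> i \<and> \<delta> i \<le> 1"
  shows "0 \<le> mle n \<tau> \<delta> x" "mle n \<tau> \<delta> x \<le> 1"
  using mle_at_bounds[of "num_le n \<tau> x" n \<delta> \<tau>] assms num_le_le[of n \<tau> x] by (auto simp: mle_eq_num_le)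

lemma mle_mono:
  assumes "\<And>i. i < n \<Longrightarrow> 0 \<le> \<delta> i \<and> \<delta> i \<le> 1" and "x \<le> z"
  shows "mle n \<tau> \<delta> x \<le> mle n \<tau> \<delta> z"
proof (cases "num_le n \<tau> x = 0")
  case True
  then show ?thesis using mle_bounds[of n \<delta> \<tau> z] assms by (simp add: mle_eq_num_le)
next
  case False
  then show ?thesis
    using num_le_mono[OF assms(2), of n \<tau>] num_le_le[of n \<tau> z]
    by (simp add: mle_eq_num_le mle_at_eq_step mult_left_mono gcm_step_mono)
qed

text \<open>With distinct observation times a range of order statistics is the set of observations in
  an interval, so the two sides of a block of the minorant turn into statements about intervals.\<close>

lemma num_le_obs_order:
  assumes inj: "inj_on \<tau> {..<n}" and l: "l < n"
  shows "num_le n \<tau> (\<tau> (obs_order n \<tau> ! l)) = Suc l"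
proof -
  let ?N = "num_le n \<tau> (\<tau> (obs_order n \<tau> ! l))"
  have "l < ?N" using l by (simp add: less_num_le_iff)
  moreover have "\<not> Suc l < ?N"
  proof
    assume a: "Suc l < ?N"
    then have sl: "Suc l < n" using num_le_le[of n \<tau>] less_le_trans by blast
    from a have "\<tau> (obs_order n \<tau> ! Suc l) \<le> \<tau> (obs_order n \<tau> ! l)" by (simp add: less_num_le_iff[OF sl])
    with obs_order_sorted[of l "Suc l" n \<tau>] sl have "\<tau> (obs_order n \<tau> ! Suc l) = \<tau> (obs_order n \<tau> ! l)" by simp
    then have "obs_order n \<tau> ! Suc l = obs_order n \<tau> ! l"
      by (rule inj_onD[OF inj]) (use obs_order_less sl l in auto)
    then show False using nth_eq_iff_index_eq[of "obs_order n \<tau>" "Suc l" l] sl l by simp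
  qed
  ultimately show ?thesis by simp
qed

lemma sum_Icc_obs_order:
  assumes inj: "inj_on \<tau> {..<n}" and a: "a < n"
  shows "(\<Sum>i<n. indicat_real {\<tau> (obs_order n \<tau> ! a)..z} (\<tau> i) * f i) = (\<Sum>l\<in>{a..<num_le n \<tau> z}. f (obs_order n \<tau> ! l))"
proof -
  have "\<tau> (obs_order n \<tau> ! a) \<le> \<tau> (obs_order n \<tau> ! l) \<longleftrightarrow> a \<le> l" if "l < n" for l
    using less_num_le_iff[OF a, of \<tau> "\<tau> (obs_order n \<tau> ! l)"] num_le_obs_order[OF inj that] by auto
  then have "(\<Sum>l<n. indicat_real {\<tau> (obs_order n \<tau> ! a)..z} (\<tau> (obs_order n \<tau> ! l)) * f (obs_order n \<tau> ! l))
     = (\<Sum>l<n. if l \<in> {a..<num_le n \<tau> z} then f (obs_order n \<tau> ! l) else 0)"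
    by (intro sum.cong) (auto simp: indicator_def less_num_le_iff)
  also have "\<dots> = (\<Sum>l\<in>{..<n} \<inter> {a..<num_le n \<tau> z}. f (obs_order n \<tau> ! l))"
    by (simp add: sum.inter_restrict)
  also have "{..<n} \<inter> {a..<num_le n \<tau> z} = {a..<num_le n \<tau> z}" using num_le_le[of n \<tau> z] by auto
  finally show ?thesis by (subst sum_obs_order[where \<tau>=\<tau>])
qed

lemma sum_Ioc_obs_order:
  "(\<Sum>i<n. indicat_real {x<..z} (\<tau> i) * f i) = (\<Sum>l\<in>{num_le n \<tau> x..<num_le n \<tau> z}. f (obs_order n \<tau> ! l))"
proof -
  have "(\<Sum>l<n. indicat_real {x<..z} (\<tau> (obs_order n \<tau> ! l)) * f (obs_order n \<tau> ! l))
     = (\<Sum>l<n. if l \<in> {num_le n \<tau> x..<num_le n \<tau> z} then f (obs_order n \<tau> ! l) else 0)"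
    by (intro sum.cong) (auto simp: indicator_def less_num_le_iff not_less[symmetric])
  also have "\<dots> = (\<Sum>l\<in>{..<n} \<inter> {num_le n \<tau> x..<num_le n \<tau> z}. f (obs_order n \<tau> ! l))"
    by (simp add: sum.inter_restrict)
  also have "{..<n} \<inter> {num_le n \<tau> x..<num_le n \<tau> z} = {num_le n \<tau> x..<num_le n \<tau> z}" using num_le_le[of n \<tau> z] by auto
  finally show ?thesis by (subst sum_obs_order[where \<tau>=\<tau>])
qed

lemma sum_atMost_obs_order:
  "(\<Sum>i<n. indicat_real {..z} (\<tau> i) * f i) = (\<Sum>l<num_le n \<tau> z. f (obs_order n \<tau> ! l))"
proof -
  have "(\<Sum>l<n. indicat_real {..z} (\<tau> (obs_order n \<tau> ! l)) * f (obs_order n \<tau> ! l))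
     = (\<Sum>l<n. if l \<in> {..<num_le n \<tau> z} then f (obs_order n \<tau> ! l) else 0)"
    by (intro sum.cong) (auto simp: indicator_def less_num_le_iff)
  also have "\<dots> = (\<Sum>l\<in>{..<n} \<inter> {..<num_le n \<tau> z}. f (obs_order n \<tau> ! l))"
    by (simp add: sum.inter_restrict)
  also have "{..<n} \<inter> {..<num_le n \<tau> z} = {..<num_le n \<tau> z}" using num_le_le[of n \<tau> z] by auto
  finally show ?thesis by (subst sum_obs_order[where \<tau>=\<tau>])
qed

text \<open>The point \<open>s\<close> is the first observation time after the left end of the block that contains \<open>x\<close>, so that the
interval is closed on the left. The last equation holds because the diagram touches its minorant at the left
end, where both cumulative sums agree.\<close>

lemma mle_block_left:
  assumes inj: "inj_on \<tau> {..<n}" and \<delta>: "\<And>i. i < n \<Longrightarrow> 0 \<le> \<delta> i \<and> \<delta> i \<le> 1"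
  obtains s where "s \<le> x" "\<And>u. s \<le> u \<Longrightarrow> u \<le> x \<Longrightarrow> mle n \<tau> \<delta> u = mle n \<tau> \<delta> x"
    "\<And>z. x \<le> z \<Longrightarrow> 0 \<le> (\<Sum>i<n. indicat_real {s..z} (\<tau> i) * (\<delta> i - mle n \<tau> \<delta> x))"
    "(\<Sum>i<n. indicat_real {..x} (\<tau> i) * (\<delta> i - mle n \<tau> \<delta> (\<tau> i)))
       = (\<Sum>i<n. indicat_real {s..x} (\<tau> i) * (\<delta> i - mle n \<tau> \<delta> x))"
proof (cases "num_le n \<tau> x = 0")
  case True
  then have no: "\<not> \<tau> i \<le> x" if "i < n" for i using that by (auto simp: num_le_def)
  have m0: "mle n \<tau> \<delta> x = 0" using True by (simp add: mle_eq_num_le)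
  show ?thesis
  proof (rule that[of x])
    show "0 \<le> (\<Sum>i<n. indicat_real {x..z} (\<tau> i) * (\<delta> i - mle n \<tau> \<delta> x))" for z
      using \<delta> by (intro sum_nonneg) (auto simp: m0 indicator_def)
    show "(\<Sum>i<n. indicat_real {..x} (\<tau> i) * (\<delta> i - mle n \<tau> \<delta> (\<tau> i)))
       = (\<Sum>i<n. indicat_real {x..x} (\<tau> i) * (\<delta> i - mle n \<tau> \<delta> x))"
      using no by (intro sum.cong) (auto simp: indicator_def)
  qed auto
next
  case False
  let ?y = "cusum n \<tau> \<delta>" and ?L = "\<lambda>l. obs_order n \<tau> ! l"
  define i where "i = num_le n \<tau> x"
  have i: "0 < i" "i \<le> n" using False num_le_le by (auto simp: i_def)
  then have n: "n > 0" by simp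
  obtain a b where ab: "a < i" "i \<le> b" "b \<le> n" and touch: "gcm n ?y (real a / real n) = ?y a"
    and st: "\<And>j. a < j \<Longrightarrow> j \<le> b \<Longrightarrow> gcm_step n ?y j = gcm_step n ?y i"
    and lo: "\<And>m. a \<le> m \<Longrightarrow> m \<le> n \<Longrightarrow> gcm_step n ?y i * (real m - real a) \<le> ?y m - ?y a"
    using gcm_block_bounds[OF i, of ?y] by metis
  have an: "a < n" using ab i by simp
  have mx: "mle n \<tau> \<delta> x = real n * gcm_step n ?y i" using i by (simp add: mle_eq_num_le i_def mle_at_eq_step)
  have mL: "mle n \<tau> \<delta> (\<tau> (?L l)) = real n * gcm_step n ?y (Suc l)" if "l < n" for l
    using that by (simp add: mle_eq_num_le num_le_obs_order[OF inj] mle_at_eq_step)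
  show ?thesis
  proof (rule that[of "\<tau> (?L a)"])
    show "\<tau> (?L a) \<le> x" using ab an by (simp add: less_num_le_iff[symmetric] i_def)
    fix u assume u: "\<tau> (?L a) \<le> u" "u \<le> x"
    have "a < num_le n \<tau> u" "num_le n \<tau> u \<le> i" using u an num_le_mono[OF u(2)] by (auto simp: less_num_le_iff i_def)
    then show "mle n \<tau> \<delta> u = mle n \<tau> \<delta> x"
      using st[of "num_le n \<tau> u"] ab by (simp add: mx) (simp add: mle_eq_num_le mle_at_eq_step)
  next
    fix z assume "x \<le> z"
    then have N: "i \<le> num_le n \<tau> z" "num_le n \<tau> z \<le> n" using num_le_mono num_le_le by (auto simp: i_def)
    have "(\<Sum>i<n. indicat_real {\<tau> (?L a)..z} (\<tau> i) * (\<delta> i - mle n \<tau> \<delta> x))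
       = (\<Sum>l\<in>{a..<num_le n \<tau> z}. \<delta> (?L l)) - (real (num_le n \<tau> z) - real a) * mle n \<tau> \<delta> x"
      using N ab by (subst sum_Icc_obs_order[OF inj an]) (simp add: sum_subtractf of_nat_diff)
    also have "\<dots> = real n * ((?y (num_le n \<tau> z) - ?y a) - gcm_step n ?y i * (real (num_le n \<tau> z) - real a))"
      using N ab n by (subst cusum_diff[symmetric]) (auto simp: mx algebra_simps)
    also have "\<dots> \<ge> 0" using lo[of "num_le n \<tau> z"] N ab by simp
    finally show "0 \<le> (\<Sum>i<n. indicat_real {\<tau> (?L a)..z} (\<tau> i) * (\<delta> i - mle n \<tau> \<delta> x))" .
  next
    have "(\<Sum>l<a. \<delta> (?L l) - mle n \<tau> \<delta> (\<tau> (?L l))) = (\<Sum>l<a. \<delta> (?L l)) - real n * (\<Sum>l<a. gcm_step n ?y (Suc l))"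
      using mL an by (simp add: sum_subtractf sum_distrib_left)
    also have "(\<Sum>l<a. gcm_step n ?y (Suc l)) = (\<Sum>l\<in>{0<..a}. gcm_step n ?y l)"
      by (rule sum.reindex_bij_witness[where j = Suc and i = "\<lambda>j. j - 1"]) auto
    also have "\<dots> = ?y a - ?y 0" using gcm_diff_sum[of 0 a n ?y] gcm_left_end[OF n, of ?y] touch by simp
    also have "(\<Sum>l<a. \<delta> (?L l)) - real n * (?y a - ?y 0) = 0" using n by (simp add: cusum_eq)
    finally have z: "(\<Sum>l<a. \<delta> (?L l) - mle n \<tau> \<delta> (\<tau> (?L l))) = 0" .
    have "(\<Sum>i<n. indicat_real {..x} (\<tau> i) * (\<delta> i - mle n \<tau> \<delta> (\<tau> i)))
      = (\<Sum>l<i. \<delta> (?L l) - mle n \<tau> \<delta> (\<tau> (?L l)))" by (subst sum_atMost_obs_order) (simp add: i_def)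
    also have "{..<i} = {..<a} \<union> {a..<i}" using ab by auto
    also have "(\<Sum>l\<in>{..<a} \<union> {a..<i}. \<delta> (?L l) - mle n \<tau> \<delta> (\<tau> (?L l))) = (\<Sum>l\<in>{a..<i}. \<delta> (?L l) - mle n \<tau> \<delta> (\<tau> (?L l)))"
      by (subst sum.union_disjoint) (auto simp: z)
    also have "\<dots> = (\<Sum>l\<in>{a..<i}. \<delta> (?L l) - mle n \<tau> \<delta> x)"
    proof (rule sum.cong[OF refl])
      fix l assume l: "l \<in> {a..<i}"
      then have "l < n" "a < Suc l" "Suc l \<le> b" using ab i by auto
      then have "mle n \<tau> \<delta> (\<tau> (?L l)) = mle n \<tau> \<delta> x" using mL[of l] st[of "Suc l"] mx by metis
      then show "\<delta> (?L l) - mle n \<tau> \<delta> (\<tau> (?L l)) = \<delta> (?L l) - mle n \<tau> \<delta> x" by simp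
    qed
    also have "\<dots> = (\<Sum>i<n. indicat_real {\<tau> (?L a)..x} (\<tau> i) * (\<delta> i - mle n \<tau> \<delta> x))"
      by (subst sum_Icc_obs_order[OF inj an]) (simp add: i_def)
    finally show "(\<Sum>i<n. indicat_real {..x} (\<tau> i) * (\<delta> i - mle n \<tau> \<delta> (\<tau> i)))
       = (\<Sum>i<n. indicat_real {\<tau> (?L a)..x} (\<tau> i) * (\<delta> i - mle n \<tau> \<delta> x))" .
  qed
qed

text \<open>The counterpart at the right end \<open>s\<close> of the block. If no observation precedes \<open>x\<close> the estimator vanishes there
by convention and the inequality may fail, whence the assumption.\<close>

lemma mle_block_right:
  assumes inj: "inj_on \<tau> {..<n}" and N0: "num_le n \<tau> x > 0"
  obtains s where "x \<le> s" 
    "\<And>z. z \<le> x \<Longrightarrow> (\<Sum>i<n. indicat_real {z<..s} (\<tau> i) * (\<delta> i - mle n \<tau> \<delta> x)) \<le> 0"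
proof -
  let ?y = "cusum n \<tau> \<delta>" and ?L = "\<lambda>l. obs_order n \<tau> ! l"
  define i where "i = num_le n \<tau> x"
  have i: "0 < i" "i \<le> n" using N0 num_le_le by (auto simp: i_def)
  then have n: "n > 0" by simp
  obtain a b where ab: "a < i" "i \<le> b" "b \<le> n"
    and up: "\<And>m. m \<le> b \<Longrightarrow> ?y b - ?y m \<le> gcm_step n ?y i * (real b - real m)"
    using gcm_block_bounds[OF i, of ?y] by metis
  have mx: "mle n \<tau> \<delta> x = real n * gcm_step n ?y i" using i by (simp add: mle_eq_num_le i_def mle_at_eq_step)
  \<comment> \<open>The maximum matters if the block ends at the index of \<open>x\<close> itself.\<close>
  define s where "s = max x (\<tau> (?L (b - 1)))"
  have Ns: "num_le n \<tau> s = b"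
  proof (cases "b = i")
    case True
    then have "\<tau> (?L (b - 1)) \<le> x" using i by (simp add: less_num_le_iff[symmetric] i_def)
    then show ?thesis using True by (simp add: s_def max_absorb1 i_def)
  next
    case False
    then have "\<not> \<tau> (?L (b - 1)) \<le> x" using ab by (subst less_num_le_iff[symmetric]) (auto simp: i_def)
    then have "s = \<tau> (?L (b - 1))" by (simp add: s_def)
    then show ?thesis using num_le_obs_order[OF inj, of "b - 1"] ab i by simp
  qed
  show ?thesis
  proof (rule that[of s])
    show "x \<le> s" by (simp add: s_def)
    fix z assume "z \<le> x"
    then have N: "num_le n \<tau> z \<le> b" using num_le_mono[of z x n \<tau>] ab by (simp add: i_def)
    have "(\<Sum>i<n. indicat_real {z<..s} (\<tau> i) * (\<delta> i - mle n \<tau> \<delta> x))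
       = (\<Sum>l\<in>{num_le n \<tau> z..<b}. \<delta> (?L l)) - (real b - real (num_le n \<tau> z)) * mle n \<tau> \<delta> x"
      using N ab by (subst sum_Ioc_obs_order) (simp add: sum_subtractf of_nat_diff Ns)
    also have "\<dots> = real n * ((?y b - ?y (num_le n \<tau> z)) - gcm_step n ?y i * (real b - real (num_le n \<tau> z)))"
      using N ab n by (subst cusum_diff[symmetric]) (auto simp: mx algebra_simps)
    also have "\<dots> \<le> 0" using up[OF N] by (simp add: mult_le_0_iff)
    finally show "(\<Sum>i<n. indicat_real {z<..s} (\<tau> i) * (\<delta> i - mle n \<tau> \<delta> x)) \<le> 0" .
  qed
qed


section \<open>Consequences of a modulus of continuity for the empirical processes\<close>

text \<open>A realisation of the sample for which the number of observation times in an interval and the centred sum of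
the indicators over the interval are of the order of their standard deviations, up to the factor \<open>\<kappa>\<close>; the
summand \<open>1\<close> accounts for intervals of probability below \<open>1 / n\<close>.\<close>

locale sample_modulus = real_distribution P for P :: "real measure" +
  fixes n :: nat and \<tau> \<delta> :: "nat \<Rightarrow> real" and F0 :: "real \<Rightarrow> real" and \<kappa> :: real
  assumes n_pos: "n > 0" and inj: "inj_on \<tau> {..<n}"
    and \<delta>: "\<And>i. i < n \<Longrightarrow> 0 \<le> \<delta> i \<and> \<delta> i \<le> 1"
    and F0_mono: "\<And>x y. x \<le> y \<Longrightarrow> F0 x \<le> F0 y" and F0_01: "\<And>x. 0 \<le> F0 x" "\<And>x. F0 x \<le> 1"
    and \<kappa>: "1 \<le> \<kappa>"
    and modulus_G: "\<And>A. is_interval A \<Longrightarrow> 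
      \<bar>(\<Sum>i<n. indicat_real A (\<tau> i)) - n * prob A\<bar> \<le> \<kappa> * (sqrt (n * prob A) + 1)"
    and modulus_F: "\<And>A. is_interval A \<Longrightarrow> 
      \<bar>\<Sum>i<n. indicat_real A (\<tau> i) * (\<delta> i - F0 (\<tau> i))\<bar> \<le> \<kappa> * (sqrt (n * prob A) + 1)"
begin

abbreviation Fh :: "real \<Rightarrow> real" where "Fh \<equiv> mle n \<tau> \<delta>"

lemma Fh_01: "0 \<le> Fh x" "Fh x \<le> 1" and Fh_mono: "x \<le> y \<Longrightarrow> Fh x \<le> Fh y"
  using mle_bounds[of n \<delta> \<tau> x] mle_mono[of n \<delta> x y \<tau>] \<delta> by auto

text \<open>The estimate common to the next two lemmas: an interval with expected number of observations \<open>m \<ge> 16 \<kappa>\<^sup>2\<close>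
contains at least \<open>m / 2\<close> of them, so a sum over it of the order of the fluctuation has an average of order
\<open>\<kappa> / sqrt m\<close>.\<close>

lemma ratio_bound:
  assumes w: "16 * \<kappa>\<^sup>2 \<le> w" "w \<le> m" and N: "\<bar>N - m\<bar> \<le> \<kappa> * (sqrt m + 1)" and D: "N * D \<le> \<kappa> * (sqrt m + 1)"
  shows "D \<le> 4 * \<kappa> / sqrt w"
proof (cases "D \<le> 0")
  case True
  then show ?thesis using \<kappa> w by (intro order_trans[OF True]) (auto intro!: divide_nonneg_nonneg simp: order_trans[OF _ w(1)])
next
  case False
  have w0: "0 < w" using w \<kappa> by (intro less_le_trans[OF _ w(1)]) auto
  have "sqrt (16 * \<kappa>\<^sup>2) \<le> sqrt w" using w by simp
  then have sw: "4 * \<kappa> \<le> sqrt w" using \<kappa> by (simp add: real_sqrt_mult)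
  moreover have swm: "sqrt w \<le> sqrt m" using w by simp
  ultimately have sm: "4 * \<kappa> \<le> sqrt m" by linarith
  then have sm1: "1 \<le> sqrt m" using \<kappa> by linarith
  have m: "sqrt m * sqrt m = m" using w w0 by simp
  have k2: "\<kappa> * (sqrt m + 1) \<le> 2 * \<kappa> * sqrt m" using \<kappa> mult_left_mono[OF sm1, of \<kappa>] by (simp add: distrib_left)
  also have "\<dots> \<le> m / 2" using mult_right_mono[OF sm, of "sqrt m"] m w w0 by simp
  finally have "m / 2 \<le> N" using N by linarith
  then have "m / 2 * D \<le> N * D" using False by (intro mult_right_mono) auto
  also have "\<dots> \<le> 2 * \<kappa> * sqrt m" using D k2 by linarith
  finally have "m * D \<le> 4 * \<kappa> * sqrt m" by simp
  also have "\<dots> = sqrt m * (4 * \<kappa>)" by (rule mult.commute)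
  finally have "sqrt m * (sqrt m * D) \<le> sqrt m * (4 * \<kappa>)" by (subst mult.assoc[symmetric]) (simp only: m)
  then have "sqrt m * D \<le> 4 * \<kappa>" by (rule mult_left_le_imp_le) (use sm1 in linarith)
  then have "sqrt w * D \<le> 4 * \<kappa>" using swm False by (meson mult_right_mono order_trans not_le less_imp_le)
  then show ?thesis using w0 by (simp add: field_simps)
qed

text \<open>From the start of the block up to \<open>z\<close> the indicators average at least to \<open>Fh x\<close>, whereas their means are at most
\<open>F0 z\<close>. The block may start far to the left of \<open>x\<close>, but this only lengthens the interval and improves the bound.\<close>

lemma mle_upper:
  assumes x: "x \<le> z" and w: "16 * \<kappa>\<^sup>2 \<le> w" "w \<le> n * prob {x<..z}"
  shows "Fh x \<le> F0 z + 4 * \<kappa> / sqrt w"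
proof -
  obtain s where s1: "s \<le> x" and s2: "\<And>z. x \<le> z \<Longrightarrow> 0 \<le> (\<Sum>i<n. indicat_real {s..z} (\<tau> i) * (\<delta> i - Fh x))"
    by (rule mle_block_left[where \<delta>=\<delta> and x=x, OF inj \<delta>], assumption, rule that)
  note s = s1 s2[OF x]
  define m where "m = n * prob {s..z}"
  define N where "N = (\<Sum>i<n. indicat_real {s..z} (\<tau> i))"
  have wm: "w \<le> m" unfolding m_def using s(1)
    by (intro order_trans[OF w(2)] mult_left_mono finite_measure_mono) auto
  have i: "is_interval {s..z}" by (simp add: is_interval_cc)
  have "N * (Fh x - F0 z) \<le> \<kappa> * (sqrt m + 1)"
  proof -
    have "N * (Fh x - F0 z) = (\<Sum>i<n. indicat_real {s..z} (\<tau> i) * (Fh x - F0 z))" by (simp add: N_def sum_distrib_right)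
    also have "\<dots> \<le> (\<Sum>i<n. indicat_real {s..z} (\<tau> i) * (\<delta> i - F0 (\<tau> i)) - indicat_real {s..z} (\<tau> i) * (\<delta> i - Fh x))"
      by (intro sum_mono) (auto simp: indicator_def F0_mono)
    also have "\<dots> \<le> (\<Sum>i<n. indicat_real {s..z} (\<tau> i) * (\<delta> i - F0 (\<tau> i)))"
      using s(2) by (simp add: sum_subtractf)
    also have "\<dots> \<le> \<kappa> * (sqrt m + 1)" using modulus_F[OF i] by (simp add: m_def)
    finally show ?thesis .
  qed
  then show ?thesis
    using ratio_bound[OF w(1) wm, of N "Fh x - F0 z"] modulus_G[OF i] by (simp add: m_def N_def)
qed

lemma mle_lower:
  assumes x: "z \<le> x" and w: "16 * \<kappa>\<^sup>2 \<le> w" "w \<le> n * prob {z<..x}"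
  shows "F0 z - 4 * \<kappa> / sqrt w \<le> Fh x"
proof -
  have "num_le n \<tau> x > 0"
  proof (rule ccontr)
    assume "\<not> ?thesis"
    then have "indicat_real {z<..x} (\<tau> i) = 0" if "i < n" for i using that by (auto simp: num_le_def indicator_def)
    then have "(\<Sum>i<n. indicat_real {z<..x} (\<tau> i)) = 0" by simp
    with modulus_G[of "{z<..x}"] have "\<bar>0 - n * prob {z<..x}\<bar> \<le> \<kappa> * (sqrt (n * prob {z<..x}) + 1)"
      by (simp add: is_interval_oc)
    from ratio_bound[OF w this, of "4 * \<kappa> / sqrt w + 1"] \<kappa> show False by simp
  qed
  then obtain s where s1: "x \<le> s" and s2: "\<And>z. z \<le> x \<Longrightarrow> (\<Sum>i<n. indicat_real {z<..s} (\<tau> i) * (\<delta> i - Fh x)) \<le> 0"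
    by (rule mle_block_right[OF inj, where x=x and \<delta>=\<delta>]) (rule that)
  note s = s1 s2[OF x]
  define m where "m = n * prob {z<..s}"
  define N where "N = (\<Sum>i<n. indicat_real {z<..s} (\<tau> i))"
  have wm: "w \<le> m" unfolding m_def using s(1)
    by (intro order_trans[OF w(2)] mult_left_mono finite_measure_mono) auto
  have i: "is_interval {z<..s}" by (simp add: is_interval_oc)
  have "N * (F0 z - Fh x) \<le> \<kappa> * (sqrt m + 1)"
  proof -
    have "N * (F0 z - Fh x) = (\<Sum>i<n. indicat_real {z<..s} (\<tau> i) * (F0 z - Fh x))" by (simp add: N_def sum_distrib_right)
    also have "\<dots> \<le> (\<Sum>i<n. indicat_real {z<..s} (\<tau> i) * (\<delta> i - Fh x) - indicat_real {z<..s} (\<tau> i) * (\<delta> i - F0 (\<tau> i)))"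
      by (intro sum_mono) (auto simp: indicator_def F0_mono)
    also have "\<dots> \<le> - (\<Sum>i<n. indicat_real {z<..s} (\<tau> i) * (\<delta> i - F0 (\<tau> i)))"
      using s(2) by (simp add: sum_subtractf)
    also have "\<dots> \<le> \<kappa> * (sqrt m + 1)" using modulus_F[OF i] by (simp add: m_def)
    finally show ?thesis .
  qed
  then show ?thesis
    using ratio_bound[OF w(1) wm, of N "F0 z - Fh x"] modulus_G[OF i] by (simp add: m_def N_def)
qed

text \<open>Layer cake: minus \<open>\<alpha>\<close>, a monotone function with values in \<open>[\<alpha>, \<alpha> + B]\<close> is a mixture of total mass \<open>B\<close> of
  indicators of intervals, and for each of these the modulus applies.\<close>

lemma modulus_G_mono:
  fixes \<psi> :: "real \<Rightarrow> real"
  assumes I: "is_interval I" and mono: "\<And>x y. x \<le> y \<Longrightarrow> \<psi> x \<le> \<psi> y"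
    and B: "\<And>x. x \<in> I \<Longrightarrow> \<alpha> \<le> \<psi> x \<and> \<psi> x \<le> \<alpha> + B" "0 \<le> B"
  shows "\<bar>n * expectation (\<lambda>u. indicator I u * (\<psi> u - \<alpha>)) - (\<Sum>i<n. indicator I (\<tau> i) * (\<psi> (\<tau> i) - \<alpha>))\<bar>
    \<le> B * (\<kappa> * (sqrt n + 1))"
proof -
  have [measurable]: "I \<in> sets borel" using I by (rule real_interval_borel_measurable)
  have [measurable]: "\<psi> \<in> borel_measurable borel" by (rule borel_measurable_mono) (auto intro: monoI mono)
  define A where "A s = {u \<in> I. s < \<psi> u - \<alpha>}" for s
  have [measurable]: "A s \<in> sets borel" for s unfolding A_def by measurable
  have As: "is_interval (A s)" for s
    unfolding is_interval_1 A_def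
  proof safe
    fix a b x assume a: "a \<in> I" "b \<in> I" "s < \<psi> a - \<alpha>" "a \<le> x" "x \<le> b"
    show "x \<in> I" using I a unfolding is_interval_1 by blast
    show "s < \<psi> x - \<alpha>" using a(3) mono[OF a(4)] by linarith
  qed
  have ll: "indicator I u * (\<psi> u - \<alpha>) = (LBINT s. indicator {0..<B} s * indicator (A s) u)" for u
  proof -
    have "(LBINT s. indicator {0..<B} s * indicator (A s) u :: real) = (LBINT s. indicator I u * indicator {0..<\<psi> u - \<alpha>} s)"
      using B(1)[of u] by (intro Bochner_Integration.integral_cong) (auto simp: A_def indicator_def)
    also have "\<dots> = indicator I u * (\<psi> u - \<alpha>)" using B(1)[of u] by (cases "u \<in> I") auto
    finally show ?thesis by simp
  qed
  interpret pair_sigma_finite P lborel ..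
  have meas: "(\<lambda>(u, s). indicator {0..<B} s * indicator (A s) u :: real) \<in> borel_measurable (P \<Otimes>\<^sub>M lborel)"
    unfolding A_def indicator_def by measurable
  have "integrable (P \<Otimes>\<^sub>M lborel) (\<lambda>z. indicator (UNIV \<times> {0..<B}) z :: real)"
    using B(2) by (intro integrable_real_indicator) (auto simp: lborel.emeasure_pair_measure_Times emeasure_eq_measure ennreal_mult_less_top)
  then have int: "integrable (P \<Otimes>\<^sub>M lborel) (\<lambda>(u, s). indicator {0..<B} s * indicator (A s) u :: real)"
    by (rule Bochner_Integration.integrable_bound[OF _ meas]) (auto simp: indicator_def)
  have e: "expectation (\<lambda>u. indicator I u * (\<psi> u - \<alpha>)) = (LBINT s. indicator {0..<B} s * prob (A s))"
    unfolding ll by (subst Fubini_integral[OF int, symmetric]) simp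
  have int1: "integrable lborel (\<lambda>s. indicator {0..<B} s * prob (A s))"
    using integrable_snd[OF int] by simp
  have mA: "(\<lambda>s. indicator (A s) u :: real) \<in> borel_measurable borel" for u
  proof -
    have "(\<lambda>s. indicator (A s) u :: real) = (\<lambda>s. indicator I u * indicator {..<\<psi> u - \<alpha>} s)"
      by (auto simp: fun_eq_iff A_def indicator_def)
    then show ?thesis by simp
  qed
  have iB: "integrable lborel (indicator {0..<B} :: real \<Rightarrow> real)" using B(2) by simp
  have int2: "integrable lborel (\<lambda>s. indicator {0..<B} s * indicator (A s) u :: real)" for u
  proof (rule Bochner_Integration.integrable_bound[OF iB])
    show "(\<lambda>s. indicator {0..<B} s * indicator (A s) u :: real) \<in> borel_measurable lborel"
      using mA[of u] by measurable
    show "AE s in lborel. norm (indicator {0..<B} s * indicator (A s) u :: real) \<le> norm (indicator {0..<B} s :: real)"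
      by (intro AE_I2) (simp add: indicator_def)
  qed
  have int2': "integrable lborel (\<lambda>s. indicator {0..<B} s * (\<Sum>i<n. indicator (A s) (\<tau> i) :: real))"
    unfolding sum_distrib_left by (intro Bochner_Integration.integrable_sum int2)
  have "n * expectation (\<lambda>u. indicator I u * (\<psi> u - \<alpha>)) - (\<Sum>i<n. indicator I (\<tau> i) * (\<psi> (\<tau> i) - \<alpha>))
    = n * (LBINT s. indicator {0..<B} s * prob (A s)) - (LBINT s. indicator {0..<B} s * (\<Sum>i<n. indicator (A s) (\<tau> i)))"
    unfolding e unfolding ll sum_distrib_left by (subst Bochner_Integration.integral_sum) (auto intro: int2)
  also have "\<dots> = (LBINT s. indicator {0..<B} s * (n * prob (A s) - (\<Sum>i<n. indicator (A s) (\<tau> i))))"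
    using int1 int2' by (simp add: right_diff_distrib mult.left_commute)
  also have "\<bar>\<dots>\<bar> \<le> (LBINT s. \<bar>indicator {0..<B} s * (n * prob (A s) - (\<Sum>i<n. indicator (A s) (\<tau> i)))\<bar>)"
    by (rule integral_abs_bound)
  also have "\<dots> \<le> (LBINT s. indicator {0..<B} s * (\<kappa> * (sqrt n + 1)))"
  proof (rule integral_mono)
    show "integrable lborel (\<lambda>s. \<bar>indicator {0..<B} s * (n * prob (A s) - (\<Sum>i<n. indicator (A s) (\<tau> i)))\<bar>)"
      using int1 int2' by (intro integrable_abs) (simp add: right_diff_distrib mult.left_commute)
    show "integrable lborel (\<lambda>s. indicator {0..<B} s * (\<kappa> * (sqrt n + 1)))" using B by simp
    fix s
    have "\<bar>n * prob (A s) - (\<Sum>i<n. indicator (A s) (\<tau> i))\<bar> \<le> \<kappa> * (sqrt (n * prob (A s)) + 1)"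
      using modulus_G[OF As, of s] by (simp add: abs_minus_commute)
    also have "\<dots> \<le> \<kappa> * (sqrt n + 1)" using \<kappa> mult_left_le[of "prob (A s)" "real n"] by (intro mult_left_mono add_right_mono real_sqrt_le_mono) auto
    finally show "\<bar>indicator {0..<B} s * (n * prob (A s) - (\<Sum>i<n. indicator (A s) (\<tau> i)))\<bar> \<le> indicator {0..<B} s * (\<kappa> * (sqrt n + 1))"
      by (auto simp: indicator_def)
  qed
  also have "\<dots> = B * (\<kappa> * (sqrt n + 1))" using B by simp
  finally show ?thesis .
qed

text \<open>The error of replacing the integral of \<open>\<phi> (F - F0)\<close> against the law of the observation times by the average of
\<open>\<phi>(T\<^sub>i) (\<Delta>\<^sub>i - F0(T\<^sub>i))\<close>.\<close>

definition residual :: "(real \<Rightarrow> real) \<Rightarrow> real" where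
  "residual \<phi> = expectation (\<lambda>u. \<phi> u * (Fh u - F0 u)) - (\<Sum>i<n. \<phi> (\<tau> i) * (\<delta> i - F0 (\<tau> i))) / n"

lemma Fh_measurable [measurable]: "Fh \<in> borel_measurable borel"
  by (rule borel_measurable_mono) (auto intro: monoI Fh_mono)
lemma F0_measurable [measurable]: "F0 \<in> borel_measurable borel"
  by (rule borel_measurable_mono) (auto intro: monoI F0_mono)

lemma abs_Fh_F0: "\<bar>Fh x - F0 x\<bar> \<le> 1" 
  using Fh_01[of x] F0_01[of x] by auto

lemma integrable_bounded_times:
  assumes [measurable]: "\<phi> \<in> borel_measurable borel" and b: "\<And>u. \<bar>\<phi> u\<bar> \<le> C"
  shows "integrable P (\<lambda>u. \<phi> u * (Fh u - F0 u))"
proof (rule integrable_const_bound[where B=C])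
  show "AE u in P. norm (\<phi> u * (Fh u - F0 u)) \<le> C"
  proof (rule AE_I2)
    fix u have "\<bar>\<phi> u\<bar> * \<bar>Fh u - F0 u\<bar> \<le> C * 1" by (intro mult_mono b abs_Fh_F0) (use b[of u] in auto)
    then show "norm (\<phi> u * (Fh u - F0 u)) \<le> C" by (simp add: abs_mult)
  qed
qed simp

lemma residual_bound:
  assumes [measurable]: "\<phi> \<in> borel_measurable borel" and b: "\<And>u. \<bar>\<phi> u\<bar> \<le> C"
  shows "\<bar>residual \<phi>\<bar> \<le> 2 * C"
proof -
  have C: "0 \<le> C" using b[of 0] by auto
  have "\<bar>expectation (\<lambda>u. \<phi> u * (Fh u - F0 u))\<bar> \<le> expectation (\<lambda>u. \<bar>\<phi> u * (Fh u - F0 u)\<bar>)"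
    by (rule integral_abs_bound)
  also have "\<dots> \<le> expectation (\<lambda>u. C)"
  proof (rule integral_mono)
    show "integrable P (\<lambda>u. \<bar>\<phi> u * (Fh u - F0 u)\<bar>)" using integrable_bounded_times[OF assms] by simp
    fix u have "\<bar>\<phi> u\<bar> * \<bar>Fh u - F0 u\<bar> \<le> C * 1" by (intro mult_mono b abs_Fh_F0) (use C in auto)
    then show "\<bar>\<phi> u * (Fh u - F0 u)\<bar> \<le> C" by (simp add: abs_mult)
  qed simp
  finally have 1: "\<bar>expectation (\<lambda>u. \<phi> u * (Fh u - F0 u))\<bar> \<le> C" using prob_space by simp
  have "\<bar>\<Sum>i<n. \<phi> (\<tau> i) * (\<delta> i - F0 (\<tau> i))\<bar> \<le> (\<Sum>i<n. C)"
  proof (rule order_trans[OF sum_abs sum_mono])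
    fix i assume "i \<in> {..<n}"
    then have "\<bar>\<phi> (\<tau> i)\<bar> * \<bar>\<delta> i - F0 (\<tau> i)\<bar> \<le> C * 1"
      using \<delta>[of i] F0_01[of "\<tau> i"] C by (intro mult_mono b) auto
    then show "\<bar>\<phi> (\<tau> i) * (\<delta> i - F0 (\<tau> i))\<bar> \<le> C" by (simp add: abs_mult)
  qed
  then have "\<bar>(\<Sum>i<n. \<phi> (\<tau> i) * (\<delta> i - F0 (\<tau> i))) / n\<bar> \<le> C" using n_pos by (simp add: field_simps)
  with 1 show ?thesis unfolding residual_def by linarith
qed

lemma residual_step_function:
  fixes c x :: "'k \<Rightarrow> real"
  assumes m[measurable]: "\<phi> \<in> borel_measurable borel" and b: "\<And>u. \<bar>\<phi> u\<bar> \<le> C"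
  shows "residual (\<lambda>u. \<phi> u - (\<Sum>k\<in>K. c k * indicator {a<..x k} u)) = residual \<phi> - (\<Sum>k\<in>K. c k * residual (indicator {a<..x k}))"
proof -
  have i1: "integrable P (\<lambda>u. \<phi> u * (Fh u - F0 u))" by (rule integrable_bounded_times[OF m b])
  have i2: "integrable P (\<lambda>u. indicator {a<..x k} u * (Fh u - F0 u))" for k
    by (rule integrable_bounded_times[of _ 1]) auto
  have "expectation (\<lambda>u. (\<phi> u - (\<Sum>k\<in>K. c k * indicator {a<..x k} u)) * (Fh u - F0 u))
    = expectation (\<lambda>u. \<phi> u * (Fh u - F0 u) - (\<Sum>k\<in>K. c k * (indicator {a<..x k} u * (Fh u - F0 u))))"
    by (simp add: left_diff_distrib sum_distrib_right mult.assoc)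
  also have "\<dots> = expectation (\<lambda>u. \<phi> u * (Fh u - F0 u)) - (\<Sum>k\<in>K. c k * expectation (\<lambda>u. indicator {a<..x k} u * (Fh u - F0 u)))"
    using i1 i2 by (subst Bochner_Integration.integral_diff) (auto simp: Bochner_Integration.integral_sum)
  finally have e: "expectation (\<lambda>u. (\<phi> u - (\<Sum>k\<in>K. c k * indicator {a<..x k} u)) * (Fh u - F0 u)) = \<dots>" .
  have s: "(\<Sum>i<n. (\<phi> (\<tau> i) - (\<Sum>k\<in>K. c k * indicator {a<..x k} (\<tau> i))) * (\<delta> i - F0 (\<tau> i)))
    = (\<Sum>i<n. \<phi> (\<tau> i) * (\<delta> i - F0 (\<tau> i))) - (\<Sum>k\<in>K. c k * (\<Sum>i<n. indicator {a<..x k} (\<tau> i) * (\<delta> i - F0 (\<tau> i))))"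
    unfolding left_diff_distrib sum_subtractf sum_distrib_right sum_distrib_left mult.assoc
    by (subst sum.swap) simp
  have "(A - (\<Sum>k\<in>K. c k * u k)) - (B - (\<Sum>k\<in>K. c k * w k)) / n = (A - B / n) - (\<Sum>k\<in>K. c k * (u k - w k / n))"
    for A B and u w :: "'k \<Rightarrow> real"
    by (simp add: diff_divide_distrib right_diff_distrib sum_subtractf sum_divide_distrib)
  then show ?thesis unfolding residual_def e s .
qed

text \<open>Summation by parts, with the smooth function replaced by a step function on a fine grid.\<close>

lemma residual_lipschitz:
  assumes ab: "a < b" and [measurable]: "\<theta> \<in> borel_measurable borel"
    and zero: "\<And>u. u \<le> a \<or> b \<le> u \<Longrightarrow> \<theta> u = 0"
    and lip: "\<And>x y. x \<in> {a..b} \<Longrightarrow> y \<in> {a..b} \<Longrightarrow> \<bar>\<theta> x - \<theta> y\<bar> \<le> L * \<bar>x - y\<bar>"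
    and \<beta>: "\<And>v. v \<in> {a..b} \<Longrightarrow> \<bar>residual (indicator {a<..v})\<bar> \<le> \<beta>"
  shows "\<bar>residual \<theta>\<bar> \<le> L * (b - a) * \<beta>"
proof -
  have L: "0 \<le> L" 
  proof -
    have "0 \<le> L * \<bar>a - b\<bar>" using ab by (intro order_trans[OF abs_ge_zero lip]) auto
    then show ?thesis using ab by (simp add: zero_le_mult_iff)
  qed
  have bnd: "\<bar>\<theta> u\<bar> \<le> L * (b - a)" for u
  proof (cases "u \<in> {a..b}")
    case True
    have "\<bar>\<theta> u - \<theta> a\<bar> \<le> L * \<bar>u - a\<bar>" using True ab by (intro lip) auto
    also have "\<dots> \<le> L * (b - a)" using True L by (intro mult_left_mono) auto
    finally show ?thesis using zero[of a] by simp
  next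
    case False then show ?thesis using zero[of u] L ab by auto
  qed
  have main: "\<bar>residual \<theta>\<bar> \<le> L * (b - a) * \<beta> + 2 * (L * ((b - a) / m))" if m: "m > 0" for m :: nat
  proof -
    define x where "x k = a + real k * ((b - a) / m)" for k :: nat
    have xm: "x m = b" using m by (simp add: x_def)
    have x0: "x 0 = a" by (simp add: x_def)
    have xmono: "x j \<le> x k" if "j \<le> k" for j k using that ab by (auto simp: x_def intro!: divide_right_mono mult_right_mono)
    have xab: "x k \<in> {a..b}" if "k \<le> m" for k using xmono[of 0 k] xmono[OF that] by (simp add: xm x0)
    have xs: "x (Suc k) - x k = (b - a) / m" for k by (simp add: x_def distrib_right add_divide_distrib)
    define c where "c k = \<theta> (x k) - \<theta> (x (Suc k))" for k
    define S where "S u = (\<Sum>k<m. c k * indicator {a<..x k} u)" for u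
    have S: "\<bar>\<theta> u - S u\<bar> \<le> L * ((b - a) / m)" for u
    proof (cases "a < u \<and> u < b")
      case False
      then have "indicator {a<..x k} u = (0::real)" if "k < m" for k
      proof -
        have "0 < (b - a) / m" using m ab by simp
        then have "x k < x (Suc k)" "x (Suc k) \<le> b" using xs[of k] xab[of "Suc k"] that by auto
        then show ?thesis using False by (auto simp: indicator_def)
      qed
      then have "S u = 0" unfolding S_def by (intro sum.neutral) auto
      then show ?thesis using zero[of u] False L ab by (simp add: not_less)
    next
      case True
      \<comment> \<open>The grid point just to the right of \<open>u\<close>, where the step function takes the value of \<open>\<theta>\<close>.\<close>
      define j where "j = (LEAST j. u \<le> x j)"
      have uj: "u \<le> x j" unfolding j_def by (rule LeastI[of _ m]) (use True xm in simp)
      have jm: "j \<le> m" unfolding j_def by (rule Least_le) (use True xm in simp)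
      have jk: "u \<le> x k \<longleftrightarrow> j \<le> k" for k
        using uj xmono[of j k] Least_le[of "\<lambda>j. u \<le> x j" k] by (auto simp: j_def[symmetric])
      have j0: "0 < j" using uj True x0 by (metis gr0I not_le)
      have "S u = (\<Sum>k<m. if k \<in> {j..<m} then c k else 0)"
        unfolding S_def by (intro sum.cong) (use True jk in \<open>auto simp: indicator_def\<close>)
      also have "\<dots> = (\<Sum>k\<in>{..<m} \<inter> {j..<m}. c k)" by (simp add: sum.inter_restrict)
      also have "{..<m} \<inter> {j..<m} = {j..<m}" by auto
      also have "(\<Sum>k\<in>{j..<m}. c k) = \<theta> (x j) - \<theta> (x m)"
        unfolding c_def using sum_Suc_diff'[OF jm, of "\<lambda>k. - \<theta> (x k)"] by simp
      finally have "S u = \<theta> (x j)" using zero[of b] xm by simp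
      moreover have "\<bar>\<theta> u - \<theta> (x j)\<bar> \<le> L * \<bar>u - x j\<bar>" using True xab[OF jm] by (intro lip) auto
      moreover have "\<not> u \<le> x (j - 1)" using jk[of "j - 1"] j0 by simp
      then have "\<bar>u - x j\<bar> \<le> (b - a) / m" using xs[of "j - 1"] uj j0 by simp
      ultimately show ?thesis using mult_left_mono[OF _ L] by fastforce
    qed
    have [measurable]: "S \<in> borel_measurable borel" unfolding S_def by measurable
    have "residual (\<lambda>u. \<theta> u - S u) = residual \<theta> - (\<Sum>k<m. c k * residual (indicator {a<..x k}))"
      unfolding S_def by (rule residual_step_function[OF _ bnd]) simp
    moreover have "\<bar>residual (\<lambda>u. \<theta> u - S u)\<bar> \<le> 2 * (L * ((b - a) / m))"
      by (rule residual_bound[OF _ S]) simp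
    moreover have "\<bar>\<Sum>k<m. c k * residual (indicator {a<..x k})\<bar> \<le> (\<Sum>k<m. L * ((b - a) / m) * \<beta>)"
    proof (rule order_trans[OF sum_abs sum_mono])
      fix k assume k: "k \<in> {..<m}"
      have "\<bar>c k\<bar> \<le> L * \<bar>x k - x (Suc k)\<bar>" unfolding c_def using k by (intro lip xab) auto
      also have "\<bar>x k - x (Suc k)\<bar> = (b - a) / m" using xs[of k] ab by (subst abs_minus_commute) simp
      finally show "\<bar>c k * residual (indicator {a<..x k})\<bar> \<le> L * ((b - a) / m) * \<beta>"
        unfolding abs_mult using k L ab by (intro mult_mono \<beta> xab) auto
    qed
    moreover have "(\<Sum>k<m. L * ((b - a) / m) * \<beta>) = L * (b - a) * \<beta>" using m by simp
    ultimately show ?thesis by linarith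
  qed
  have "(\<lambda>m. L * (b - a) * \<beta> + 2 * (L * ((b - a) / real m))) \<longlonglongrightarrow> L * (b - a) * \<beta> + 2 * (L * 0)"
    by (intro tendsto_intros tendsto_divide_0[OF tendsto_const] filterlim_at_top_imp_at_infinity filterlim_real_sequentially)
  then have "(\<lambda>m. L * (b - a) * \<beta> + 2 * (L * ((b - a) / real m))) \<longlonglongrightarrow> L * (b - a) * \<beta>" by simp
  then show ?thesis
  proof (rule LIMSEQ_le_const, intro exI[of _ 1] allI impI)
    fix m :: nat assume "1 \<le> m"
    then show "\<bar>residual \<theta>\<bar> \<le> L * (b - a) * \<beta> + 2 * (L * ((b - a) / real m))" by (intro main) simp
  qed
qed

end

text \<open>Near \<open>t\<close> both \<open>F0\<close> and the law of the observation times have densities bounded away from zero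
  and infinity; \<open>d\<close> is the length over which the estimator averages.\<close>

locale sample_modulus_local = sample_modulus +
  fixes l r p1 p2 q1 q2 d :: real
  assumes pos: "0 < p1" "0 < p2" "0 < q1" "0 < q2" "0 < d"
    and prob_lower: "\<And>x y. l \<le> x \<Longrightarrow> x \<le> y \<Longrightarrow> y \<le> r \<Longrightarrow> p1 * (y - x) \<le> prob {x<..y}"
    and prob_upper: "\<And>x y. l \<le> x \<Longrightarrow> x \<le> y \<Longrightarrow> y \<le> r \<Longrightarrow> prob {x..y} \<le> p2 * (y - x)"
    and F0_lower: "\<And>x y. l \<le> x \<Longrightarrow> x \<le> y \<Longrightarrow> y \<le> r \<Longrightarrow> q1 * (y - x) \<le> F0 y - F0 x"
    and F0_upper: "\<And>x y. l \<le> x \<Longrightarrow> x \<le> y \<Longrightarrow> y \<le> r \<Longrightarrow> F0 y - F0 x \<le> q2 * (y - x)"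
    and d_large: "16 * \<kappa>\<^sup>2 \<le> n * (p1 * d)"
begin

text \<open>The two terms are the bias and the fluctuation of an average over an interval of length \<open>d\<close>.\<close>

definition rate :: real where "rate = q2 * d + 4 * \<kappa> / sqrt (n * (p1 * d))"

lemma rate_nonneg: "0 \<le> rate"
  using pos \<kappa> by (auto simp: rate_def)

lemma mle_rate:
  assumes x: "x \<in> {l + d..r - d}" shows "\<bar>Fh x - F0 x\<bar> \<le> rate"
proof -
  have "Fh x \<le> F0 (x + d) + 4 * \<kappa> / sqrt (n * (p1 * d))"
    using prob_lower[of x "x + d"] x pos d_large by (intro mle_upper mult_left_mono) auto
  moreover have "F0 (x + d) - F0 x \<le> q2 * d" using F0_upper[of x "x + d"] x pos by auto
  moreover have "F0 (x - d) - 4 * \<kappa> / sqrt (n * (p1 * d)) \<le> Fh x"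
    using prob_lower[of "x - d" x] x pos d_large by (intro mle_lower mult_left_mono) auto
  moreover have "F0 x - F0 (x - d) \<le> q2 * d" using F0_upper[of "x - d" x] x pos by auto
  ultimately show ?thesis unfolding rate_def by linarith
qed

text \<open>Here \<open>2 * rate / q1\<close> bounds the length of a block, \<open>\<pi>\<close> its probability, and \<open>w\<close> the fluctuation over it; the last
summand is \<open>rate\<close> times a bound for the number of observations in the block.\<close>

definition cusum_gap :: real where
  "cusum_gap = (let \<pi> = p2 * (2 * rate / q1); w = \<kappa> * (sqrt (n * \<pi>) + 1) in w + rate * (n * \<pi> + w))"

text \<open>A block of the minorant has length of the order of the rate, because the estimator is constant on
  it while \<open>F0\<close> increases with positive slope; hence the cumulative sum diagram is close to its minorant.\<close>

lemma cusum_gap_bound: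
  assumes v: "v \<in> {l + d..r - d}" "l + d + 2 * rate / q1 < v"
  shows "\<bar>\<Sum>i<n. indicat_real {..v} (\<tau> i) * (\<delta> i - Fh (\<tau> i))\<bar> \<le> cusum_gap"
proof -
  obtain s where s: "s \<le> v" "\<And>u. s \<le> u \<Longrightarrow> u \<le> v \<Longrightarrow> Fh u = Fh v"
    and D: "(\<Sum>i<n. indicat_real {..v} (\<tau> i) * (\<delta> i - Fh (\<tau> i))) = (\<Sum>i<n. indicat_real {s..v} (\<tau> i) * (\<delta> i - Fh v))"
    by (rule mle_block_left[where \<delta>=\<delta> and x=v, OF inj \<delta>], assumption, rule that)
  define y where "y = 2 * rate / q1"
  have y: "q1 * y = 2 * rate" "0 \<le> y" using pos rate_nonneg by (auto simp: y_def)
  have vs: "v - s \<le> y"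
  proof (rule ccontr)
    assume "\<not> v - s \<le> y"
    then obtain x where x: "max s (l + d) < x" "x < v - y" using v dense[of "max s (l + d)" "v - y"] by (auto simp: y_def)
    have "q1 * (v - x) \<le> F0 v - F0 x" using x y v pos by (intro F0_lower) auto
    also have "\<dots> \<le> 2 * rate" using mle_rate[of v] mle_rate[of x] s(2)[of x] x v y by auto
    finally have "q1 * (v - x) \<le> q1 * y" using y by simp
    then have "v - x \<le> y" using pos by simp
    then show False using x by simp
  qed
  have ls: "l + d \<le> s" using vs v by (simp add: y_def)
  define \<pi> where "\<pi> = p2 * y"
  define w where "w = \<kappa> * (sqrt (n * \<pi>) + 1)"
  have "prob {s..v} \<le> p2 * (v - s)" using ls s v pos by (intro prob_upper) auto
  also have "\<dots> \<le> \<pi>" using vs pos by (simp add: \<pi>_def)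
  finally have P: "prob {s..v} \<le> \<pi>" .
  then have nP: "n * prob {s..v} \<le> n * \<pi>" by (simp add: mult_left_mono)
  then have Pw: "\<kappa> * (sqrt (n * prob {s..v}) + 1) \<le> w" using \<kappa> by (auto simp: w_def)
  have i: "is_interval {s..v}" by (simp add: is_interval_cc)
  have N: "(\<Sum>i<n. indicat_real {s..v} (\<tau> i)) \<le> n * \<pi> + w" using modulus_G[OF i] Pw nP by linarith
  have "\<bar>\<Sum>i<n. indicat_real {s..v} (\<tau> i) * (\<delta> i - Fh v)\<bar>
    \<le> \<bar>\<Sum>i<n. indicat_real {s..v} (\<tau> i) * (\<delta> i - F0 (\<tau> i))\<bar> + \<bar>\<Sum>i<n. indicat_real {s..v} (\<tau> i) * (F0 (\<tau> i) - Fh v)\<bar>"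
    by (rule order_trans[OF _ abs_triangle_ineq]) (simp add: sum.distrib[symmetric] algebra_simps)
  also have "\<dots> \<le> w + (\<Sum>i<n. indicat_real {s..v} (\<tau> i) * rate)"
  proof (intro add_mono order_trans[OF modulus_F[OF i] Pw] order_trans[OF sum_abs] sum_mono)
    fix j
    show "\<bar>indicat_real {s..v} (\<tau> j) * (F0 (\<tau> j) - Fh v)\<bar> \<le> indicat_real {s..v} (\<tau> j) * rate"
    proof (cases "\<tau> j \<in> {s..v}")
      case True
      then show ?thesis using mle_rate[of "\<tau> j"] s(2)[of "\<tau> j"] ls v by (simp add: abs_minus_commute)
    qed simp
  qed
  also have "(\<Sum>i<n. indicat_real {s..v} (\<tau> i) * rate) = rate * (\<Sum>i<n. indicat_real {s..v} (\<tau> i))"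
    by (simp add: sum_distrib_left mult.commute)
  also have "w + rate * (\<Sum>i<n. indicat_real {s..v} (\<tau> i)) \<le> w + rate * (n * \<pi> + w)"
    using N rate_nonneg by (intro add_left_mono mult_left_mono) auto
  also have "\<dots> = cusum_gap" by (simp add: cusum_gap_def w_def \<pi>_def y_def Let_def)
  finally show ?thesis unfolding D .
qed

text \<open>The residual of an indicator splits into \<open>E\<close>, the integral of \<open>Fh - F0\<close> against the difference of the law and the
empirical measure, and the increment of the distance between the cumulative sum diagram and its minorant. For \<open>E\<close> the
function \<open>Fh - F0\<close> is a difference of two monotone functions with small increments and a small constant.\<close>

lemma residual_interval:
  assumes ab: "a < b" "b \<le> r - d" "l + d + 2 * rate / q1 < a" and v: "v \<in> {a..b}"
  shows "\<bar>residual (indicator {a<..v})\<bar> \<le> ((2 * q2 * (b - a) + 3 * rate) * (\<kappa> * (sqrt n + 1)) + 2 * cusum_gap) / n"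
proof -
  have "0 \<le> 2 * rate / q1" using pos rate_nonneg by simp
  then have la: "l + d \<le> a" using ab(3) by linarith
  have I: "is_interval {a<..v}" by (simp add: is_interval_oc)
  define osc where "osc = \<kappa> * (sqrt n + 1)"
  define E where "E \<psi> = n * expectation (\<lambda>u. indicator {a<..v} u * \<psi> u) - (\<Sum>i<n. indicator {a<..v} (\<tau> i) * \<psi> (\<tau> i))" for \<psi> :: "real \<Rightarrow> real"
  have E1: "\<bar>E (\<lambda>u. Fh u - Fh a)\<bar> \<le> (Fh b - Fh a) * osc" unfolding E_def osc_def
    by (rule modulus_G_mono[OF I]) (use v in \<open>auto intro!: Fh_mono\<close>)
  have E2: "\<bar>E (\<lambda>u. F0 u - F0 a)\<bar> \<le> (F0 b - F0 a) * osc" unfolding E_def osc_def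
    by (rule modulus_G_mono[OF I]) (use v in \<open>auto intro!: F0_mono\<close>)
  have E3: "\<bar>E (\<lambda>u. 1)\<bar> \<le> 1 * osc"
    using modulus_G_mono[OF I, of "\<lambda>_. 1" 0 1] unfolding E_def osc_def by simp
  have int: "integrable P (\<lambda>u. indicator {a<..v} u * \<psi> u)" if "\<psi> \<in> borel_measurable borel" "\<And>u. \<bar>\<psi> u\<bar> \<le> 1" for \<psi> :: "real \<Rightarrow> real"
    using that by (intro integrable_const_bound[where B=1]) (auto simp: indicator_def)
  have i1: "integrable P (\<lambda>u. indicator {a<..v} u * (Fh u - Fh a))"
  proof (rule int)
    show "\<bar>Fh u - Fh a\<bar> \<le> 1" for u using Fh_01[of u] Fh_01[of a] by linarith
  qed simp
  have i2: "integrable P (\<lambda>u. indicator {a<..v} u * (F0 u - F0 a))"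
  proof (rule int)
    show "\<bar>F0 u - F0 a\<bar> \<le> 1" for u using F0_01[of u] F0_01[of a] by linarith
  qed simp
  have i3: "integrable P (\<lambda>u. indicator {a<..v} u * 1 :: real)" by (rule int[of "\<lambda>_. 1"]) auto
  have "E (\<lambda>u. Fh u - F0 u) = E (\<lambda>u. Fh u - Fh a) - E (\<lambda>u. F0 u - F0 a) + (Fh a - F0 a) * E (\<lambda>u. 1)"
  proof -
    have "(\<lambda>u. indicator {a<..v} u * (Fh u - F0 u)) = (\<lambda>u. indicator {a<..v} u * (Fh u - Fh a) - indicator {a<..v} u * (F0 u - F0 a) + (Fh a - F0 a) * (indicator {a<..v} u * 1))"
      by (auto simp: algebra_simps)
    note eq = this
    have x: "expectation (\<lambda>u. f u - g u + c * h u) = expectation f - expectation g + c * expectation h"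
      if "integrable P f" "integrable P g" "integrable P h" for f g h :: "real \<Rightarrow> real" and c
      using that by simp
    have y: "(\<Sum>i<n. f (\<tau> i) - g (\<tau> i) + c * h (\<tau> i)) = (\<Sum>i<n. f (\<tau> i)) - (\<Sum>i<n. g (\<tau> i)) + c * (\<Sum>i<n. h (\<tau> i))"
      for f g h :: "real \<Rightarrow> real" and c by (simp add: sum.distrib sum_subtractf sum_distrib_left)
    have z: "n * (e1 - e2 + c * e3) - (s1 - s2 + c * s3) = (n * e1 - s1) - (n * e2 - s2) + c * (n * e3 - s3)"
      for e1 e2 e3 s1 s2 s3 c :: real by (simp add: algebra_simps)
    have "E (\<lambda>u. Fh u - F0 u) = n * expectation (\<lambda>u. indicator {a<..v} u * (Fh u - Fh a) - indicator {a<..v} u * (F0 u - F0 a) + (Fh a - F0 a) * (indicator {a<..v} u * 1))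
      - (\<Sum>i<n. indicator {a<..v} (\<tau> i) * (Fh (\<tau> i) - Fh a) - indicator {a<..v} (\<tau> i) * (F0 (\<tau> i) - F0 a) + (Fh a - F0 a) * (indicator {a<..v} (\<tau> i) * 1))"
      unfolding E_def using eq by (simp only: fun_eq_iff) 
    then show ?thesis
      unfolding x[OF i1 i2 i3] y[of "\<lambda>u. indicator {a<..v} u * (Fh u - Fh a)" "\<lambda>u. indicator {a<..v} u * (F0 u - F0 a)" _ "\<lambda>u. indicator {a<..v} u * 1"] z E_def .
  qed
  also have "\<bar>\<dots>\<bar> \<le> (Fh b - Fh a) * osc + (F0 b - F0 a) * osc + rate * osc"
  proof -
    have "\<bar>(Fh a - F0 a) * E (\<lambda>u. 1)\<bar> \<le> rate * osc"
      unfolding abs_mult using E3 mle_rate[of a] la ab rate_nonneg by (intro mult_mono) auto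
    then show ?thesis using E1 E2 by linarith
  qed
  also have "\<dots> = (Fh b - Fh a + (F0 b - F0 a) + rate) * osc" by (simp add: algebra_simps)
  also have "\<dots> \<le> (2 * q2 * (b - a) + 3 * rate) * osc"
  proof (rule mult_right_mono)
    show "0 \<le> osc" using \<kappa> by (simp add: osc_def)
    have "F0 b - F0 a \<le> q2 * (b - a)" using ab la pos by (intro F0_upper) auto
    then show "Fh b - Fh a + (F0 b - F0 a) + rate \<le> 2 * q2 * (b - a) + 3 * rate"
      using mle_rate[of a] mle_rate[of b] la ab by auto
  qed
  finally have E: "\<bar>E (\<lambda>u. Fh u - F0 u)\<bar> \<le> (2 * q2 * (b - a) + 3 * rate) * osc" .
  have D: "\<bar>\<Sum>i<n. indicat_real {..u} (\<tau> i) * (\<delta> i - Fh (\<tau> i))\<bar> \<le> cusum_gap" if "u \<in> {a..b}" for u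
    using that la ab by (intro cusum_gap_bound) auto
  have "indicat_real {a<..v} u = indicat_real {..v} u - indicat_real {..a} u" for u
    using v by (auto simp: indicator_def)
  then have "(\<Sum>i<n. indicat_real {a<..v} (\<tau> i) * (\<delta> i - Fh (\<tau> i)))
    = (\<Sum>i<n. indicat_real {..v} (\<tau> i) * (\<delta> i - Fh (\<tau> i))) - (\<Sum>i<n. indicat_real {..a} (\<tau> i) * (\<delta> i - Fh (\<tau> i)))"
    by (simp only: left_diff_distrib sum_subtractf)
  then have D': "\<bar>\<Sum>i<n. indicat_real {a<..v} (\<tau> i) * (\<delta> i - Fh (\<tau> i))\<bar> \<le> 2 * cusum_gap"
    using D[of v] D[of a] v ab by auto
  have "n * residual (indicator {a<..v}) = n * expectation (\<lambda>u. indicator {a<..v} u * (Fh u - F0 u)) - (\<Sum>i<n. indicator {a<..v} (\<tau> i) * (\<delta> i - F0 (\<tau> i)))"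
    using n_pos by (simp add: residual_def right_diff_distrib)
  also have "\<dots> = E (\<lambda>u. Fh u - F0 u) - (\<Sum>i<n. indicat_real {a<..v} (\<tau> i) * (\<delta> i - Fh (\<tau> i)))"
  proof -
    have "indicator {a<..v} (\<tau> i) * (\<delta> i - F0 (\<tau> i)) = indicator {a<..v} (\<tau> i) * (Fh (\<tau> i) - F0 (\<tau> i)) + indicator {a<..v} (\<tau> i) * (\<delta> i - Fh (\<tau> i))" for i
      by (simp add: algebra_simps)
    then show ?thesis unfolding E_def by (simp only: sum.distrib)
  qed
  finally have "\<bar>n * residual (indicator {a<..v})\<bar> \<le> (2 * q2 * (b - a) + 3 * rate) * osc + 2 * cusum_gap"
    using E D' by linarith
  then show ?thesis using n_pos by (simp add: abs_mult osc_def field_simps)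
qed

lemma residual_small:
  assumes ab: "a < b" "b \<le> r - d" "l + d + 2 * rate / q1 < a" and m: "\<theta> \<in> borel_measurable borel"
    and zero: "\<And>u. u \<le> a \<or> b \<le> u \<Longrightarrow> \<theta> u = 0"
    and lip: "\<And>x y. x \<in> {a..b} \<Longrightarrow> y \<in> {a..b} \<Longrightarrow> \<bar>\<theta> x - \<theta> y\<bar> \<le> L * \<bar>x - y\<bar>"
  shows "\<bar>residual \<theta>\<bar> \<le> L * (b - a) * (((2 * q2 * (b - a) + 3 * rate) * (\<kappa> * (sqrt n + 1)) + 2 * cusum_gap) / n)"
  by (rule residual_lipschitz[OF ab(1) m zero lip residual_interval[OF ab]])

end


section \<open>An exponential inequality\<close>

text \<open>Both factors on the right hand side of \<open>1 \<le> (1 + y) (1 - y + y\<^sup>2) = 1 + y\<^sup>3\<close> are nonnegative, and \<open>1 + y \<le> exp y\<close>.\<close>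

lemma exp_minus_le:
  fixes y :: real assumes y: "0 \<le> y" shows "exp (- y) \<le> 1 - y + y\<^sup>2"
proof -
  have "1 \<le> (1 + y) * (1 - y + y\<^sup>2)" using y by (simp add: algebra_simps power2_eq_square)
  also have "\<dots> \<le> exp y * (1 - y + y\<^sup>2)"
    using exp_ge_add_one_self[of y] sum_power2_ge_zero[of "y - 1/2" 0]
    by (intro mult_right_mono) (auto simp: power2_eq_square algebra_simps)
  finally show "exp (- y) \<le> 1 - y + y\<^sup>2" by (simp add: exp_minus field_simps)
qed

lemma exp_le_quadratic:
  fixes x :: real assumes "\<bar>x\<bar> \<le> 1" shows "exp x \<le> 1 + x + x\<^sup>2"
  using exp_bound[of x] exp_minus_le[of "- x"] assms by (cases "0 \<le> x") auto

context prob_space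
begin

lemma integrable_bounded:
  "Z \<in> borel_measurable M \<Longrightarrow> (\<And>\<omega>. \<bar>Z \<omega>\<bar> \<le> C) \<Longrightarrow> integrable M (Z :: 'a \<Rightarrow> real)"
  by (rule integrable_const_bound[where B=C]) auto

text \<open>Chernoff's bound with the moment generating function estimated by \<open>exp (s\<^sup>2 p)\<close>. The threshold has the form
\<open>\<kappa> (sqrt (n p) + 1)\<close> because then \<open>s = 1 / (sqrt (n p) + 1)\<close> is admissible for all \<open>p\<close>: it is at most one and makes
the variance term \<open>n s\<^sup>2 p\<close> at most one.\<close>

lemma bernstein_one_sided:
  fixes Y :: "nat \<Rightarrow> 'a \<Rightarrow> real"
  assumes ind: "indep_vars (\<lambda>_. borel) Y {..<n}" and n: "n > 0"
    and b: "\<And>i \<omega>. \<bar>Y i \<omega>\<bar> \<le> 1" and mean: "\<And>i. i < n \<Longrightarrow> expectation (Y i) = 0"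
    and var: "\<And>i. i < n \<Longrightarrow> expectation (\<lambda>\<omega>. (Y i \<omega>)\<^sup>2) \<le> p"
  shows "prob {\<omega>\<in>space M. \<kappa> * (sqrt (n * p) + 1) \<le> (\<Sum>i<n. Y i \<omega>)} \<le> exp (1 - \<kappa>)"
proof -
  have rv: "Y i \<in> borel_measurable M" if "i < n" for i using ind that by (auto simp: indep_vars_def2)
  have p0: "0 \<le> p" using var[of 0] n by (intro order_trans[OF integral_nonneg_AE]) auto
  \<comment> \<open>The exponent of the Chernoff bound.\<close>
  define s where "s = 1 / (sqrt (n * p) + 1)"
  have sp: "0 \<le> sqrt (n * p)" using p0 by simp
  have s: "0 < s" "s \<le> 1" using sp unfolding s_def by (auto simp: add_nonneg_pos)
  have sY: "\<bar>s * Y i \<omega>\<bar> \<le> 1" for i \<omega> 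
    using s mult_mono[of s 1 "\<bar>Y i \<omega>\<bar>" 1] b[of i \<omega>] by (simp add: abs_mult)
  have ie: "integrable M (\<lambda>\<omega>. exp (s * Y i \<omega>))" if "i < n" for i
    by (rule integrable_bounded[where C="exp 1"]) (use rv[OF that] sY in \<open>auto simp: abs_le_iff\<close>)
  have iY: "integrable M (Y i)" "integrable M (\<lambda>\<omega>. (Y i \<omega>)\<^sup>2)" if "i < n" for i
    using rv[OF that] b by (auto intro!: integrable_bounded[where C=1] simp: abs_square_le_1)
  have mgf: "expectation (\<lambda>\<omega>. exp (s * Y i \<omega>)) \<le> exp (s\<^sup>2 * p)" if i: "i < n" for i
  proof -
    have "expectation (\<lambda>\<omega>. exp (s * Y i \<omega>)) \<le> expectation (\<lambda>\<omega>. 1 + s * Y i \<omega> + s\<^sup>2 * (Y i \<omega>)\<^sup>2)"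
    proof (rule integral_mono[OF ie[OF i]])
      show "integrable M (\<lambda>\<omega>. 1 + s * Y i \<omega> + s\<^sup>2 * (Y i \<omega>)\<^sup>2)" using iY[OF i] by simp
      fix \<omega> show "exp (s * Y i \<omega>) \<le> 1 + s * Y i \<omega> + s\<^sup>2 * (Y i \<omega>)\<^sup>2"
        using exp_le_quadratic[OF sY, of i \<omega>] by (simp add: power_mult_distrib)
    qed
    also have "\<dots> = 1 + s\<^sup>2 * expectation (\<lambda>\<omega>. (Y i \<omega>)\<^sup>2)" using iY[OF i] mean[OF i] by (simp add: prob_space)
    also have "\<dots> \<le> 1 + s\<^sup>2 * p" using var[OF i] by (intro add_left_mono mult_left_mono) auto
    also have "\<dots> \<le> exp (s\<^sup>2 * p)" by (rule exp_ge_add_one_self)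
    finally show ?thesis .
  qed
  have indE: "indep_vars (\<lambda>_. borel) (\<lambda>i \<omega>. exp (s * Y i \<omega>)) {..<n}"
    by (rule indep_vars_compose2[OF ind]) simp
  have "expectation (\<lambda>\<omega>. exp (s * (\<Sum>i<n. Y i \<omega>))) = expectation (\<lambda>\<omega>. \<Prod>i<n. exp (s * Y i \<omega>))"
    by (simp add: sum_distrib_left exp_sum)
  also have "\<dots> = (\<Prod>i<n. expectation (\<lambda>\<omega>. exp (s * Y i \<omega>)))"
    by (rule indep_vars_lebesgue_integral[OF _ indE]) (use ie in auto)
  also have "\<dots> \<le> (\<Prod>i<n. exp (s\<^sup>2 * p))" by (intro prod_mono) (auto intro!: mgf integral_nonneg_AE)
  also have "\<dots> = exp (n * (s\<^sup>2 * p))" by (simp add: exp_of_nat_mult)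
  also have "n * (s\<^sup>2 * p) = (s * sqrt (n * p))\<^sup>2" using p0 by (simp add: power_mult_distrib)
  also have "\<dots> \<le> 1" using sp s by (intro power_le_one) (auto simp: s_def field_simps)
  finally have E: "expectation (\<lambda>\<omega>. exp (s * (\<Sum>i<n. Y i \<omega>))) \<le> exp 1" by simp
  have iS: "integrable M (\<lambda>\<omega>. exp (s * (\<Sum>i<n. Y i \<omega>)))"
    using indep_vars_integrable[OF _ indE] ie by (simp add: sum_distrib_left exp_sum)
  have sk: "s * (\<kappa> * (sqrt (n * p) + 1)) = \<kappa>"
  proof -
    have "0 < sqrt (n * p) + 1" using sp by linarith
    then show ?thesis by (simp add: s_def)
  qed
  have "prob {\<omega>\<in>space M. \<kappa> * (sqrt (n * p) + 1) \<le> (\<Sum>i<n. Y i \<omega>)}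
      = prob {\<omega>\<in>space M. exp \<kappa> \<le> exp (s * (\<Sum>i<n. Y i \<omega>))}"
  proof -
    have "\<kappa> * (sqrt (n * p) + 1) \<le> z \<longleftrightarrow> exp \<kappa> \<le> exp (s * z)" for z
      using mult_le_cancel_left_pos[OF s(1), of "\<kappa> * (sqrt (n * p) + 1)" z] sk by simp
    then show ?thesis by simp
  qed
  also have "\<dots> \<le> expectation (\<lambda>\<omega>. exp (s * (\<Sum>i<n. Y i \<omega>))) / exp \<kappa>"
    by (rule integral_Markov_inequality_measure[OF iS sets.empty_sets]) auto
  also have "\<dots> \<le> exp 1 / exp \<kappa>" using E by (intro divide_right_mono) auto
  finally show ?thesis by (simp add: exp_diff)
qed

lemma bernstein:
  fixes Y :: "nat \<Rightarrow> 'a \<Rightarrow> real"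
  assumes ind: "indep_vars (\<lambda>_. borel) Y {..<n}" and n: "n > 0"
    and b: "\<And>i \<omega>. \<bar>Y i \<omega>\<bar> \<le> 1" and mean: "\<And>i. i < n \<Longrightarrow> expectation (Y i) = 0"
    and var: "\<And>i. i < n \<Longrightarrow> expectation (\<lambda>\<omega>. (Y i \<omega>)\<^sup>2) \<le> p"
  shows "prob {\<omega>\<in>space M. \<kappa> * (sqrt (n * p) + 1) \<le> \<bar>\<Sum>i<n. Y i \<omega>\<bar>} \<le> 2 * exp (1 - \<kappa>)"
proof -
  have [measurable]: "(\<lambda>\<omega>. \<Sum>i<n. Y i \<omega>) \<in> borel_measurable M"
    using ind by (intro borel_measurable_sum) (auto simp: indep_vars_def2)
  have ind': "indep_vars (\<lambda>_. borel) (\<lambda>i \<omega>. - Y i \<omega>) {..<n}"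
    by (rule indep_vars_compose2[OF ind]) simp
  let ?A = "{\<omega>\<in>space M. \<kappa> * (sqrt (n * p) + 1) \<le> (\<Sum>i<n. Y i \<omega>)}"
  let ?B = "{\<omega>\<in>space M. \<kappa> * (sqrt (n * p) + 1) \<le> - (\<Sum>i<n. Y i \<omega>)}"
  have B: "prob ?B \<le> exp (1 - \<kappa>)"
    using bernstein_one_sided[where Y="\<lambda>i \<omega>. - Y i \<omega>" and p=p and \<kappa>=\<kappa>, OF ind' n] b mean var by (simp add: sum_negf)
  have A: "prob ?A \<le> exp (1 - \<kappa>)"
    using bernstein_one_sided[where Y=Y and p=p and \<kappa>=\<kappa>, OF ind n] b mean var by simp
  have "{\<omega>\<in>space M. \<kappa> * (sqrt (n * p) + 1) \<le> \<bar>\<Sum>i<n. Y i \<omega>\<bar>} = ?A \<union> ?B" by auto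
  moreover have "prob (?A \<union> ?B) \<le> prob ?A + prob ?B" by (rule measure_Un_le) auto
  ultimately show ?thesis using A B by simp
qed

end

section \<open>The current status model\<close>

locale current_status = prob_space M for M :: "'a measure" +
  fixes X T :: "nat \<Rightarrow> 'a \<Rightarrow> real" and F0 G :: "real \<Rightarrow> real"
  assumes indep_X: "indep_vars (\<lambda>_. borel) X UNIV"
    and indep_T: "indep_vars (\<lambda>_. borel) T UNIV"
    and indep_XT: "indep_var (PiM UNIV (\<lambda>_::nat. borel)) (\<lambda>\<omega> i. X i \<omega>) (PiM UNIV (\<lambda>_::nat. borel)) (\<lambda>\<omega> i. T i \<omega>)"
    and cdf_X: "\<And>i. cdf (distr M borel (X i)) = F0"
    and cdf_T: "\<And>i. cdf (distr M borel (T i)) = G"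
begin

abbreviation times :: "'a \<Rightarrow> nat \<Rightarrow> real" where "times \<omega> \<equiv> \<lambda>i. T i \<omega>"
abbreviation inds :: "'a \<Rightarrow> nat \<Rightarrow> real" where "inds \<omega> \<equiv> \<lambda>i. of_bool (X i \<omega> \<le> T i \<omega>)"

lemma X_rv [measurable]: "X i \<in> borel_measurable M" and T_rv [measurable]: "T i \<in> borel_measurable M"
  using indep_X indep_T by (auto simp: indep_vars_def2)

abbreviation lawX :: "real measure" where "lawX \<equiv> distr M borel (X 0)"
abbreviation lawT :: "real measure" where "lawT \<equiv> distr M borel (T 0)"

lemma distr_X: "distr M borel (X i) = lawX" and distr_T: "distr M borel (T i) = lawT"
  using cdf_X cdf_T by (auto intro!: cdf_unique)

sublocale lawX: real_distribution lawX by simp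
sublocale lawT: real_distribution lawT by simp

lemma F0_eq: "F0 x = lawX.prob {..x}" and G_eq: "G x = lawT.prob {..x}"
  using cdf_X[of 0] cdf_T[of 0] by (auto simp: cdf_def)

lemma F0_01: "0 \<le> F0 x" "F0 x \<le> 1" and F0_mono: "x \<le> y \<Longrightarrow> F0 x \<le> F0 y"
  by (auto simp: F0_eq intro: lawX.finite_measure_mono)

lemma F0_measurable [measurable]: "F0 \<in> borel_measurable borel"
  by (rule borel_measurable_mono) (auto intro: monoI F0_mono)

text \<open>Independence within each of the two sequences and between them is independence of the whole family, which may then be
regrouped into pairs.\<close>

lemma indep_combined:
  "indep_vars (\<lambda>_::nat \<times> bool. borel) (\<lambda>(i, b). if b then T i else X i) UNIV" (is "indep_vars _ ?Z _")
  unfolding indep_vars_def2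
proof (intro conjI ballI indep_setsI)
  show rv: "random_variable borel (?Z j)" for j by (cases j) auto
  show "{?Z j -` A \<inter> space M |A. A \<in> sets borel} \<subseteq> events" for j
    using measurable_sets[OF rv] by blast
next
  fix A and J :: "(nat \<times> bool) set" assume J: "J \<noteq> {}" "finite J" and A: "\<forall>j\<in>J. A j \<in> {?Z j -` A \<inter> space M |A. A \<in> sets borel}"
  have "\<forall>j\<in>J. \<exists>B. B \<in> sets borel \<and> A j = ?Z j -` B \<inter> space M" using A by blast
  from bchoice[OF this] obtain B where B: "\<And>j. j \<in> J \<Longrightarrow> B j \<in> sets borel" and AB: "\<And>j. j \<in> J \<Longrightarrow> A j = ?Z j -` B j \<inter> space M"
    by blast
  define J1 where "J1 = {i. (i, False) \<in> J}"
  define J2 where "J2 = {i. (i, True) \<in> J}"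
  have JJ: "J = (\<lambda>i. (i, False)) ` J1 \<union> (\<lambda>i. (i, True)) ` J2"
  proof (rule set_eqI)
    fix j :: "nat \<times> bool" show "j \<in> J \<longleftrightarrow> j \<in> (\<lambda>i. (i, False)) ` J1 \<union> (\<lambda>i. (i, True)) ` J2"
      by (cases j; cases "snd j") (auto simp: J1_def J2_def)
  qed
  have fin: "finite J1" "finite J2"
    using J(2) finite_imageD[of "\<lambda>i. (i, False)" J1] finite_imageD[of "\<lambda>i. (i, True)" J2] by (auto simp: JJ inj_on_def)
  define E1 where "E1 = {x \<in> space (PiM UNIV (\<lambda>_::nat. borel)). \<forall>i\<in>J1. x i \<in> B (i, False)}"
  define E2 where "E2 = {x \<in> space (PiM UNIV (\<lambda>_::nat. borel)). \<forall>i\<in>J2. x i \<in> B (i, True)}"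
  have BF: "B (i, False) \<in> sets borel" if "i \<in> J1" for i using B that by (auto simp: J1_def)
  have BT: "B (i, True) \<in> sets borel" if "i \<in> J2" for i using B that by (auto simp: J2_def)
  have E: "E1 \<in> sets (PiM UNIV (\<lambda>_::nat. borel))" "E2 \<in> sets (PiM UNIV (\<lambda>_::nat. borel))"
    unfolding E1_def E2_def using fin BF BT by (auto intro!: sets.sets_Collect_finite_All' measurable_sets_Collect[OF measurable_component_singleton])
  have p1: "prob ((\<lambda>\<omega> i. X i \<omega>) -` E1 \<inter> space M) = (\<Prod>i\<in>J1. prob (X i -` B (i, False) \<inter> space M))"
  proof (cases "J1 = {}")
    case False
    have "(\<lambda>\<omega> i. X i \<omega>) -` E1 \<inter> space M = (\<Inter>i\<in>J1. X i -` B (i, False) \<inter> space M)"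
      using False by (auto simp: E1_def space_PiM)
    then show ?thesis using indep_varsD[OF indep_X False fin(1), of "\<lambda>i. B (i, False)"] BF by simp
  qed (simp add: E1_def space_PiM prob_space)
  have p2: "prob ((\<lambda>\<omega> i. T i \<omega>) -` E2 \<inter> space M) = (\<Prod>i\<in>J2. prob (T i -` B (i, True) \<inter> space M))"
  proof (cases "J2 = {}")
    case False
    have "(\<lambda>\<omega> i. T i \<omega>) -` E2 \<inter> space M = (\<Inter>i\<in>J2. T i -` B (i, True) \<inter> space M)"
      using False by (auto simp: E2_def space_PiM)
    then show ?thesis using indep_varsD[OF indep_T False fin(2), of "\<lambda>i. B (i, True)"] BT by simp
  qed (simp add: E2_def space_PiM prob_space)
  have "(\<Inter>j\<in>J. A j) = (\<lambda>\<omega>. (\<lambda>i. X i \<omega>, \<lambda>i. T i \<omega>)) -` (E1 \<times> E2) \<inter> space M"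
  proof -
    have "(\<Inter>j\<in>J. A j) = (\<Inter>j\<in>J. ?Z j -` B j \<inter> space M)" using AB by auto
    also have "\<dots> = {\<omega>\<in>space M. \<forall>j\<in>J. ?Z j \<omega> \<in> B j}" using J(1) by blast
    also have "\<dots> = {\<omega>\<in>space M. (\<forall>i\<in>J1. X i \<omega> \<in> B (i, False)) \<and> (\<forall>i\<in>J2. T i \<omega> \<in> B (i, True))}"
      by (simp add: JJ ball_Un)
    also have "\<dots> = (\<lambda>\<omega>. (\<lambda>i. X i \<omega>, \<lambda>i. T i \<omega>)) -` (E1 \<times> E2) \<inter> space M"
      by (auto simp: E1_def E2_def space_PiM)
    finally show ?thesis .
  qed
  then have "prob (\<Inter>j\<in>J. A j) = (\<Prod>i\<in>J1. prob (X i -` B (i, False) \<inter> space M)) * (\<Prod>i\<in>J2. prob (T i -` B (i, True) \<inter> space M))"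
    using indep_varD[OF indep_XT E] p1 p2 by simp
  also have "\<dots> = (\<Prod>j\<in>J. prob (?Z j -` B j \<inter> space M))"
    unfolding JJ using fin by (subst prod.union_disjoint) (auto simp: prod.reindex inj_on_def)
  also have "\<dots> = (\<Prod>j\<in>J. prob (A j))" using AB by (intro prod.cong) auto
  finally show "prob (\<Inter>j\<in>J. A j) = (\<Prod>j\<in>J. prob (A j))" .
qed

lemma indep_pairs:
  fixes \<psi> :: "real \<Rightarrow> real \<Rightarrow> real"
  assumes [measurable]: "(\<lambda>(x, u). \<psi> x u) \<in> borel_measurable (borel \<Otimes>\<^sub>M borel)"
  shows "indep_vars (\<lambda>_. borel) (\<lambda>i \<omega>. \<psi> (X i \<omega>) (T i \<omega>)) I"
proof -
  let ?Z = "\<lambda>(i, b). if b then T i else X i"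
  let ?K = "\<lambda>i. {(i, False), (i, True)}"
  have "indep_vars (\<lambda>i. PiM (?K i) (\<lambda>_. borel)) (\<lambda>i \<omega>. restrict (\<lambda>j. ?Z j \<omega>) (?K i)) (UNIV :: nat set)"
    by (rule indep_vars_restrict[OF indep_combined]) (auto simp: disjoint_family_on_def)
  then have "indep_vars (\<lambda>_. borel) (\<lambda>i \<omega>. (\<lambda>f. \<psi> (f (i, False)) (f (i, True))) (restrict (\<lambda>j. ?Z j \<omega>) (?K i))) UNIV"
  proof (rule indep_vars_compose2)
    fix i :: nat
    have "(\<lambda>f. (\<lambda>(x, u). \<psi> x u) (f (i, False), f (i, True))) \<in> borel_measurable (PiM (?K i) (\<lambda>_. borel))"
      by measurable
    then show "(\<lambda>f. \<psi> (f (i, False)) (f (i, True))) \<in> borel_measurable (PiM (?K i) (\<lambda>_. borel))" by simp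
  qed
  then show ?thesis by (auto intro: indep_vars_subset)
qed

lemma distr_pair: "distr M (borel \<Otimes>\<^sub>M borel) (\<lambda>\<omega>. (X i \<omega>, T i \<omega>)) = lawX \<Otimes>\<^sub>M lawT"
proof -
  have "indep_var borel ((\<lambda>f. f i) \<circ> (\<lambda>\<omega> i. X i \<omega>)) borel ((\<lambda>f. f i) \<circ> (\<lambda>\<omega> i. T i \<omega>))"
    by (rule indep_var_compose[OF indep_XT]) auto
  then have "indep_var borel (X i) borel (T i)" by (simp add: comp_def)
  then show ?thesis unfolding indep_var_distribution_eq using distr_X[of i] distr_T[of i] by simp
qed

lemma expectation_pair:
  fixes \<psi> :: "real \<Rightarrow> real \<Rightarrow> real"
  assumes m[measurable]: "(\<lambda>(x, u). \<psi> x u) \<in> borel_measurable (borel \<Otimes>\<^sub>M borel)" and b: "\<And>x u. \<bar>\<psi> x u\<bar> \<le> C"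
  shows "expectation (\<lambda>\<omega>. \<psi> (X i \<omega>) (T i \<omega>)) = lawT.expectation (\<lambda>u. lawX.expectation (\<lambda>x. \<psi> x u))"
proof -
  interpret PP: pair_prob_space lawX lawT ..
  have s: "sets (lawX \<Otimes>\<^sub>M lawT) = sets (borel \<Otimes>\<^sub>M borel)" by (intro sets_pair_measure_cong) auto
  have m': "(\<lambda>(x, u). \<psi> x u) \<in> borel_measurable (lawX \<Otimes>\<^sub>M lawT)" using m measurable_cong_sets[OF s refl] by blast
  have int: "integrable (lawX \<Otimes>\<^sub>M lawT) (\<lambda>(x, u). \<psi> x u)"
    by (rule PP.P.integrable_const_bound[where B=C, OF _ m']) (use b in auto)
  have "expectation (\<lambda>\<omega>. \<psi> (X i \<omega>) (T i \<omega>)) = expectation (\<lambda>\<omega>. (\<lambda>(x, u). \<psi> x u) (X i \<omega>, T i \<omega>))" by simp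
  also have "\<dots> = integral\<^sup>L (distr M (borel \<Otimes>\<^sub>M borel) (\<lambda>\<omega>. (X i \<omega>, T i \<omega>))) (\<lambda>(x, u). \<psi> x u)"
    by (rule integral_distr[symmetric]) (auto intro: m)
  also have "\<dots> = integral\<^sup>L (lawX \<Otimes>\<^sub>M lawT) (\<lambda>(x, u). \<psi> x u)" by (simp add: distr_pair)
  also have "\<dots> = lawT.expectation (\<lambda>u. lawX.expectation (\<lambda>x. \<psi> x u))"
    by (rule PP.integral_snd[OF int, symmetric])
  finally show ?thesis .
qed

text \<open>Centred given the observation time, for every weight \<open>\<psi>\<close>.\<close>

definition score :: "(real \<Rightarrow> real) \<Rightarrow> real \<Rightarrow> real \<Rightarrow> real" where
  "score \<psi> x u = \<psi> u * (of_bool (x \<le> u) - F0 u)"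

lemma score_measurable:
  assumes [measurable]: "\<psi> \<in> borel_measurable borel"
  shows "(\<lambda>(x, u). score \<psi> x u) \<in> borel_measurable (borel \<Otimes>\<^sub>M borel)"
  unfolding score_def by measurable

lemma score_bound: "\<bar>score \<psi> x u\<bar> \<le> \<bar>\<psi> u\<bar>"
  using F0_01[of u] mult_left_le[of "\<bar>of_bool (x \<le> u) - F0 u\<bar>" "\<bar>\<psi> u\<bar>"] by (auto simp: score_def abs_mult)

lemma expectation_score:
  assumes m: "\<psi> \<in> borel_measurable borel" and b: "\<And>u. \<bar>\<psi> u\<bar> \<le> C"
  shows "expectation (\<lambda>\<omega>. score \<psi> (X i \<omega>) (T i \<omega>)) = 0"
    and "expectation (\<lambda>\<omega>. (score \<psi> (X i \<omega>) (T i \<omega>))\<^sup>2) = lawT.expectation (\<lambda>u. (\<psi> u)\<^sup>2 * (F0 u * (1 - F0 u)))"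
proof -
  have b': "\<bar>score \<psi> x u\<bar> \<le> C" for x u using score_bound[of \<psi> x u] b[of u] by linarith
  have bool: "lawX.expectation (\<lambda>x. of_bool (x \<le> u)) = F0 u" for u
  proof -
    have "(\<lambda>x. of_bool (x \<le> u)) = (indicator {..u} :: real \<Rightarrow> real)" by (auto simp: fun_eq_iff indicator_def)
    then show ?thesis by (simp add: F0_eq)
  qed
  have ib: "integrable lawX (\<lambda>x. of_bool (x \<le> u) :: real)" for u
    by (rule lawX.integrable_const_bound[where B=1]) auto
  have "expectation (\<lambda>\<omega>. score \<psi> (X i \<omega>) (T i \<omega>)) = lawT.expectation (\<lambda>u. lawX.expectation (\<lambda>x. score \<psi> x u))"
    by (rule expectation_pair[OF score_measurable[OF m] b'])
  also have "\<dots> = 0" using ib bool lawX.prob_space unfolding score_def by simp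
  finally show "expectation (\<lambda>\<omega>. score \<psi> (X i \<omega>) (T i \<omega>)) = 0" .
  have m2: "(\<lambda>(x, u). (score \<psi> x u)\<^sup>2) \<in> borel_measurable (borel \<Otimes>\<^sub>M borel)"
    using borel_measurable_power[OF score_measurable[OF m], of 2] by (simp add: case_prod_beta')
  have C: "\<bar>(score \<psi> x u)\<^sup>2\<bar> \<le> C\<^sup>2" for x u
    using power_mono[OF b', of x u 2] by simp
  have "expectation (\<lambda>\<omega>. (score \<psi> (X i \<omega>) (T i \<omega>))\<^sup>2) = lawT.expectation (\<lambda>u. lawX.expectation (\<lambda>x. (score \<psi> x u)\<^sup>2))"
    by (rule expectation_pair[OF m2 C])
  also have "\<dots> = lawT.expectation (\<lambda>u. (\<psi> u)\<^sup>2 * (F0 u * (1 - F0 u)))"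
  proof (rule arg_cong[where f="lawT.expectation"], rule ext)
    fix u
    have "(score \<psi> x u)\<^sup>2 = (\<psi> u)\<^sup>2 * ((1 - 2 * F0 u) * of_bool (x \<le> u) + (F0 u)\<^sup>2)" for x
      by (auto simp: score_def power_mult_distrib power2_eq_square algebra_simps)
    then have "lawX.expectation (\<lambda>x. (score \<psi> x u)\<^sup>2) = lawX.expectation (\<lambda>x. (\<psi> u)\<^sup>2 * ((1 - 2 * F0 u) * of_bool (x \<le> u) + (F0 u)\<^sup>2))"
      by simp
    also have "\<dots> = (\<psi> u)\<^sup>2 * ((1 - 2 * F0 u) * F0 u + (F0 u)\<^sup>2)"
      using ib[of u] bool[of u] lawX.prob_space by simp
    also have "\<dots> = (\<psi> u)\<^sup>2 * (F0 u * (1 - F0 u))" by (simp add: power2_eq_square algebra_simps)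
    finally show "lawX.expectation (\<lambda>x. (score \<psi> x u)\<^sup>2) = (\<psi> u)\<^sup>2 * (F0 u * (1 - F0 u))" .
  qed
  finally show "expectation (\<lambda>\<omega>. (score \<psi> (X i \<omega>) (T i \<omega>))\<^sup>2) = lawT.expectation (\<lambda>u. (\<psi> u)\<^sup>2 * (F0 u * (1 - F0 u)))" .
qed

end


section \<open>A modulus of continuity holds with high probability\<close>

text \<open>It suffices to control the unions of consecutive cells of a partition into \<open>n\<close> cells of
  probability \<open>1 / n\<close>: an interval differs from such a union by parts of two cells.\<close>

lemma modulus_from_cells:
  fixes cell :: "real \<Rightarrow> nat" and P :: "real measure" and d \<tau> :: "nat \<Rightarrow> real"
  defines "B \<equiv> \<lambda>l r. {u. l \<le> cell u \<and> cell u \<le> r}"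
  assumes P: "real_distribution P" and n: "n > 0" and \<kappa>: "1 \<le> \<kappa>"
    and mono: "\<And>x y. x \<le> y \<Longrightarrow> cell x \<le> cell y" and cn: "\<And>u. cell u \<le> n"
    and meas: "\<And>l r. B l r \<in> sets borel" and small: "\<And>j. measure P (B j j) \<le> 1 / n"
    and d: "\<And>i. i < n \<Longrightarrow> \<bar>d i\<bar> \<le> 1"
    and H1: "\<And>l r. l \<le> n \<Longrightarrow> r \<le> n \<Longrightarrow> \<bar>(\<Sum>i<n. indicat_real (B l r) (\<tau> i)) - n * measure P (B l r)\<bar> \<le> \<kappa> * (sqrt (n * measure P (B l r)) + 1)"
    and H2: "\<And>l r. l \<le> n \<Longrightarrow> r \<le> n \<Longrightarrow> \<bar>\<Sum>i<n. indicat_real (B l r) (\<tau> i) * d i\<bar> \<le> \<kappa> * (sqrt (n * measure P (B l r)) + 1)"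
    and A: "is_interval A"
  shows "\<bar>(\<Sum>i<n. indicat_real A (\<tau> i)) - n * measure P A\<bar> \<le> 12 * \<kappa> * (sqrt (n * measure P A) + 1)"
    and "\<bar>\<Sum>i<n. indicat_real A (\<tau> i) * d i\<bar> \<le> 12 * \<kappa> * (sqrt (n * measure P A) + 1)"
proof -
  interpret real_distribution P by fact
  have "\<bar>(\<Sum>i<n. indicat_real A (\<tau> i)) - n * measure P A\<bar> \<le> 12 * \<kappa> * (sqrt (n * measure P A) + 1) \<and>
    \<bar>\<Sum>i<n. indicat_real A (\<tau> i) * d i\<bar> \<le> 12 * \<kappa> * (sqrt (n * measure P A) + 1)"
  proof (cases "A = {}")
    case True then show ?thesis using \<kappa> by simp
  next
    case ne: False
    have fin: "finite (cell ` A)" by (rule finite_subset[of _ "{..n}"]) (use cn in auto)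
    define l where "l = Min (cell ` A)"
    define r where "r = Max (cell ` A)"
    have l: "l \<in> cell ` A" "\<And>u. u \<in> A \<Longrightarrow> l \<le> cell u" and r: "r \<in> cell ` A" "\<And>u. u \<in> A \<Longrightarrow> cell u \<le> r"
      using fin ne by (auto simp: l_def r_def)
    have lrn: "l \<le> n" "r \<le> n" using l(1) r(1) cn by auto
    have sub: "A \<subseteq> B l r" using l(2) r(2) by (auto simp: B_def)
    have rest: "B l r - A \<subseteq> B l l \<union> B r r"
    proof
      fix u assume u: "u \<in> B l r - A"
      show "u \<in> B l l \<union> B r r"
      proof (rule ccontr)
        assume "u \<notin> B l l \<union> B r r"
        then have lt: "l < cell u" "cell u < r" using u by (auto simp: B_def)
        obtain a b where ab: "a \<in> A" "b \<in> A" "cell a = l" "cell b = r" using l(1) r(1) by auto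
        have "\<not> u \<le> a" "\<not> b \<le> u" using mono[of u a] mono[of b u] ab lt by auto
        then have "a \<le> u" "u \<le> b" by auto
        with ab A have "u \<in> A" unfolding is_interval_1 by blast
        then show False using u by simp
      qed
    qed
    have [measurable]: "A \<in> sets borel" using A by (rule real_interval_borel_measurable)
    note meas[measurable]
    define s where "s = sqrt (n * prob A)"
    have s0: "0 \<le> s" by (simp add: s_def)
    have "prob (B l r) \<le> prob A + (prob (B l l) + prob (B r r))"
    proof -
      have "prob (B l r) \<le> prob (A \<union> (B l l \<union> B r r))" using sub rest by (intro finite_measure_mono) auto
      also have "\<dots> \<le> prob A + prob (B l l \<union> B r r)" by (rule measure_Un_le) auto
      also have "prob (B l l \<union> B r r) \<le> prob (B l l) + prob (B r r)" by (rule measure_Un_le) auto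
      finally show ?thesis by simp
    qed
    also have "\<dots> \<le> prob A + (1 / n + 1 / n)" using small by (intro add_mono) auto
    finally have PB: "n * prob (B l r) \<le> n * prob A + 2" using n by (simp add: field_simps)
    have PA: "n * prob A \<le> n * prob (B l r)" using sub by (intro mult_left_mono finite_measure_mono) auto
    have "sqrt (n * prob (B l r)) \<le> sqrt ((s + 2)\<^sup>2)"
    proof (rule real_sqrt_le_mono)
      have "n * prob A + 2 \<le> (s + 2)\<^sup>2" using s0 by (simp add: s_def power2_sum)
      then show "n * prob (B l r) \<le> (s + 2)\<^sup>2" using PB by linarith
    qed
    then have sB: "sqrt (n * prob (B l r)) \<le> s + 2" using s0 by simp
    have KB: "\<kappa> * (sqrt (n * prob (B l r)) + 1) \<le> \<kappa> * (s + 3)" using sB \<kappa> by (intro mult_left_mono) auto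
    have C: "(\<Sum>i<n. indicat_real (B j j) (\<tau> i)) \<le> 1 + 2 * \<kappa>" if "j \<le> n" for j
    proof -
      have 1: "n * prob (B j j) \<le> 1" using small[of j] n by (simp add: field_simps)
      have "\<kappa> * (sqrt (n * prob (B j j)) + 1) \<le> \<kappa> * (1 + 1)" using 1 \<kappa> by (intro mult_left_mono add_mono) auto
      also have "\<dots> = 2 * \<kappa>" by simp
      finally have 2: "\<kappa> * (sqrt (n * prob (B j j)) + 1) \<le> 2 * \<kappa>" .
      show ?thesis using H1[OF that that] 1 2 by linarith
    qed
    define R where "R = (\<Sum>i<n. indicat_real (B l r - A) (\<tau> i))"
    have "R \<le> (\<Sum>i<n. indicat_real (B l l) (\<tau> i) + indicat_real (B r r) (\<tau> i))"
      unfolding R_def by (intro sum_mono) (use rest in \<open>auto simp: indicator_def\<close>)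
    then have R: "R \<le> 2 + 4 * \<kappa>" using C[OF lrn(1)] C[OF lrn(2)] by (simp add: sum.distrib)
    have R0: "0 \<le> R" unfolding R_def by (intro sum_nonneg) auto
    have ind: "indicat_real A u = indicat_real (B l r) u - indicat_real (B l r - A) u" for u
      using sub by (auto simp: indicator_def)
    have fin: "\<kappa> * (s + 3) + (2 + 4 * \<kappa>) \<le> 12 * \<kappa> * (s + 1)"
    proof -
      have "0 \<le> \<kappa> * s" using \<kappa> s0 by simp
      then show ?thesis using \<kappa> by (simp add: algebra_simps)
    qed
    have N: "(\<Sum>i<n. indicat_real A (\<tau> i)) = (\<Sum>i<n. indicat_real (B l r) (\<tau> i)) - R"
      unfolding R_def ind by (simp add: sum_subtractf)
    have "\<bar>(\<Sum>i<n. indicat_real A (\<tau> i)) - n * prob A\<bar> \<le> \<kappa> * (s + 3) + (2 + 4 * \<kappa>)"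
      unfolding N by (rule abs_leI) (use H1[OF lrn] KB R R0 PA PB \<kappa> in linarith)+
    moreover have "\<bar>\<Sum>i<n. indicat_real A (\<tau> i) * d i\<bar> \<le> \<kappa> * (s + 3) + (2 + 4 * \<kappa>)"
    proof -
      have "(\<Sum>i<n. indicat_real A (\<tau> i) * d i) = (\<Sum>i<n. indicat_real (B l r) (\<tau> i) * d i) - (\<Sum>i<n. indicat_real (B l r - A) (\<tau> i) * d i)"
        unfolding ind by (simp add: left_diff_distrib sum_subtractf)
      moreover have "\<bar>\<Sum>i<n. indicat_real (B l r - A) (\<tau> i) * d i\<bar> \<le> R"
        unfolding R_def by (rule order_trans[OF sum_abs sum_mono]) (use d in \<open>auto simp: indicator_def\<close>)
      ultimately show ?thesis using H2[OF lrn] KB R by linarith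
    qed
    ultimately show ?thesis using fin by (simp add: s_def)
  qed
  then show "\<bar>(\<Sum>i<n. indicat_real A (\<tau> i)) - n * measure P A\<bar> \<le> 12 * \<kappa> * (sqrt (n * measure P A) + 1)"
    and "\<bar>\<Sum>i<n. indicat_real A (\<tau> i) * d i\<bar> \<le> 12 * \<kappa> * (sqrt (n * measure P A) + 1)" by auto
qed

text \<open>Continuity excludes ties, and strict monotonicity makes \<open>G\<close> invertible on the support.\<close>

locale current_status_cont = current_status +
  assumes G_cont: "\<And>x. isCont G x"
    and G_neg: "\<And>x. x < 0 \<Longrightarrow> G x = 0"
    and G_strict: "\<And>x y. 0 \<le> x \<Longrightarrow> x < y \<Longrightarrow> G x < G y"
begin

lemma G_mono: "x \<le> y \<Longrightarrow> G x \<le> G y" and G_01: "0 \<le> G x" "G x \<le> 1"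
  by (auto simp: G_eq intro: lawT.finite_measure_mono)

lemma G_measurable [measurable]: "G \<in> borel_measurable borel"
  by (rule borel_measurable_mono) (auto intro: monoI G_mono)

lemma G_zero: "G 0 = 0"
proof -
  have "((\<lambda>x. G x) \<longlongrightarrow> G 0) (at_left 0)" using G_cont[of 0] by (simp add: isCont_def filterlim_at_split)
  moreover have "((\<lambda>x. G x) \<longlongrightarrow> 0) (at_left 0)"
    by (rule tendsto_eventually) (auto simp: eventually_at_filter G_neg)
  ultimately show ?thesis by (intro tendsto_unique[of "at_left (0::real)"]) auto
qed

lemma prob_G_le:
  assumes v: "0 \<le> v" "v \<le> 1" shows "lawT.prob {u. G u \<le> v} = v"
proof (cases "v = 1")
  case True
  then have "{u. G u \<le> v} = space lawT" using G_01 by auto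
  then show ?thesis using True lawT.prob_space by metis
next
  case False
  have "(G \<longlongrightarrow> 1) at_top" using lawT.cdf_lim_at_top_prob cdf_T[of 0] by simp
  then have "eventually (\<lambda>x. v < G x) at_top" using v False by (intro order_tendstoD(1)) auto
  then obtain b where b: "\<And>x. b \<le> x \<Longrightarrow> v < G x" by (auto simp: eventually_at_top_linorder)
  have "\<exists>x\<ge>0. x \<le> max 0 b \<and> G x = v"
    using b[of "max 0 b"] v G_zero G_cont by (intro IVT) auto
  then obtain x where x: "0 \<le> x" "G x = v" by auto
  have "{u. G u \<le> v} = {..x}"
  proof (rule set_eqI)
    fix u show "u \<in> {u. G u \<le> v} \<longleftrightarrow> u \<in> {..x}"
      using G_mono[of u x] G_strict[OF x(1), of u] x(2) by (auto simp: not_le[symmetric])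
  qed
  then show ?thesis using G_eq[of x] x by simp
qed

text \<open>The level sets of \<open>cell n\<close> are the cells: the one with number \<open>j \<ge> 1\<close> is where \<open>(j - 1) / n < G \<le> j / n\<close>, and cell \<open>0\<close>, where
\<open>G\<close> vanishes, has probability zero.\<close>

definition cell :: "nat \<Rightarrow> real \<Rightarrow> nat" where "cell n u = nat \<lceil>n * G u\<rceil>"
definition cells :: "nat \<Rightarrow> nat \<Rightarrow> nat \<Rightarrow> real set" where "cells n l r = {u. l \<le> cell n u \<and> cell n u \<le> r}"

lemma cell_le_iff: "cell n u \<le> r \<longleftrightarrow> n * G u \<le> r"
  unfolding cell_def by (simp add: ceiling_le_iff nat_le_iff)

lemma le_cell_iff: "l \<le> cell n u \<longleftrightarrow> l = 0 \<or> \<not> n * G u \<le> real (l - 1)"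
  using cell_le_iff[of n u "l - 1"] by (cases l) (auto simp: Suc_le_eq not_le)

lemma cells_measurable [measurable]: "cells n l r \<in> sets borel"
proof -
  have "cells n l r = {u. n * G u \<le> r} - (if l = 0 then {} else {u. n * G u \<le> real (l - 1)})"
    using cell_le_iff[of n _ r] le_cell_iff[of l n] by (auto simp: cells_def)
  then show ?thesis by simp
qed

lemma prob_cells_single:
  assumes n: "n > 0" shows "lawT.prob (cells n j j) \<le> 1 / n"
proof (cases "j = 0 \<or> n < j")
  case True
  then have "cells n j j \<subseteq> {u. G u \<le> 0}"
  proof
    assume "n < j"
    moreover have "cell n u \<le> n" for u using G_01[of u] by (simp add: cell_le_iff mult_left_le)
    ultimately have "cells n j j = {}" by (auto simp: cells_def not_le[symmetric] dest: le_trans)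
    then show ?thesis by simp
  next
    assume "j = 0"
    then show ?thesis using cell_le_iff[of n _ 0] n by (auto simp: cells_def mult_le_0_iff)
  qed
  then have "lawT.prob (cells n j j) \<le> lawT.prob {u. G u \<le> 0}" by (intro lawT.finite_measure_mono) auto
  then show ?thesis using prob_G_le[of 0] n by (simp add: order_trans)
next
  case False
  then have j: "0 < j" "j \<le> n" by auto
  have "cells n j j = {u. G u \<le> real j / n} - {u. G u \<le> real (j - 1) / n}"
  proof -
    have "n * G u \<le> real i \<longleftrightarrow> G u \<le> real i / n" for u i using n by (simp add: field_simps)
    note iff = this
    have e1: "cell n u \<le> j \<longleftrightarrow> G u \<le> real j / n" for u unfolding cell_le_iff by (rule iff)
    have e2: "j \<le> cell n u \<longleftrightarrow> \<not> G u \<le> real (j - 1) / n" for u unfolding le_cell_iff iff using j(1) by blast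
    show ?thesis unfolding cells_def e1 e2 by blast
  qed
  moreover have "lawT.prob ({u. G u \<le> real j / n} - {u. G u \<le> real (j - 1) / n}) = lawT.prob {u. G u \<le> real j / n} - lawT.prob {u. G u \<le> real (j - 1) / n}"
  proof (rule lawT.finite_measure_Diff)
    have "real (j - 1) / n \<le> real j / n" by (intro divide_right_mono) auto
    then show "{u. G u \<le> real (j - 1) / n} \<subseteq> {u. G u \<le> real j / n}" by auto
  qed auto
  moreover have "\<dots> = real j / n - real (j - 1) / n" using j n by (subst (1 2) prob_G_le) auto
  ultimately have "lawT.prob (cells n j j) = real j / n - real (j - 1) / n" by (simp only:)
  also have "\<dots> = 1 / n" using j by (simp add: of_nat_diff diff_divide_distrib[symmetric])
  finally show ?thesis by simp
qed

definition centred :: "real set \<Rightarrow> real \<Rightarrow> real" where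
  "centred A u = indicat_real A u - lawT.prob A"

text \<open>The inequalities are required for the finitely many unions of consecutive cells only, which makes this an event; the
modulus for all intervals follows on it at the cost of a constant.\<close>

definition good :: "nat \<Rightarrow> real \<Rightarrow> 'a set" where
  "good n \<kappa> = {\<omega>\<in>space M. \<forall>l\<in>{..n}. \<forall>r\<in>{..n}.
     \<not> \<kappa> * (sqrt (n * lawT.prob (cells n l r)) + 1) \<le> \<bar>\<Sum>i<n. centred (cells n l r) (T i \<omega>)\<bar> \<and>
     \<not> \<kappa> * (sqrt (n * lawT.prob (cells n l r)) + 1) \<le> \<bar>\<Sum>i<n. score (indicator (cells n l r)) (X i \<omega>) (T i \<omega>)\<bar>} \<inter>
   {\<omega>\<in>space M. inj_on (\<lambda>i. T i \<omega>) {..<n}}"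

lemma prob_centred:
  assumes n: "n > 0" and [measurable]: "A \<in> sets borel"
  shows "prob {\<omega>\<in>space M. \<kappa> * (sqrt (n * lawT.prob A) + 1) \<le> \<bar>\<Sum>i<n. centred A (T i \<omega>)\<bar>} \<le> 2 * exp (1 - \<kappa>)"
proof (rule bernstein[OF _ n])
  show "indep_vars (\<lambda>_. borel) (\<lambda>i \<omega>. centred A (T i \<omega>)) {..<n}"
    by (rule indep_pairs[of "\<lambda>_ u. centred A u"]) (simp add: centred_def)
  show "\<bar>centred A (T i \<omega>)\<bar> \<le> 1" for i \<omega> by (auto simp: centred_def indicator_def)
  have ii: "integrable lawT (indicat_real A)" by (rule lawT.integrable_const_bound[where B=1]) auto
  have e: "expectation (\<lambda>\<omega>. f (T i \<omega>)) = lawT.expectation f" if "f \<in> borel_measurable borel" for f :: "real \<Rightarrow> real" and i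
  proof -
    have "lawT.expectation f = integral\<^sup>L (distr M borel (T i)) f" by (simp only: distr_T[of i])
    also have "\<dots> = expectation (\<lambda>\<omega>. f (T i \<omega>))" by (rule integral_distr) (use that in auto)
    finally show ?thesis by simp
  qed
  show "expectation (\<lambda>\<omega>. centred A (T i \<omega>)) = 0" for i
    using ii lawT.prob_space e[of "centred A" i] by (simp add: centred_def[abs_def])
  show "expectation (\<lambda>\<omega>. (centred A (T i \<omega>))\<^sup>2) \<le> lawT.prob A" for i
  proof -
    have "(centred A u)\<^sup>2 = (1 - 2 * lawT.prob A) * indicat_real A u + (lawT.prob A)\<^sup>2" for u
      by (auto simp: centred_def indicator_def power2_eq_square algebra_simps)
    then have "expectation (\<lambda>\<omega>. (centred A (T i \<omega>))\<^sup>2) = lawT.expectation (\<lambda>u. (1 - 2 * lawT.prob A) * indicat_real A u + (lawT.prob A)\<^sup>2)"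
      using e[of "\<lambda>u. (centred A u)\<^sup>2" i] by (simp add: centred_def)
    also have "\<dots> = (1 - 2 * lawT.prob A) * lawT.prob A + (lawT.prob A)\<^sup>2"
      using ii lawT.prob_space by simp
    also have "\<dots> = lawT.prob A - (lawT.prob A)\<^sup>2" by (simp add: power2_eq_square algebra_simps)
    also have "\<dots> \<le> lawT.prob A" by simp
    finally show ?thesis .
  qed
qed

lemma prob_score_indicator:
  assumes n: "n > 0" and [measurable]: "A \<in> sets borel"
  shows "prob {\<omega>\<in>space M. \<kappa> * (sqrt (n * lawT.prob A) + 1) \<le> \<bar>\<Sum>i<n. score (indicator A) (X i \<omega>) (T i \<omega>)\<bar>} \<le> 2 * exp (1 - \<kappa>)"
proof (rule bernstein[OF _ n])
  show "indep_vars (\<lambda>_. borel) (\<lambda>i \<omega>. score (indicator A) (X i \<omega>) (T i \<omega>)) {..<n}"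
    by (rule indep_pairs[OF score_measurable]) simp
  show "\<bar>score (indicator A) (X i \<omega>) (T i \<omega>)\<bar> \<le> 1" for i \<omega>
    by (rule order_trans[OF score_bound]) (auto simp: indicator_def)
  show "expectation (\<lambda>\<omega>. score (indicator A) (X i \<omega>) (T i \<omega>)) = 0" for i
    by (rule expectation_score(1)[where C=1]) (auto simp: indicator_def)
  show "expectation (\<lambda>\<omega>. (score (indicator A) (X i \<omega>) (T i \<omega>))\<^sup>2) \<le> lawT.prob A" for i
  proof -
    have "expectation (\<lambda>\<omega>. (score (indicator A) (X i \<omega>) (T i \<omega>))\<^sup>2) = lawT.expectation (\<lambda>u. (indicat_real A u)\<^sup>2 * (F0 u * (1 - F0 u)))"
      by (rule expectation_score(2)[where C=1]) (auto simp: indicator_def)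
    also have "\<dots> \<le> lawT.expectation (indicat_real A)"
    proof (rule integral_mono)
      have 0: "0 \<le> F0 u * (1 - F0 u)" "F0 u * (1 - F0 u) \<le> 1" for u
        using F0_01[of u] mult_mono[of "F0 u" 1 "1 - F0 u" 1] by auto
      show "integrable lawT (\<lambda>u. (indicat_real A u)\<^sup>2 * (F0 u * (1 - F0 u)))"
        by (rule lawT.integrable_const_bound[where B=1]) (use 0 in \<open>auto simp: indicator_def\<close>)
      show "integrable lawT (indicat_real A)" by (rule lawT.integrable_const_bound[where B=1]) auto
      show "(indicat_real A u)\<^sup>2 * (F0 u * (1 - F0 u)) \<le> indicat_real A u" for u
        using 0[of u] by (auto simp: indicator_def)
    qed
    finally show ?thesis by simp
  qed
qed

lemma AE_distinct: "AE \<omega> in M. inj_on (\<lambda>i. T i \<omega>) {..<n}"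
proof -
  have atom: "emeasure lawT {x} = 0" for x
    using lawT.isCont_cdf[of x] G_cont[of x] cdf_T[of 0] by (simp add: lawT.emeasure_eq_measure)
  have "AE \<omega> in M. T i \<omega> \<noteq> T j \<omega>" if "i \<noteq> j" for i j
  proof -
    have "indep_var (PiM {i} (\<lambda>_. borel)) (\<lambda>\<omega>. restrict (\<lambda>i. T i \<omega>) {i}) (PiM {j} (\<lambda>_. borel)) (\<lambda>\<omega>. restrict (\<lambda>i. T i \<omega>) {j})"
      by (rule indep_var_restrict[OF indep_T]) (use that in auto)
    then have "indep_var borel ((\<lambda>f. f i) \<circ> (\<lambda>\<omega>. restrict (\<lambda>i. T i \<omega>) {i})) borel ((\<lambda>f. f j) \<circ> (\<lambda>\<omega>. restrict (\<lambda>i. T i \<omega>) {j}))"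
      by (rule indep_var_compose) auto
    then have "indep_var borel (T i) borel (T j)" by (simp add: comp_def)
    then have d: "distr M (borel \<Otimes>\<^sub>M borel) (\<lambda>\<omega>. (T i \<omega>, T j \<omega>)) = lawT \<Otimes>\<^sub>M lawT"
      unfolding indep_var_distribution_eq using distr_T[of i] distr_T[of j] by simp
    interpret PP: pair_sigma_finite lawT lawT ..
    have "AE z in lawT \<Otimes>\<^sub>M lawT. fst z \<noteq> snd z"
    proof (rule PP.AE_pair_measure)
      show "{x \<in> space (lawT \<Otimes>\<^sub>M lawT). fst x \<noteq> snd x} \<in> sets (lawT \<Otimes>\<^sub>M lawT)" by measurable
      show "AE x in lawT. AE y in lawT. fst (x, y) \<noteq> snd (x, y)"
      proof (rule AE_I2)
        fix x show "AE y in lawT. fst (x, y) \<noteq> snd (x, y)"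
          by (rule AE_I'[where N="{x}"]) (use atom in \<open>auto simp: null_sets_def\<close>)
      qed
    qed
    then have "AE z in distr M (borel \<Otimes>\<^sub>M borel) (\<lambda>\<omega>. (T i \<omega>, T j \<omega>)). fst z \<noteq> snd z" unfolding d .
    then show ?thesis by (subst (asm) AE_distr_iff) auto
  qed
  then have "AE \<omega> in M. \<forall>i\<in>{..<n}. \<forall>j\<in>{..<n}. i \<noteq> j \<longrightarrow> T i \<omega> \<noteq> T j \<omega>"
    by (intro AE_finite_allI) auto
  then show ?thesis by eventually_elim (auto simp: inj_on_def)
qed

lemma good_measurable [measurable]: "good n \<kappa> \<in> events"
proof -
  have [measurable]: "(\<lambda>\<omega>. score (indicator (cells n l r)) (X i \<omega>) (T i \<omega>)) \<in> borel_measurable M" for l r i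
    unfolding score_def by measurable
  have "{\<omega>\<in>space M. inj_on (\<lambda>i. T i \<omega>) {..<n}} = {\<omega>\<in>space M. \<forall>i\<in>{..<n}. \<forall>j\<in>{..<n}. T i \<omega> = T j \<omega> \<longrightarrow> i = j}"
    by (auto simp: inj_on_def)
  then have [measurable]: "{\<omega>\<in>space M. inj_on (\<lambda>i. T i \<omega>) {..<n}} \<in> events" by simp
  show ?thesis unfolding good_def centred_def by measurable
qed

text \<open>A union bound over the two inequalities for each of the \<open>(n + 1)\<^sup>2\<close> pairs of cells.\<close>

lemma prob_good:
  assumes n: "n > 0"
  shows "1 - 4 * (real n + 1)\<^sup>2 * exp (1 - \<kappa>) \<le> prob (good n \<kappa>)"
proof -
  define b1 where "b1 l r = {\<omega>\<in>space M. \<kappa> * (sqrt (n * lawT.prob (cells n l r)) + 1) \<le> \<bar>\<Sum>i<n. centred (cells n l r) (T i \<omega>)\<bar>}" for l r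
  define b2 where "b2 l r = {\<omega>\<in>space M. \<kappa> * (sqrt (n * lawT.prob (cells n l r)) + 1) \<le> \<bar>\<Sum>i<n. score (indicator (cells n l r)) (X i \<omega>) (T i \<omega>)\<bar>}" for l r
  have [measurable]: "(\<lambda>\<omega>. score (indicator (cells n l r)) (X i \<omega>) (T i \<omega>)) \<in> borel_measurable M" for l r i
    unfolding score_def by measurable
  have [measurable]: "b1 l r \<in> events" "b2 l r \<in> events" for l r
    unfolding b1_def b2_def centred_def by measurable
  let ?U = "\<Union>(l, r)\<in>{..n} \<times> {..n}. b1 l r \<union> b2 l r"
  have "prob ?U \<le> (\<Sum>(l, r)\<in>{..n} \<times> {..n}. prob (b1 l r \<union> b2 l r))"
    by (rule order_trans[OF finite_measure_subadditive_finite]) (auto simp: case_prod_beta')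
  also have "\<dots> \<le> (\<Sum>(l, r)\<in>{..n} \<times> {..n}. 4 * exp (1 - \<kappa>))"
  proof (rule sum_mono, clarify)
    fix l r
    have "prob (b1 l r \<union> b2 l r) \<le> prob (b1 l r) + prob (b2 l r)" by (rule measure_Un_le) auto
    also have "\<dots> \<le> 2 * exp (1 - \<kappa>) + 2 * exp (1 - \<kappa>)"
      unfolding b1_def b2_def by (intro add_mono prob_centred[OF n] prob_score_indicator[OF n]) auto
    finally show "prob (b1 l r \<union> b2 l r) \<le> 4 * exp (1 - \<kappa>)" by simp
  qed
  also have "\<dots> = 4 * (real n + 1)\<^sup>2 * exp (1 - \<kappa>)" by (simp add: power2_eq_square algebra_simps)
  finally have U: "prob ?U \<le> 4 * (real n + 1)\<^sup>2 * exp (1 - \<kappa>)" .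
  have "prob (space M - ?U) \<le> prob (good n \<kappa>)"
  proof (rule finite_measure_mono_AE)
    show "AE \<omega> in M. \<omega> \<in> space M - ?U \<longrightarrow> \<omega> \<in> good n \<kappa>"
      using AE_distinct[of n] by eventually_elim (auto simp: good_def b1_def b2_def)
  qed auto
  moreover have "prob (space M - ?U) = 1 - prob ?U" by (rule prob_compl) auto
  ultimately show ?thesis using U by simp
qed

lemma sample_modulus_good:
  assumes n: "n > 0" and \<kappa>: "1 \<le> \<kappa>" and \<omega>: "\<omega> \<in> good n \<kappa>"
  shows "sample_modulus lawT n (times \<omega>) (inds \<omega>) F0 (12 * \<kappa>)"
proof (intro sample_modulus.intro sample_modulus_axioms.intro)
  have H: "\<bar>\<Sum>i<n. centred (cells n l r) (T i \<omega>)\<bar> \<le> \<kappa> * (sqrt (n * lawT.prob (cells n l r)) + 1)"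
      "\<bar>\<Sum>i<n. score (indicator (cells n l r)) (X i \<omega>) (T i \<omega>)\<bar> \<le> \<kappa> * (sqrt (n * lawT.prob (cells n l r)) + 1)"
    if "l \<le> n" "r \<le> n" for l r using \<omega> that by (auto simp: good_def not_le intro: less_imp_le)
  have d: "\<bar>of_bool (X i \<omega> \<le> T i \<omega>) - F0 (T i \<omega>)\<bar> \<le> 1" for i using F0_01[of "T i \<omega>"] by auto
  have c: "cell n u \<le> n" for u using G_01[of u] n by (simp add: cell_le_iff)
  have m: "cell n x \<le> cell n y" if "x \<le> y" for x y
    unfolding cell_def using G_mono[OF that] by (intro nat_mono ceiling_mono mult_left_mono) auto
  note mod = modulus_from_cells[of lawT n \<kappa> "cell n" "\<lambda>i. of_bool (X i \<omega> \<le> T i \<omega>) - F0 (T i \<omega>)" "\<lambda>i. T i \<omega>", folded cells_def,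
      OF _ n \<kappa> m c cells_measurable prob_cells_single[OF n] d]
  fix A :: "real set" assume A: "is_interval A"
  show "\<bar>(\<Sum>i<n. indicat_real A (T i \<omega>)) - n * lawT.prob A\<bar> \<le> 12 * \<kappa> * (sqrt (n * lawT.prob A) + 1)"
    by (rule mod(1)[OF _ _ _ _ A]) (use H in \<open>auto simp: centred_def score_def sum_subtractf\<close>)
  show "\<bar>\<Sum>i<n. indicat_real A (T i \<omega>) * (of_bool (X i \<omega> \<le> T i \<omega>) - F0 (T i \<omega>))\<bar> \<le> 12 * \<kappa> * (sqrt (n * lawT.prob A) + 1)"
    by (rule mod(2)[OF _ _ _ _ A]) (use H in \<open>auto simp: centred_def score_def sum_subtractf\<close>)
qed (use n \<kappa> \<omega> F0_01 F0_mono in \<open>auto simp: good_def\<close>)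

end


section \<open>A central limit theorem with a perturbation\<close>

text \<open>Lyapunov's argument: the third absolute moment is at most \<open>b n\<close> times the variance, so each factor of the characteristic
function of the sum differs from \<open>exp (- a n)\<close>, where \<open>a n = s\<^sup>2 v n / 2\<close>, by \<open>o(1 / n)\<close>.\<close>

lemma (in prob_space) char_triangular_array_tendsto:
  fixes Y :: "nat \<Rightarrow> nat \<Rightarrow> 'a \<Rightarrow> real" and v b :: "nat \<Rightarrow> real" and V s :: real
  assumes ind: "\<And>n. indep_vars (\<lambda>_. borel) (Y n) {..<n}"
    and bnd: "\<And>n i \<omega>. \<bar>Y n i \<omega>\<bar> \<le> b n" and b: "b \<longlonglongrightarrow> 0"
    and mean: "\<And>n i. i < n \<Longrightarrow> expectation (Y n i) = 0"
    and var: "\<And>n i. i < n \<Longrightarrow> expectation (\<lambda>\<omega>. (Y n i \<omega>)\<^sup>2) = v n"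
    and V: "(\<lambda>n. n * v n) \<longlonglongrightarrow> V"
  shows "(\<lambda>n. char (distr M borel (\<lambda>\<omega>. \<Sum>i<n. Y n i \<omega>)) s) \<longlonglongrightarrow> complex_of_real (exp (- (s\<^sup>2 * V / 2)))"
proof -
  define a where "a n = s\<^sup>2 * v n / 2" for n
  have b0: "0 \<le> b n" for n using bnd[of n 0 undefined] by simp
  have rv: "Y n i \<in> borel_measurable M" if "i < n" for n i using ind[of n] that by (auto simp: indep_vars_def2)
  have v0: "0 \<le> v n" if "n > 0" for n
  proof -
    have "0 \<le> expectation (\<lambda>\<omega>. (Y n 0 \<omega>)\<^sup>2)" by (rule integral_nonneg_AE) auto
    then show ?thesis using var[OF that] by simp
  qed
  then have a0: "0 \<le> a n" if "n > 0" for n using that by (simp add: a_def)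
  have iY: "integrable M (Y n i)" if "i < n" for n i
    by (rule integrable_const_bound[where B="b n"]) (use rv[OF that] bnd in auto)
  have Y2: "(Y n i \<omega>)\<^sup>2 \<le> (b n)\<^sup>2" for n i \<omega> using bnd[of n i \<omega>] b0 by (simp add: abs_le_square_iff[symmetric])
  have iY2: "integrable M (\<lambda>\<omega>. (Y n i \<omega>)\<^sup>2)" if "i < n" for n i
    by (rule integrable_const_bound[where B="(b n)\<^sup>2"]) (use rv[OF that] Y2 in auto)
  have one: "cmod (char (distr M borel (Y n i)) s - complex_of_real (exp (- a n))) \<le> \<bar>s\<bar> ^ 3 * b n * v n / 6 + (a n)\<^sup>2"
    if i: "i < n" for n i
  proof -
    have n: "n > 0" using i by simp
    have "cmod (char (distr M borel (Y n i)) s - (1 - s^2 * v n / 2)) \<le> (s^2 / 6) * expectation (\<lambda>x. min (6 * (Y n i x)^2) (\<bar>s\<bar> * \<bar>Y n i x\<bar>^3))"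
      using rv[OF i] iY[OF i] iY2[OF i] mean[OF i] var[OF i] by (intro char_approx3') auto
    also have "expectation (\<lambda>x. min (6 * (Y n i x)^2) (\<bar>s\<bar> * \<bar>Y n i x\<bar>^3)) \<le> expectation (\<lambda>x. \<bar>s\<bar> * b n * (Y n i x)^2)"
    proof (rule integral_mono)
      fix x
      have "min (6 * (Y n i x)^2) (\<bar>s\<bar> * \<bar>Y n i x\<bar>^3) \<le> \<bar>s\<bar> * (\<bar>Y n i x\<bar> * (Y n i x)\<^sup>2)"
        by (simp add: power2_eq_square power3_eq_cube abs_mult mult.assoc[symmetric])
      also have "\<dots> \<le> \<bar>s\<bar> * (b n * (Y n i x)\<^sup>2)" by (intro mult_left_mono mult_right_mono bnd) auto
      finally show "min (6 * (Y n i x)^2) (\<bar>s\<bar> * \<bar>Y n i x\<bar>^3) \<le> \<bar>s\<bar> * b n * (Y n i x)^2" by (simp add: mult.assoc)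
      have [measurable]: "Y n i \<in> borel_measurable M" by (rule rv[OF i])
      show "integrable M (\<lambda>x. min (6 * (Y n i x)^2) (\<bar>s\<bar> * \<bar>Y n i x\<bar>^3))"
      proof (rule integrable_const_bound[where B="6 * (b n)\<^sup>2"])
        have "0 \<le> min (6 * (Y n i x)^2) (\<bar>s\<bar> * \<bar>Y n i x\<bar>^3)" "min (6 * (Y n i x)^2) (\<bar>s\<bar> * \<bar>Y n i x\<bar>^3) \<le> 6 * (b n)\<^sup>2" for x
          using Y2[of n i x] by (auto simp: min_le_iff_disj)
        then show "AE x in M. norm (min (6 * (Y n i x)^2) (\<bar>s\<bar> * \<bar>Y n i x\<bar>^3)) \<le> 6 * (b n)\<^sup>2"
          by (intro AE_I2) (simp only: real_norm_def abs_of_nonneg)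
      qed simp
    qed (use iY2[OF i] in simp)
    also have "expectation (\<lambda>x. \<bar>s\<bar> * b n * (Y n i x)^2) = \<bar>s\<bar> * b n * v n" using var[OF i] by simp
    also have "s^2 / 6 * (\<bar>s\<bar> * b n * v n) = \<bar>s\<bar> ^ 3 * b n * v n / 6"
      by (simp add: power2_eq_square power3_eq_cube abs_mult[symmetric])
    finally have 1: "cmod (char (distr M borel (Y n i)) s - (1 - s^2 * v n / 2)) \<le> \<bar>s\<bar> ^ 3 * b n * v n / 6"
      by (simp add: mult_left_mono)
    have "1 - a n \<le> exp (- a n)" using exp_ge_add_one_self[of "- a n"] by simp
    then have "\<bar>(1 - a n) - exp (- a n)\<bar> \<le> (a n)\<^sup>2" using exp_minus_le[OF a0[OF n]] by simp
    then have "cmod (complex_of_real ((1 - a n) - exp (- a n))) \<le> (a n)\<^sup>2" by (simp only: norm_of_real)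
    then have 2: "cmod ((1 - s^2 * v n / 2) - complex_of_real (exp (- a n))) \<le> (a n)\<^sup>2" by (simp add: a_def)
    show ?thesis by (rule norm_diff_triangle_le[OF 1 2])
  qed
  have main: "cmod (char (distr M borel (\<lambda>\<omega>. \<Sum>i<n. Y n i \<omega>)) s - complex_of_real (exp (- (n * a n))))
      \<le> n * (\<bar>s\<bar> ^ 3 * b n * v n / 6 + (a n)\<^sup>2)" for n
  proof (cases "n > 0")
    case True
    have "char (distr M borel (\<lambda>\<omega>. \<Sum>i<n. Y n i \<omega>)) s = (\<Prod>i<n. char (distr M borel (Y n i)) s)"
      by (rule char_distr_sum[OF ind])
    moreover have "complex_of_real (exp (- (n * a n))) = (\<Prod>i<n. complex_of_real (exp (- a n)))"
      by (simp add: exp_of_nat_mult[symmetric] of_real_power[symmetric] del: of_real_power)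
    moreover have "cmod ((\<Prod>i<n. char (distr M borel (Y n i)) s) - (\<Prod>i<n. complex_of_real (exp (- a n))))
       \<le> (\<Sum>i<n. cmod (char (distr M borel (Y n i)) s - complex_of_real (exp (- a n))))"
    proof (rule norm_prod_diff)
      fix i assume "i \<in> {..<n}"
      then interpret D: real_distribution "distr M borel (Y n i)" using rv by (intro real_distribution_distr) auto
      show "cmod (char (distr M borel (Y n i)) s) \<le> 1" by (rule D.cmod_char_le_1)
      show "cmod (complex_of_real (exp (- a n))) \<le> 1" using a0[OF True] by simp
    qed
    moreover have "\<dots> \<le> (\<Sum>i<n. \<bar>s\<bar> ^ 3 * b n * v n / 6 + (a n)\<^sup>2)" by (intro sum_mono one) simp
    ultimately show ?thesis by simp
  next
    case False
    then show ?thesis using char_distr_sum[OF ind[of n], of s] by simp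
  qed
  have "(\<lambda>n. (s\<^sup>2 / 2) * (n * v n) * (1 / real n)) \<longlonglongrightarrow> (s\<^sup>2 / 2) * V * 0"
    by (intro tendsto_mult V tendsto_const lim_const_over_n)
  moreover have "\<forall>\<^sub>F n in sequentially. (s\<^sup>2 / 2) * (n * v n) * (1 / real n) = a n"
    by (intro eventually_sequentiallyI[of 1]) (simp add: a_def)
  ultimately have a: "a \<longlonglongrightarrow> 0" by (simp add: filterlim_cong)
  have na: "(\<lambda>n. n * a n) \<longlonglongrightarrow> s\<^sup>2 / 2 * V"
    using tendsto_mult[OF tendsto_const V, of "s\<^sup>2 / 2"] by (simp add: a_def mult.left_commute)
  have "(\<lambda>n. \<bar>s\<bar> ^ 3 / 6 * b n * (n * v n) + (n * a n) * a n) \<longlonglongrightarrow> \<bar>s\<bar> ^ 3 / 6 * 0 * V + (s\<^sup>2 / 2 * V) * 0"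
    by (intro tendsto_intros b V na a)
  then have "(\<lambda>n. n * (\<bar>s\<bar> ^ 3 * b n * v n / 6 + (a n)\<^sup>2)) \<longlonglongrightarrow> 0"
    by (simp add: algebra_simps power2_eq_square)
  then have d: "(\<lambda>n. char (distr M borel (\<lambda>\<omega>. \<Sum>i<n. Y n i \<omega>)) s - complex_of_real (exp (- (n * a n)))) \<longlonglongrightarrow> 0"
    by (rule Lim_null_comparison[OF always_eventually[OF allI[OF main]]])
  have "(\<lambda>n. complex_of_real (exp (- (n * a n)))) \<longlonglongrightarrow> complex_of_real (exp (- (s\<^sup>2 / 2 * V)))"
    by (intro tendsto_of_real tendsto_exp tendsto_minus na)
  from Lim_transform[OF this d] show ?thesis by simp
qed

lemma (in prob_space) char_distr_diff_le:
  assumes [measurable]: "Z \<in> borel_measurable M" "W \<in> borel_measurable M" "E \<in> events"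
    and R: "integrable M R" "\<And>\<omega>. 0 \<le> R \<omega>" and le: "\<And>\<omega>. \<omega> \<in> E \<Longrightarrow> \<bar>Z \<omega> - W \<omega>\<bar> \<le> R \<omega>"
  shows "cmod (char (distr M borel Z) s - char (distr M borel W) s) \<le> 2 * prob (space M - E) + \<bar>s\<bar> * expectation R"
proof -
  have i: "integrable M (\<lambda>\<omega>. iexp (s * Z \<omega>))" "integrable M (\<lambda>\<omega>. iexp (s * W \<omega>))"
    by (intro integrable_const_bound[where B=1]; simp)+
  have "char (distr M borel Z) s - char (distr M borel W) s = (CLINT \<omega>|M. iexp (s * Z \<omega>) - iexp (s * W \<omega>))"
    using i by (simp add: char_def integral_distr)
  also have "cmod \<dots> \<le> expectation (\<lambda>\<omega>. cmod (iexp (s * Z \<omega>) - iexp (s * W \<omega>)))" by (rule integral_norm_bound)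
  also have "\<dots> \<le> expectation (\<lambda>\<omega>. 2 * indicator (space M - E) \<omega> + \<bar>s\<bar> * R \<omega>)"
  proof (rule integral_mono)
    show "integrable M (\<lambda>\<omega>. cmod (iexp (s * Z \<omega>) - iexp (s * W \<omega>)))" using i by simp
    show "integrable M (\<lambda>\<omega>. 2 * indicator (space M - E) \<omega> + \<bar>s\<bar> * R \<omega>)"
      using R by (intro Bochner_Integration.integrable_add integrable_mult_right integrable_real_indicator) (auto simp: emeasure_eq_measure)
    fix \<omega> assume \<omega>: "\<omega> \<in> space M"
    show "cmod (iexp (s * Z \<omega>) - iexp (s * W \<omega>)) \<le> 2 * indicator (space M - E) \<omega> + \<bar>s\<bar> * R \<omega>"
    proof (cases "\<omega> \<in> E")
      case True
      have "iexp (s * Z \<omega>) - iexp (s * W \<omega>) = iexp (s * W \<omega>) * (iexp (s * (Z \<omega> - W \<omega>)) - 1)"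
        by (simp add: right_diff_distrib exp_diff ring_distribs)
      then have "cmod (iexp (s * Z \<omega>) - iexp (s * W \<omega>)) = cmod (iexp (s * (Z \<omega> - W \<omega>)) - 1)"
        by (simp add: norm_mult)
      also have "\<dots> \<le> \<bar>s * (Z \<omega> - W \<omega>)\<bar>" using iexp_approx1[of "s * (Z \<omega> - W \<omega>)" 0] by simp
      also have "\<dots> \<le> \<bar>s\<bar> * R \<omega>" unfolding abs_mult using le[OF True] by (intro mult_left_mono) auto
      finally show ?thesis using True by simp
    next
      case False
      have "cmod (iexp (s * Z \<omega>) - iexp (s * W \<omega>)) \<le> cmod (iexp (s * Z \<omega>)) + cmod (iexp (s * W \<omega>))" by (rule norm_triangle_ineq4)
      also have "\<dots> = 2" by simp
      finally show ?thesis using False \<omega> mult_nonneg_nonneg[OF abs_ge_zero[of s] R(2)[of \<omega>]] by simp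
    qed
  qed
  also have "\<dots> = 2 * prob (space M - E) + \<bar>s\<bar> * expectation R"
    using R by (subst Bochner_Integration.integral_add) (auto simp: emeasure_eq_measure)
  finally show ?thesis .
qed

lemma char_distr_affine:
  assumes "prob_space M" and [measurable]: "A \<in> borel_measurable M"
  shows "char (distr M borel (\<lambda>\<omega>. m + a * A \<omega>)) s = iexp (s * m) * char (distr M borel A) (a * s)"
proof -
  have "iexp (s * (m + a * x)) = iexp (s * m) * iexp (a * s * x)" for x
    by (simp add: exp_add[symmetric] algebra_simps)
  then show ?thesis by (simp add: char_def integral_distr)
qed

lemma normal_law_eq_distr:
  assumes "0 < v" shows "normal_law \<mu> v = distr std_normal_distribution borel (\<lambda>x. \<mu> + sqrt v * x)"
proof -
  interpret N: prob_space std_normal_distribution using real_dist_normal_dist by (simp add: real_distribution_def)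
  have "distributed std_normal_distribution lborel (\<lambda>x. x) (normal_density 0 1)"
    unfolding distributed_def by (auto simp: distr_id2 intro!: measure_eqI) 
  from N.normal_density_affine[OF this, of "sqrt v" \<mu>] assms
  have "distributed std_normal_distribution lborel (\<lambda>x. \<mu> + sqrt v * x) (normal_density \<mu> (sqrt v))" by simp
  then have "distr std_normal_distribution lborel (\<lambda>x. \<mu> + sqrt v * x) = normal_law \<mu> v"
    unfolding normal_law_def distributed_def by simp
  moreover have "distr std_normal_distribution lborel (\<lambda>x. \<mu> + sqrt v * x) = distr std_normal_distribution borel (\<lambda>x. \<mu> + sqrt v * x)"
    by (rule distr_cong) auto
  ultimately show ?thesis by simp
qed

lemma char_normal_law:
  assumes v: "0 < v" shows "char (normal_law \<mu> v) s = iexp (s * \<mu>) * complex_of_real (exp (- (s\<^sup>2 * v / 2)))"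
proof -
  interpret N: prob_space std_normal_distribution using real_dist_normal_dist by (simp add: real_distribution_def)
  have "char (normal_law \<mu> v) s = iexp (s * \<mu>) * char (distr std_normal_distribution borel (\<lambda>x. x)) (sqrt v * s)"
    unfolding normal_law_eq_distr[OF v] by (rule char_distr_affine) (auto simp: N.prob_space_axioms)
  also have "distr std_normal_distribution borel (\<lambda>x. x) = std_normal_distribution"
    by (rule distr_id2) simp
  finally show ?thesis using v by (simp add: char_std_normal_distribution power_mult_distrib mult.commute)
qed

lemma real_distribution_normal_law:
  assumes "0 < v" shows "real_distribution (normal_law \<mu> v)"
proof -
  interpret N: prob_space std_normal_distribution using real_dist_normal_dist by (simp add: real_distribution_def)
  show ?thesis unfolding normal_law_eq_distr[OF assms] by (rule N.real_distribution_distr) simp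
qed

text \<open>Slutsky's lemma in the form in which it is needed: the perturbation is controlled on events of probability tending to one, by a
multiple of \<open>A n\<close> and a constant. By \<open>char_distr_diff_le\<close> and the bounded second moments the characteristic functions of \<open>Y n\<close> and
\<open>m + a * A n\<close> have the same limit.\<close>

lemma (in prob_space) conv_in_distribution_normal_perturbed:
  fixes Y A :: "nat \<Rightarrow> 'a \<Rightarrow> real"
  assumes rvY: "\<And>n. Y n \<in> borel_measurable M" and rvA: "\<And>n. A n \<in> borel_measurable M"
    and A2: "\<And>n. integrable M (\<lambda>\<omega>. (A n \<omega>)\<^sup>2)" "\<And>n. expectation (\<lambda>\<omega>. (A n \<omega>)\<^sup>2) \<le> C"
    and A: "\<And>s. (\<lambda>n. char (distr M borel (A n)) s) \<longlonglongrightarrow> complex_of_real (exp (- (s\<^sup>2 * V / 2)))"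
    and V: "0 < V" and a: "a \<noteq> 0"
    and E: "\<And>n. E n \<in> events" "(\<lambda>n. prob (E n)) \<longlonglongrightarrow> 1"
    and near: "\<forall>\<^sub>F n in sequentially. 0 \<le> \<alpha> n \<and> 0 \<le> \<beta> n \<and> (\<forall>\<omega>\<in>E n. \<bar>Y n \<omega> - (m + a * A n \<omega>)\<bar> \<le> \<alpha> n * \<bar>A n \<omega>\<bar> + \<beta> n)"
    and \<alpha>: "\<alpha> \<longlonglongrightarrow> 0" and \<beta>: "\<beta> \<longlonglongrightarrow> 0"
  shows "conv_in_distribution M Y (normal_law m (a\<^sup>2 * V))"
  unfolding conv_in_distribution_def
proof (intro conjI allI levy_continuity)
  note [measurable] = rvY rvA E(1)
  have v: "0 < a\<^sup>2 * V" using a V by simp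
  show "real_distribution (normal_law m (a\<^sup>2 * V))" by (rule real_distribution_normal_law[OF v])
  show "real_distribution (distr M borel (Y n))" for n by simp
  fix s
  have "(\<lambda>n. 2 * (1 - prob (E n)) + \<bar>s\<bar> * (\<alpha> n * (1 + C) + \<beta> n)) \<longlonglongrightarrow> 2 * (1 - 1) + \<bar>s\<bar> * (0 * (1 + C) + 0)"
    by (intro tendsto_intros E(2) \<alpha> \<beta>)
  then have l: "(\<lambda>n. 2 * (1 - prob (E n)) + \<bar>s\<bar> * (\<alpha> n * (1 + C) + \<beta> n)) \<longlonglongrightarrow> 0" by simp
  have ev: "\<forall>\<^sub>F n in sequentially. cmod (char (distr M borel (Y n)) s - char (distr M borel (\<lambda>\<omega>. m + a * A n \<omega>)) s)
     \<le> 2 * (1 - prob (E n)) + \<bar>s\<bar> * (\<alpha> n * (1 + C) + \<beta> n)"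
    using near
  proof eventually_elim
    case (elim n)
    have R: "integrable M (\<lambda>\<omega>. \<alpha> n * (1 + (A n \<omega>)\<^sup>2) + \<beta> n)" using A2(1)[of n] by simp
    have "cmod (char (distr M borel (Y n)) s - char (distr M borel (\<lambda>\<omega>. m + a * A n \<omega>)) s)
      \<le> 2 * prob (space M - E n) + \<bar>s\<bar> * expectation (\<lambda>\<omega>. \<alpha> n * (1 + (A n \<omega>)\<^sup>2) + \<beta> n)"
    proof (rule char_distr_diff_le[OF _ _ _ R])
      fix \<omega>
      show "0 \<le> \<alpha> n * (1 + (A n \<omega>)\<^sup>2) + \<beta> n" using elim by (intro add_nonneg_nonneg mult_nonneg_nonneg) auto
      assume "\<omega> \<in> E n"
      then have "\<bar>Y n \<omega> - (m + a * A n \<omega>)\<bar> \<le> \<alpha> n * \<bar>A n \<omega>\<bar> + \<beta> n" using elim by blast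
      also have "\<bar>A n \<omega>\<bar> \<le> 1 + (A n \<omega>)\<^sup>2"
        using sum_power2_ge_zero[of "\<bar>A n \<omega>\<bar> - 1/2" 0] by (simp add: power2_eq_square algebra_simps)
      then have "\<alpha> n * \<bar>A n \<omega>\<bar> + \<beta> n \<le> \<alpha> n * (1 + (A n \<omega>)\<^sup>2) + \<beta> n" using elim by (simp add: mult_left_mono)
      finally show "\<bar>Y n \<omega> - (m + a * A n \<omega>)\<bar> \<le> \<alpha> n * (1 + (A n \<omega>)\<^sup>2) + \<beta> n" .
    qed auto
    also have "expectation (\<lambda>\<omega>. \<alpha> n * (1 + (A n \<omega>)\<^sup>2) + \<beta> n) = \<alpha> n * (1 + expectation (\<lambda>\<omega>. (A n \<omega>)\<^sup>2)) + \<beta> n"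
      using A2(1)[of n] by (simp add: prob_space)
    also have "prob (space M - E n) = 1 - prob (E n)" by (rule prob_compl) simp
    also have "\<bar>s\<bar> * (\<alpha> n * (1 + expectation (\<lambda>\<omega>. (A n \<omega>)\<^sup>2)) + \<beta> n) \<le> \<bar>s\<bar> * (\<alpha> n * (1 + C) + \<beta> n)"
      using A2(2)[of n] elim by (intro mult_left_mono add_right_mono add_left_mono) auto
    finally show ?case by simp
  qed
  have d: "(\<lambda>n. char (distr M borel (Y n)) s - char (distr M borel (\<lambda>\<omega>. m + a * A n \<omega>)) s) \<longlonglongrightarrow> 0"
    by (rule Lim_null_comparison[OF ev l])
  have "(\<lambda>n. iexp (s * m) * char (distr M borel (A n)) (a * s)) \<longlonglongrightarrow> iexp (s * m) * complex_of_real (exp (- ((a * s)\<^sup>2 * V / 2)))"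
    by (intro tendsto_mult tendsto_const A)
  then have "(\<lambda>n. char (distr M borel (\<lambda>\<omega>. m + a * A n \<omega>)) s) \<longlonglongrightarrow> char (normal_law m (a\<^sup>2 * V)) s"
    by (simp add: char_distr_affine prob_space_axioms char_normal_law[OF v] power_mult_distrib mult.assoc mult.left_commute)
  from Lim_transform[OF this d] show "(\<lambda>n. char (distr M borel (Y n)) s) \<longlonglongrightarrow> char (normal_law m (a\<^sup>2 * V)) s" .
qed (rule rvY)


section \<open>The kernel and the bias\<close>

text \<open>Kernels, their derivatives and products with polynomials share these two properties, which give integrability and the
integration by parts formulas without boundary terms.\<close>

definition bump :: "(real \<Rightarrow> real) \<Rightarrow> bool" where
  "bump \<phi> \<longleftrightarrow> continuous_on UNIV \<phi> \<and> (\<forall>u. 1 \<le> \<bar>u\<bar> \<longrightarrow> \<phi> u = 0)"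

lemma bump_measurable: "bump \<phi> \<Longrightarrow> \<phi> \<in> borel_measurable borel"
  by (auto simp: bump_def intro: borel_measurable_continuous_onI)

lemma bump_zero: "bump \<phi> \<Longrightarrow> 1 \<le> \<bar>u\<bar> \<Longrightarrow> \<phi> u = 0"
  by (simp add: bump_def)

lemma bump_outside: "bump \<phi> \<Longrightarrow> u \<notin> {-1..1} \<Longrightarrow> \<phi> u = 0"
  by (erule bump_zero) (auto simp: abs_real_def)

lemma bump_indicator: "bump \<phi> \<Longrightarrow> (\<lambda>u. indicator {-1..1} u * \<phi> u) = \<phi>"
  using bump_outside[of \<phi>] by (auto simp: indicator_def fun_eq_iff)

lemma bump_integrable:
  assumes "bump \<phi>" shows "integrable lborel \<phi>"
proof -
  have "integrable lborel (\<lambda>u. indicator {-1..1} u *\<^sub>R \<phi> u)"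
    by (rule borel_integrable_compact) (use assms in \<open>auto simp: bump_def intro: continuous_on_subset\<close>)
  then show ?thesis by (simp add: bump_indicator[OF assms])
qed

lemma bump_has_integral:
  assumes "bump \<phi>" shows "(\<phi> has_integral (LBINT u. \<phi> u)) {-1..1}"
proof -
  have "(\<phi> has_integral (LBINT u. \<phi> u)) UNIV" by (rule has_integral_integral_lborel[OF bump_integrable[OF assms]])
  moreover have "\<phi> = (\<lambda>u. if u \<in> {-1..1} then \<phi> u else 0)" using bump_outside[OF assms] by (auto simp: fun_eq_iff)
  ultimately show ?thesis using has_integral_restrict_UNIV[of "{-1..1}" \<phi>] by simp
qed

lemma bump_mult: "bump \<phi> \<Longrightarrow> continuous_on UNIV f \<Longrightarrow> bump (\<lambda>u. f u * \<phi> u)"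
  by (auto simp: bump_def intro!: continuous_intros)

lemma bump_bounded:
  assumes "bump \<phi>" obtains B where "0 < B" "\<And>u. \<bar>\<phi> u\<bar> \<le> B"
proof -
  have "compact (\<phi> ` {-1..1})" using assms by (intro compact_continuous_image) (auto simp: bump_def intro: continuous_on_subset)
  then obtain B where B: "0 < B" "\<forall>x\<in>\<phi> ` {-1..1}. norm x \<le> B" using bounded_pos compact_imp_bounded by blast
  show ?thesis
  proof (rule that[OF B(1)])
    fix u show "\<bar>\<phi> u\<bar> \<le> B" using B bump_outside[OF assms, of u] by (cases "u \<in> {-1..1}") auto
  qed
qed

lemma bump_deriv_integral_zero:
  assumes "bump \<phi>" "bump \<phi>'" and d: "\<And>u. (\<phi> has_real_derivative \<phi>' u) (at u)"
  shows "(LBINT u. \<phi>' u) = 0"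
proof -
  have "(\<phi>' has_integral (\<phi> 1 - \<phi> (-1))) {-1..1}"
    using d by (intro fundamental_theorem_of_calculus)
      (auto simp: has_real_derivative_iff_has_vector_derivative intro: has_vector_derivative_at_within)
  moreover have "\<phi> 1 - \<phi> (-1) = 0" using assms(1) by (simp add: bump_def)
  ultimately show ?thesis using has_integral_unique[OF bump_has_integral[OF assms(2)]] by simp
qed

lemma odd_integral_zero:
  fixes \<phi> :: "real \<Rightarrow> real" assumes "\<And>u. \<phi> (- u) = - \<phi> u" shows "(LBINT u. \<phi> u) = 0"
  using lborel_integral_real_affine[of "-1" \<phi> 0] assms by simp

lemma bump_nonneg_integral_zero:
  assumes b: "bump \<phi>" and nn: "\<And>u. 0 \<le> \<phi> u" and z: "(LBINT u. \<phi> u) = 0"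
  shows "\<phi> u = 0"
proof (cases "u \<in> {-1..1}")
  case True
  show ?thesis
  proof (rule has_integral_0_cbox_imp_0[where a="-1" and b=1 and f=\<phi> and x=u])
    show "continuous_on (cbox (-1) 1) \<phi>" using b by (auto simp: bump_def intro: continuous_on_subset)
    show "(\<phi> has_integral 0) (cbox (-1) 1)" using bump_has_integral[OF b] z by simp
    have "(0::real) \<in> box (-1) 1" by simp
    then show "box (-1) (1::real) \<noteq> {}" by blast
  qed (use True nn in auto)
qed (rule bump_outside[OF b])

text \<open>Only values of \<open>R\<close> on the open interval matter, as \<open>\<phi>\<close> vanishes at the end points.\<close>

lemma bump_integral_bound:
  assumes b: "bump \<phi>" and [measurable]: "R \<in> borel_measurable borel" and R: "\<And>w. \<bar>w\<bar> < 1 \<Longrightarrow> \<bar>R w\<bar> \<le> B" and B: "0 \<le> B"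
  shows "integrable lborel (\<lambda>w. \<phi> w * R w)" and "\<bar>LBINT w. \<phi> w * R w\<bar> \<le> B * (LBINT w. \<bar>\<phi> w\<bar>)"
proof -
  note bump_measurable[OF b, measurable]
  have le: "\<bar>\<phi> w * R w\<bar> \<le> B * \<bar>\<phi> w\<bar>" for w
  proof (cases "\<bar>w\<bar> < 1")
    case True
    then show ?thesis using mult_left_mono[OF R[OF True] abs_ge_zero[of "\<phi> w"]] by (simp add: abs_mult mult.commute)
  next
    case False then show ?thesis using b B by (simp add: bump_def)
  qed
  have i: "integrable lborel (\<lambda>w. B * \<bar>\<phi> w\<bar>)" using bump_integrable[OF b] by simp
  show int: "integrable lborel (\<lambda>w. \<phi> w * R w)"
  proof (rule Bochner_Integration.integrable_bound[OF i])
    show "(\<lambda>w. \<phi> w * R w) \<in> borel_measurable lborel" by measurable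
    show "AE w in lborel. norm (\<phi> w * R w) \<le> norm (B * \<bar>\<phi> w\<bar>)"
    proof (rule AE_I2)
      fix w show "norm (\<phi> w * R w) \<le> norm (B * \<bar>\<phi> w\<bar>)" using le[of w] B by (simp add: abs_mult)
    qed
  qed
  have "\<bar>LBINT w. \<phi> w * R w\<bar> \<le> (LBINT w. \<bar>\<phi> w * R w\<bar>)" by (rule integral_abs_bound)
  also have "\<dots> \<le> (LBINT w. B * \<bar>\<phi> w\<bar>)" using int i le by (intro integral_mono) auto
  finally show "\<bar>LBINT w. \<phi> w * R w\<bar> \<le> B * (LBINT w. \<bar>\<phi> w\<bar>)" by simp
qed

lemma bump_concentrates:
  assumes b: "bump \<phi>" and [measurable]: "q \<in> borel_measurable borel" and q: "isCont q t"
  shows "((\<lambda>h. LBINT w. \<phi> w * q (t - h * w)) \<longlongrightarrow> q t * (LBINT w. \<phi> w)) (at_right 0)"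
proof -
  define I where "I = (LBINT w. \<bar>\<phi> w\<bar>)"
  have I: "0 \<le> I" unfolding I_def by (rule integral_nonneg_AE) auto
  show ?thesis
  proof (rule tendstoI)
    fix e :: real assume e: "0 < e"
    define e' where "e' = e / (I + 1)"
    have e': "0 < e'" using e I by (simp add: e'_def)
    from q e' obtain d where d: "0 < d" "\<And>x. \<bar>x - t\<bar> < d \<Longrightarrow> \<bar>q x - q t\<bar> < e'"
      unfolding continuous_at_eps_delta dist_real_def by blast
    show "\<forall>\<^sub>F h in at_right 0. dist (LBINT w. \<phi> w * q (t - h * w)) (q t * (LBINT w. \<phi> w)) < e"
      unfolding eventually_at_right_field
    proof (intro exI[of _ d] conjI d allI impI)
      fix h assume h: "0 < h" "h < d"
      have R: "\<bar>q (t - h * w) - q t\<bar> \<le> e'" if "\<bar>w\<bar> < 1" for w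
      proof -
        have "\<bar>h * w\<bar> < d" using that h mult_strict_mono[of h d "\<bar>w\<bar>" 1] by (simp add: abs_mult)
        then show ?thesis using d(2)[of "t - h * w"] by simp
      qed
      have m: "(\<lambda>w. q (t - h * w) - q t) \<in> borel_measurable borel" by measurable
      note B = bump_integral_bound[OF b m R less_imp_le[OF e']]
      have "(LBINT w. \<phi> w * q (t - h * w)) = (LBINT w. \<phi> w * (q (t - h * w) - q t) + q t * \<phi> w)"
        by (simp add: algebra_simps)
      also have "\<dots> = (LBINT w. \<phi> w * (q (t - h * w) - q t)) + q t * (LBINT w. \<phi> w)"
        using B(1) bump_integrable[OF b] by (subst Bochner_Integration.integral_add) auto
      finally have "dist (LBINT w. \<phi> w * q (t - h * w)) (q t * (LBINT w. \<phi> w)) \<le> e' * I"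
        using B(2) by (simp add: dist_real_def I_def)
      also have "\<dots> < e" using e I by (simp add: e'_def field_simps)
      finally show "dist (LBINT w. \<phi> w * q (t - h * w)) (q t * (LBINT w. \<phi> w)) < e" .
    qed
  qed
qed

text \<open>Lagrange's form of the remainder together with continuity of the third derivative at the single point \<open>t\<close>.\<close>

lemma taylor_cubic:
  fixes F :: "real \<Rightarrow> real"
  assumes d: "\<forall>\<^sub>F x in nhds t. DERIV F x :> f x \<and> DERIV f x :> f1 x \<and> DERIV f1 x :> f2 x"
    and c: "isCont f2 t" and e: "0 < e"
  obtains \<eta> where "0 < \<eta>"
    "\<And>s. \<bar>s\<bar> < \<eta> \<Longrightarrow> \<bar>F (t - s) - (F t - f t * s + f1 t * s\<^sup>2 / 2 - f2 t * s ^ 3 / 6)\<bar> \<le> e * \<bar>s\<bar> ^ 3"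
proof -
  obtain d1 where d1: "0 < d1" "\<And>x. dist x t < d1 \<Longrightarrow> DERIV F x :> f x \<and> DERIV f x :> f1 x \<and> DERIV f1 x :> f2 x"
    using d by (auto simp: eventually_nhds_metric)
  obtain d2 where d2: "0 < d2" "\<And>x. \<bar>x - t\<bar> < d2 \<Longrightarrow> \<bar>f2 x - f2 t\<bar> < e"
    using c e unfolding continuous_at_eps_delta dist_real_def by metis
  show ?thesis
  proof (rule that[of "min d1 d2 / 2"])
    fix s assume s: "\<bar>s\<bar> < min d1 d2 / 2"
    show "\<bar>F (t - s) - (F t - f t * s + f1 t * s\<^sup>2 / 2 - f2 t * s ^ 3 / 6)\<bar> \<le> e * \<bar>s\<bar> ^ 3"
    proof (cases "s = 0")
      case False
      define D where "D m = (if m = 0 then F else if m = 1 then f else if m = 2 then f1 else f2)" for m :: nat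
      have "\<exists>\<xi>. (if t - s < t then t - s < \<xi> \<and> \<xi> < t else t < \<xi> \<and> \<xi> < t - s) \<and>
        F (t - s) = (\<Sum>m<3. (D m t / fact m) * (t - s - t)^m) + (D 3 \<xi> / fact 3) * (t - s - t)^3"
      proof (rule Taylor[where a="t - \<bar>s\<bar>" and b="t + \<bar>s\<bar>"])
        show "\<forall>m x. m < 3 \<and> t - \<bar>s\<bar> \<le> x \<and> x \<le> t + \<bar>s\<bar> \<longrightarrow> DERIV (D m) x :> D (Suc m) x"
        proof (intro allI impI)
          fix m :: nat and x assume m: "m < 3 \<and> t - \<bar>s\<bar> \<le> x \<and> x \<le> t + \<bar>s\<bar>"
          then have "dist x t < d1" using s by (auto simp: dist_real_def)
          moreover have "m = 0 \<or> m = 1 \<or> m = 2" using m by auto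
          ultimately show "DERIV (D m) x :> D (Suc m) x" using d1(2)[of x] by (auto simp: D_def numeral_2_eq_2)
        qed
      qed (use False in \<open>auto simp: D_def\<close>)
      then obtain \<xi> where \<xi>: "(if t - s < t then t - s < \<xi> \<and> \<xi> < t else t < \<xi> \<and> \<xi> < t - s)"
        "F (t - s) = (\<Sum>m<3. (D m t / fact m) * (t - s - t)^m) + (D 3 \<xi> / fact 3) * (t - s - t)^3" by blast
      have "\<bar>\<xi> - t\<bar> < d2" using \<xi>(1) s by (auto split: if_splits)
      then have fx: "\<bar>f2 \<xi> - f2 t\<bar> \<le> e" using d2(2)[of \<xi>] by simp
      have "F (t - s) = F t - f t * s + f1 t * s\<^sup>2 / 2 - f2 \<xi> * s ^ 3 / 6"
        using \<xi>(2) by (simp add: D_def eval_nat_numeral fact_numeral)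
      then have "F (t - s) - (F t - f t * s + f1 t * s\<^sup>2 / 2 - f2 t * s ^ 3 / 6) = - ((f2 \<xi> - f2 t) * s ^ 3 / 6)"
        by (simp add: algebra_simps diff_divide_distrib)
      also have "\<bar>\<dots>\<bar> = \<bar>f2 \<xi> - f2 t\<bar> * \<bar>s\<bar> ^ 3 / 6" by (simp add: abs_mult power_abs)
      also have "\<dots> \<le> e * \<bar>s\<bar> ^ 3 / 1" using fx e by (intro frac_le mult_right_mono) auto
      finally show ?thesis by simp
    qed simp
  qed (use d1 d2 in auto)
qed

lemma bump_taylor:
  assumes b: "bump \<phi>" and [measurable]: "F \<in> borel_measurable borel"
    and d: "\<forall>\<^sub>F x in nhds t. DERIV F x :> f x \<and> DERIV f x :> f1 x \<and> DERIV f1 x :> f2 x"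
    and c: "isCont f2 t"
  shows "((\<lambda>h. ((LBINT w. \<phi> w * F (t - h * w)) - (F t * (LBINT w. \<phi> w) - f t * h * (LBINT w. w * \<phi> w)
    + f1 t * h\<^sup>2 / 2 * (LBINT w. w\<^sup>2 * \<phi> w) - f2 t * h ^ 3 / 6 * (LBINT w. w ^ 3 * \<phi> w))) / h ^ 3) \<longlongrightarrow> 0) (at_right 0)"
    (is "((\<lambda>h. ?g h / h ^ 3) \<longlongrightarrow> 0) _")
proof (rule tendstoI)
  define I where "I = (LBINT w. \<bar>\<phi> w\<bar>)"
  have I: "0 \<le> I" unfolding I_def by (rule integral_nonneg_AE) auto
  fix e :: real assume e: "0 < e"
  define e' where "e' = e / (I + 1)"
  have e': "0 < e'" using e I by (simp add: e'_def)
  obtain \<eta> where \<eta>: "0 < \<eta>"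
    "\<And>s. \<bar>s\<bar> < \<eta> \<Longrightarrow> \<bar>F (t - s) - (F t - f t * s + f1 t * s\<^sup>2 / 2 - f2 t * s ^ 3 / 6)\<bar> \<le> e' * \<bar>s\<bar> ^ 3"
    using taylor_cubic[OF d c e'] by metis
  have i: "integrable lborel (\<lambda>w. w ^ j * \<phi> w)" for j
    by (intro bump_integrable bump_mult b) (auto intro!: continuous_intros)
  show "\<forall>\<^sub>F h in at_right 0. dist (?g h / h ^ 3) 0 < e"
    unfolding eventually_at_right_field
  proof (intro exI[of _ \<eta>] conjI \<eta>(1) allI impI)
    fix h assume h: "0 < h" "h < \<eta>"
    define R where "R w = F (t - h * w) - (F t - f t * (h * w) + f1 t * (h * w)\<^sup>2 / 2 - f2 t * (h * w) ^ 3 / 6)" for w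
    have [measurable]: "R \<in> borel_measurable borel" unfolding R_def by measurable
    have R: "\<bar>R w\<bar> \<le> e' * h ^ 3" if "\<bar>w\<bar> < 1" for w
    proof -
      have hw: "\<bar>h * w\<bar> \<le> h" using that h by (simp add: abs_mult mult_left_le)
      then have "\<bar>R w\<bar> \<le> e' * \<bar>h * w\<bar> ^ 3" unfolding R_def using h by (intro \<eta>(2)) auto
      also have "\<dots> \<le> e' * h ^ 3" using hw e' by (intro mult_left_mono power_mono) auto
      finally show ?thesis .
    qed
    have B0: "0 \<le> e' * h ^ 3" using e' h by simp
    note B = bump_integral_bound[OF b \<open>R \<in> borel_measurable borel\<close> R B0]
    have "(LBINT w. \<phi> w * F (t - h * w)) = (LBINT w. \<phi> w * R w + (F t * (w ^ 0 * \<phi> w) - f t * h * (w ^ 1 * \<phi> w)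
       + f1 t * h\<^sup>2 / 2 * (w ^ 2 * \<phi> w) - f2 t * h ^ 3 / 6 * (w ^ 3 * \<phi> w)))"
      by (rule Bochner_Integration.integral_cong) (auto simp: R_def algebra_simps power_mult_distrib)
    also have "\<dots> = (LBINT w. \<phi> w * R w) + (F t * (LBINT w. w ^ 0 * \<phi> w) - f t * h * (LBINT w. w ^ 1 * \<phi> w)
       + f1 t * h\<^sup>2 / 2 * (LBINT w. w ^ 2 * \<phi> w) - f2 t * h ^ 3 / 6 * (LBINT w. w ^ 3 * \<phi> w))"
      using B(1) i by (simp only: Bochner_Integration.integral_add Bochner_Integration.integral_diff integral_mult_right_zero
        Bochner_Integration.integrable_add Bochner_Integration.integrable_diff integrable_mult_right)
    finally have "?g h = (LBINT w. \<phi> w * R w)" by simp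
    then have "\<bar>?g h\<bar> \<le> e' * h ^ 3 * I" using B(2) by (simp add: I_def)
    then have "\<bar>?g h / h ^ 3\<bar> \<le> e' * I" using h by (simp add: abs_divide field_simps)
    also have "\<dots> < e" using e I by (simp add: e'_def field_simps)
    finally show "dist (?g h / h ^ 3) 0 < e" by (simp add: dist_real_def)
  qed
qed

locale kernel =
  fixes k :: "real \<Rightarrow> real"
  assumes k: "smoothing_kernel k"
begin

abbreviation k' :: "real \<Rightarrow> real" where "k' \<equiv> deriv k"

lemma DERIV_k: "DERIV k u :> k' u" and DERIV_k': "DERIV k' u :> deriv k' u"
  using k by (auto simp: smoothing_kernel_def DERIV_deriv_iff_real_differentiable)

lemma continuous_k: "continuous_on UNIV k"
  by (rule DERIV_continuous_on) (rule has_field_derivative_at_within[OF DERIV_k])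

lemma continuous_k': "continuous_on UNIV k'"
  by (rule DERIV_continuous_on) (rule has_field_derivative_at_within[OF DERIV_k'])

text \<open>At \<open>u = 1\<close> and \<open>u = -1\<close> the function vanishes because the open set where it differs from zero is contained in the
interior of \<open>[-1, 1]\<close>.\<close>

lemma bumpI:
  fixes \<phi> :: "real \<Rightarrow> real"
  assumes "continuous_on UNIV \<phi>" "\<And>u. 1 < \<bar>u\<bar> \<Longrightarrow> \<phi> u = 0" shows "bump \<phi>"
proof -
  have "open {u. \<phi> u \<noteq> 0}" using assms(1) open_Collect_neq[OF assms(1) continuous_on_const] by auto
  moreover have "{u. \<phi> u \<noteq> 0} \<subseteq> {-1..1}"
  proof (rule subsetI, rule ccontr)
    fix x assume "x \<in> {u. \<phi> u \<noteq> 0}" "x \<notin> {-1..1}"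
    then show False using assms(2)[of x] by auto
  qed
  ultimately have s: "{u. \<phi> u \<noteq> 0} \<subseteq> interior {-1..1}" by (intro interior_maximal)
  have "\<phi> u = 0" if "1 \<le> \<bar>u\<bar>" for u
  proof (rule ccontr)
    assume "\<phi> u \<noteq> 0"
    then have "u \<in> interior {-1..1}" using s by blast
    then show False using that by (auto simp: interior_atLeastAtMost_real)
  qed
  then show ?thesis using assms(1) by (simp add: bump_def)
qed

lemma k_outside: "1 < \<bar>u\<bar> \<Longrightarrow> k u = 0"
proof (rule ccontr)
  assume u: "1 < \<bar>u\<bar>" "k u \<noteq> 0"
  then have "u \<in> closure {u. k u \<noteq> 0}" by (intro closure_subset[THEN subsetD]) auto
  then show False using k u by (auto simp: smoothing_kernel_def)
qed

lemma bump_k: "bump k"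
  by (rule bumpI[OF continuous_k k_outside])

lemma deriv_outside:
  assumes "\<And>u. 1 < \<bar>u\<bar> \<Longrightarrow> \<phi> u = 0" "DERIV \<phi> u :> D" "1 < \<bar>u\<bar>" shows "D = (0::real)"
proof -
  have "\<forall>\<^sub>F x in nhds u. \<phi> x = 0"
    unfolding eventually_nhds
    by (rule exI[of _ "{x. 1 < \<bar>x\<bar>}"]) (use assms in \<open>auto intro!: open_Collect_less continuous_intros\<close>)
  then have "DERIV \<phi> u :> D \<longleftrightarrow> DERIV (\<lambda>_. 0) u :> D" by (intro DERIV_cong_ev) auto
  then show ?thesis using assms(2) DERIV_unique[OF _ DERIV_const] by blast
qed

lemma bump_k': "bump k'"
  by (rule bumpI[OF continuous_k']) (rule deriv_outside[OF k_outside DERIV_k])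

lemma bump_k'': "bump (deriv k')"
proof (rule bumpI)
  show "continuous_on UNIV (deriv k')" using k by (simp add: smoothing_kernel_def)
  fix u :: real assume "1 < \<bar>u\<bar>"
  then show "deriv k' u = 0" using bump_k' by (intro deriv_outside[OF _ DERIV_k']) (auto simp: bump_def)
qed

lemma k'_lipschitz: obtains C where "0 < C" "\<And>x y. \<bar>k' x - k' y\<bar> \<le> C * \<bar>x - y\<bar>"
proof -
  obtain C where C: "0 < C" "\<And>u. \<bar>deriv k' u\<bar> \<le> C" using bump_bounded[OF bump_k''] by metis
  show ?thesis
  proof (rule that[OF C(1)])
    fix x y
    have "norm (k' x - k' y) \<le> C * norm (x - y)"
      by (rule field_differentiable_bound[where S=UNIV and f'="deriv k'"]) (use C DERIV_k' in auto)
    then show "\<bar>k' x - k' y\<bar> \<le> C * \<bar>x - y\<bar>" by simp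
  qed
qed

lemma k_nonneg: "0 \<le> k u" and k_even: "k (- u) = k u"
  using k by (auto simp: smoothing_kernel_def)

lemma integral_k: "(LBINT u. k u) = 1"
proof -
  have "(k has_integral 1) UNIV" using k by (simp add: smoothing_kernel_def)
  then show ?thesis using has_integral_integral_lborel[OF bump_integrable[OF bump_k]] has_integral_unique by blast
qed

lemma integral_k_odd: "(LBINT u. u * k u) = 0" "(LBINT u. u ^ 3 * k u) = 0"
  by (rule odd_integral_zero; simp add: k_even)+

lemma integral_power_k':
  "(LBINT u. u ^ Suc j * k' u) = - (real (Suc j) * (LBINT u. u ^ j * k u))" and integral_k': "(LBINT u. k' u) = 0"
proof -
  have b: "bump (\<lambda>u. u ^ i * k u)" "bump (\<lambda>u. u ^ i * k' u)" for i
    by (rule bump_mult[OF bump_k] bump_mult[OF bump_k']; auto intro!: continuous_intros)+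
  have "(LBINT u. real (Suc j) * (u ^ j * k u) + u ^ Suc j * k' u) = 0"
  proof (rule bump_deriv_integral_zero)
    show "bump (\<lambda>u. u ^ Suc j * k u)" by (rule b)
    show "bump (\<lambda>u. real (Suc j) * (u ^ j * k u) + u ^ Suc j * k' u)"
      using b(1)[of j] b(2)[of "Suc j"] by (auto simp: bump_def intro!: continuous_intros)
    show "((\<lambda>u. u ^ Suc j * k u) has_real_derivative real (Suc j) * (u ^ j * k u) + u ^ Suc j * k' u) (at u)" for u
      using DERIV_mult[OF DERIV_pow[of "Suc j" u] DERIV_k[of u]]
      by (simp add: ac_simps del: power_Suc of_nat_Suc)
  qed
  moreover have "(LBINT u. real (Suc j) * (u ^ j * k u) + u ^ Suc j * k' u) = real (Suc j) * (LBINT u. u ^ j * k u) + (LBINT u. u ^ Suc j * k' u)"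
    using bump_integrable[OF b(1)[of j]] bump_integrable[OF b(2)[of "Suc j"]] by (subst Bochner_Integration.integral_add) auto
  ultimately show "(LBINT u. u ^ Suc j * k' u) = - (real (Suc j) * (LBINT u. u ^ j * k u))" by linarith
  show "(LBINT u. k' u) = 0" by (rule bump_deriv_integral_zero[OF bump_k bump_k' DERIV_k])
qed

lemma support_k_nontrivial: "\<not> (\<forall>u. u \<noteq> 0 \<longrightarrow> k u = 0)"
proof
  assume "\<forall>u. u \<noteq> 0 \<longrightarrow> k u = 0"
  then have "closure {u. k u \<noteq> 0} \<subseteq> {0}" by (intro closure_minimal) auto
  moreover have "closure {u. k u \<noteq> 0} = {-1..1}" using k by (simp add: smoothing_kernel_def)
  ultimately have "(1::real) \<in> {0}" by auto
  then show False by simp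
qed

lemma second_moment_pos: "0 < second_moment k"
proof -
  have b: "bump (\<lambda>u. u\<^sup>2 * k u)" by (rule bump_mult[OF bump_k]) (auto intro!: continuous_intros)
  have "0 \<le> second_moment k" unfolding second_moment_def using k_nonneg by (intro integral_nonneg_AE) auto
  moreover have "second_moment k \<noteq> 0"
  proof
    assume "second_moment k = 0"
    then have "u\<^sup>2 * k u = 0" for u
      using bump_nonneg_integral_zero[OF b, of u] k_nonneg by (simp add: second_moment_def)
    then show False using support_k_nontrivial by auto
  qed
  ultimately show ?thesis by linarith
qed

lemma roughness_pos: "0 < (LBINT u. (k' u)\<^sup>2)"
proof -
  have b: "bump (\<lambda>u. (k' u)\<^sup>2)" using bump_k' by (auto simp: bump_def intro!: continuous_intros)
  have "0 \<le> (LBINT u. (k' u)\<^sup>2)" by (intro integral_nonneg_AE) auto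
  moreover have "(LBINT u. (k' u)\<^sup>2) \<noteq> 0"
  proof
    assume "(LBINT u. (k' u)\<^sup>2) = 0"
    then have "k' u = 0" for u using bump_nonneg_integral_zero[OF b, of u] by simp
    then have "DERIV k u :> 0" for u using DERIV_k[of u] by simp
    then have "k u = k 2" for u by (intro DERIV_isconst_all allI)
    then show False using support_k_nontrivial k_outside[of 2] by simp
  qed
  ultimately show ?thesis by linarith
qed

text \<open>Inserting the Taylor expansion, only one term beyond the leading one survives: the odd moments of \<open>k\<close> vanish, and
  integration by parts expresses the moments of \<open>k'\<close> by those of \<open>k\<close>.\<close>

lemma bias_F:
  assumes m: "F \<in> borel_measurable borel"
    and d: "\<forall>\<^sub>F x in nhds t. DERIV F x :> f x \<and> DERIV f x :> f1 x \<and> DERIV f1 x :> f2 x"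
    and c: "isCont f2 t"
  shows "((\<lambda>h. ((LBINT w. k w * F (t - h * w)) - F t) / h\<^sup>2) \<longlongrightarrow> f1 t * second_moment k / 2) (at_right 0)"
proof -
  let ?g = "\<lambda>h. ((LBINT w. k w * F (t - h * w)) - (F t + f1 t * h\<^sup>2 / 2 * second_moment k)) / h ^ 3"
  have "(?g \<longlongrightarrow> 0) (at_right 0)"
    using bump_taylor[OF bump_k m d c] by (simp add: integral_k integral_k_odd second_moment_def)
  then have "((\<lambda>h. ?g h * h + f1 t * second_moment k / 2) \<longlongrightarrow> 0 * 0 + f1 t * second_moment k / 2) (at_right 0)"
    by (intro tendsto_intros)
  moreover have "\<forall>\<^sub>F h in at_right 0. ?g h * h + f1 t * second_moment k / 2 = ((LBINT w. k w * F (t - h * w)) - F t) / h\<^sup>2"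
    unfolding eventually_at_filter by (rule always_eventually) (auto simp: field_simps power2_eq_square power3_eq_cube)
  ultimately show ?thesis by (simp add: filterlim_cong)
qed

lemma bias_f:
  assumes m: "F \<in> borel_measurable borel"
    and d: "\<forall>\<^sub>F x in nhds t. DERIV F x :> f x \<and> DERIV f x :> f1 x \<and> DERIV f1 x :> f2 x"
    and c: "isCont f2 t"
  shows "((\<lambda>h. ((LBINT w. k' w * F (t - h * w)) / h - f t) / h\<^sup>2) \<longlongrightarrow> f2 t * second_moment k / 2) (at_right 0)"
proof -
  let ?g = "\<lambda>h. ((LBINT w. k' w * F (t - h * w)) - (f t * h + f2 t * h ^ 3 / 2 * second_moment k)) / h ^ 3"
  have i: "(LBINT w. w * k' w) = -1" "(LBINT w. w\<^sup>2 * k' w) = 0" "(LBINT w. w ^ 3 * k' w) = - 3 * second_moment k"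
    using integral_power_k'[of 0] integral_power_k'[of 1] integral_power_k'[of 2] integral_k integral_k_odd
    by (simp_all add: second_moment_def power2_eq_square power3_eq_cube)
  have "(?g \<longlongrightarrow> 0) (at_right 0)"
    using bump_taylor[OF bump_k' m d c, unfolded integral_k' i] by (simp add: ac_simps)
  then have "((\<lambda>h. ?g h + f2 t * second_moment k / 2) \<longlongrightarrow> 0 + f2 t * second_moment k / 2) (at_right 0)"
    by (intro tendsto_intros)
  moreover have "\<forall>\<^sub>F h in at_right 0. ?g h + f2 t * second_moment k / 2 = ((LBINT w. k' w * F (t - h * w)) / h - f t) / h\<^sup>2"
    unfolding eventually_at_filter by (rule always_eventually) (auto simp: field_simps power2_eq_square power3_eq_cube)
  ultimately show ?thesis by (simp add: filterlim_cong)
qed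

end


section \<open>The smoothed estimators as integrals of the maximum likelihood estimator\<close>

text \<open>Fubini's theorem for the pairs \<open>u \<le> v\<close>. The estimator may have total mass less than one, so \<open>F\<close> is allowed to have any limit at
infinity.\<close>

lemma interval_measure_integral_by_parts:
  fixes F \<kappa> :: "real \<Rightarrow> real"
  assumes mono: "\<And>x y. x \<le> y \<Longrightarrow> F x \<le> F y" and rc: "\<And>a. continuous (at_right a) F"
    and bot: "(F \<longlongrightarrow> 0) at_bot" and top: "(F \<longlongrightarrow> m) at_top" and m: "0 \<le> m"
    and \<kappa>: "integrable lborel \<kappa>"
  shows "(LINT u|interval_measure F. (LBINT v. indicator {u..} v * \<kappa> v)) = (LBINT v. F v * \<kappa> v)"
proof -
  interpret I: finite_borel_measure "interval_measure F"
    by (rule finite_borel_measure_interval_measure[OF mono rc bot top m])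
  have [measurable]: "\<kappa> \<in> borel_measurable borel" using borel_measurable_integrable[OF \<kappa>] by simp
  interpret P: pair_sigma_finite "interval_measure F" lborel ..
  have ind: "indicator {u..} v = (if u \<le> v then 1 else 0 :: real)" for u v :: real by simp
  have meas: "(\<lambda>(u, v). indicator {u..} v * \<kappa> v) \<in> borel_measurable (interval_measure F \<Otimes>\<^sub>M lborel)"
    unfolding ind by measurable
  have i\<kappa>: "integrable lborel (\<lambda>v. indicator {u..} v * \<kappa> v)" for u
    by (rule Bochner_Integration.integrable_bound[OF \<kappa>]) (auto simp: indicator_def)
  have int: "integrable (interval_measure F \<Otimes>\<^sub>M lborel) (\<lambda>(u, v). indicator {u..} v * \<kappa> v)"
  proof (rule P.Fubini_integrable[OF meas])
    show "AE u in interval_measure F. integrable lborel (\<lambda>v. case (u, v) of (u, v) \<Rightarrow> indicator {u..} v * \<kappa> v)"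
      using i\<kappa> by simp
    show "integrable (interval_measure F) (\<lambda>u. LBINT v. norm (case (u, v) of (u, v) \<Rightarrow> indicator {u..} v * \<kappa> v))"
    proof (rule I.integrable_const_bound[where B="LBINT v. \<bar>\<kappa> v\<bar>"])
      have "(LBINT v. \<bar>indicator {u..} v * \<kappa> v\<bar>) \<le> (LBINT v. \<bar>\<kappa> v\<bar>)" for u
        using i\<kappa>[of u] \<kappa> by (intro integral_mono) (auto simp: indicator_def)
      moreover have "0 \<le> (LBINT v. \<bar>indicator {u..} v * \<kappa> v\<bar>)" for u by (intro integral_nonneg_AE) auto
      ultimately show "AE u in interval_measure F. norm (LBINT v. norm (case (u, v) of (u, v) \<Rightarrow> indicator {u..} v * \<kappa> v)) \<le> (LBINT v. \<bar>\<kappa> v\<bar>)"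
        by simp
      show "(\<lambda>u. LBINT v. norm (case (u, v) of (u, v) \<Rightarrow> indicator {u..} v * \<kappa> v)) \<in> borel_measurable (interval_measure F)"
        using meas by measurable
    qed
  qed
  have "(LINT u|interval_measure F. (LBINT v. indicator {u..} v * \<kappa> v)) = (LBINT v. (LINT u|interval_measure F. indicator {u..} v * \<kappa> v))"
    by (rule P.Fubini_integral[OF int, symmetric])
  also have "\<dots> = (LBINT v. F v * \<kappa> v)"
  proof (rule Bochner_Integration.integral_cong)
    fix v :: real
    have "indicator {u..} v = indicat_real {..v} u" for u by (auto simp: indicator_def)
    then have "(LINT u|interval_measure F. indicator {u..} v * \<kappa> v) = measure (interval_measure F) {..v} * \<kappa> v"
      by simp
    then show "(LINT u|interval_measure F. indicator {u..} v * \<kappa> v) = F v * \<kappa> v"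
      by (simp add: measure_interval_measure_Iic[OF mono rc bot])
  qed simp
  finally show ?thesis .
qed

lemma eventually_num_le_cong:
  assumes "\<And>i. i < n \<Longrightarrow> \<forall>\<^sub>F y in Q. \<tau> i \<le> y \<longleftrightarrow> P i" 
  shows "\<forall>\<^sub>F y in Q. num_le n \<tau> y = card {i. i < n \<and> P i}"
proof -
  have "\<forall>\<^sub>F y in Q. \<forall>i\<in>{..<n}. \<tau> i \<le> y \<longleftrightarrow> P i" using assms by (intro eventually_ball_finite) auto
  then show ?thesis
  proof eventually_elim
    case (elim y)
    then have "{i. i < n \<and> \<tau> i \<le> y} = {i. i < n \<and> P i}" by auto
    then show ?case by (simp add: num_le_def)
  qed
qed

lemma mle_right_continuous: "continuous (at_right a) (mle n \<tau> \<delta>)"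
proof -
  have "\<forall>\<^sub>F y in at_right a. \<tau> i \<le> y \<longleftrightarrow> \<tau> i \<le> a" for i
  proof (cases "\<tau> i \<le> a")
    case True
    show ?thesis using eventually_at_right_less[of a] by eventually_elim (use True in auto)
  next
    case False
    then have "\<forall>\<^sub>F y in at_right a. y < \<tau> i" by (intro order_tendstoD(2)[OF tendsto_ident_at]) auto
    then show ?thesis by eventually_elim (use False in auto)
  qed
  then have "\<forall>\<^sub>F y in at_right a. num_le n \<tau> y = num_le n \<tau> a"
    unfolding num_le_def[of n \<tau> a] by (rule eventually_num_le_cong)
  then have "\<forall>\<^sub>F y in at_right a. mle n \<tau> \<delta> y = mle n \<tau> \<delta> a"
    by eventually_elim (simp add: mle_eq_num_le)
  then show ?thesis unfolding continuous_within by (rule tendsto_eventually)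
qed

lemma mle_at_bot: "(mle n \<tau> \<delta> \<longlongrightarrow> 0) at_bot"
proof -
  have "\<forall>\<^sub>F y in at_bot. num_le n \<tau> y = card {i. i < n \<and> False}"
  proof (rule eventually_num_le_cong)
    show "\<forall>\<^sub>F y in at_bot. \<tau> i \<le> y \<longleftrightarrow> False" for i
      using eventually_gt_at_bot[of "\<tau> i"] by eventually_elim auto
  qed
  then have "\<forall>\<^sub>F y in at_bot. mle n \<tau> \<delta> y = 0" by eventually_elim (simp add: mle_eq_num_le)
  then show ?thesis by (rule tendsto_eventually)
qed

lemma mle_at_top: "\<exists>m. (mle n \<tau> \<delta> \<longlongrightarrow> m) at_top"
proof -
  have "\<forall>\<^sub>F y in at_top. num_le n \<tau> y = card {i. i < n \<and> True}"
    by (rule eventually_num_le_cong) (simp add: eventually_ge_at_top)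
  then have "\<forall>\<^sub>F y in at_top. mle n \<tau> \<delta> y = (if n = 0 then 0 else mle_at n \<tau> \<delta> n)"
    by eventually_elim (simp add: mle_eq_num_le)
  then have "(mle n \<tau> \<delta> \<longlongrightarrow> (if n = 0 then 0 else mle_at n \<tau> \<delta> n)) at_top" by (rule tendsto_eventually)
  then show ?thesis by blast
qed

lemma (in kernel) k_eq_integral: "k x = (LBINT y. indicator {..x} y * k' y)"
proof -
  define a where "a = min (-1) x"
  have "(LBINT y. k' y * indicator {a..x} y) = k x - k a"
  proof (rule integral_FTC_Icc_real)
    show "isCont k' y" for y using DERIV_isCont[OF DERIV_k'] .
  qed (auto simp: a_def DERIV_k)
  moreover have "k a = 0" using bump_zero[OF bump_k, of a] by (simp add: a_def)
  moreover have "k' y * indicator {a..x} y = indicator {..x} y * k' y" for y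
    using bump_zero[OF bump_k', of y] by (auto simp: a_def indicator_def)
  ultimately show ?thesis by simp
qed

context kernel
begin

context
  fixes n :: nat and \<tau> \<delta> :: "nat \<Rightarrow> real" and h t :: real
  assumes \<delta>: "\<And>i. i < n \<Longrightarrow> 0 \<le> \<delta> i \<and> \<delta> i \<le> 1" and h: "0 < h"
begin

text \<open>Both smoothed estimators are instances: the integrand is the primitive of a bump, namely \<open>int_kernel k\<close> or \<open>k\<close> itself.\<close>

lemma smoothed_mle:
  assumes b: "bump \<phi>"
  shows "(LINT u|interval_measure (mle n \<tau> \<delta>). (LBINT y. indicator {..(t - u) / h} y * \<phi> y)) = (LBINT w. \<phi> w * mle n \<tau> \<delta> (t - h * w))"
proof -
  obtain m where m: "(mle n \<tau> \<delta> \<longlongrightarrow> m) at_top" using mle_at_top by blast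
  have m0: "0 \<le> m" by (rule tendsto_lowerbound[OF m]) (auto simp: mle_bounds(1)[OF \<delta>])
  define \<kappa> where "\<kappa> v = \<phi> (t / h + (- 1 / h) * v) / h" for v
  have i\<kappa>: "integrable lborel \<kappa>"
    unfolding \<kappa>_def using h bump_integrable[OF b] by (intro integrable_divide_zero lborel_integrable_real_affine) auto
  have "(LBINT y. indicator {..(t - u) / h} y * \<phi> y) = (LBINT v. indicator {u..} v * \<kappa> v)" for u
  proof -
    have "(LBINT y. indicator {..(t - u) / h} y * \<phi> y) = \<bar>- 1 / h\<bar> *\<^sub>R (LBINT v. indicator {..(t - u) / h} (t / h + (- 1 / h) * v) * \<phi> (t / h + (- 1 / h) * v))"
      by (rule lborel_integral_real_affine) (use h in auto)
    also have "\<dots> = (LBINT v. \<bar>- 1 / h\<bar> * (indicator {..(t - u) / h} (t / h + (- 1 / h) * v) * \<phi> (t / h + (- 1 / h) * v)))"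
      by simp
    also have "\<dots> = (LBINT v. indicator {u..} v * \<kappa> v)"
      by (rule Bochner_Integration.integral_cong) (use h in \<open>auto simp: \<kappa>_def indicator_def field_simps\<close>)
    finally show ?thesis .
  qed
  then have "(LINT u|interval_measure (mle n \<tau> \<delta>). (LBINT y. indicator {..(t - u) / h} y * \<phi> y)) = (LBINT v. mle n \<tau> \<delta> v * \<kappa> v)"
    using interval_measure_integral_by_parts[OF mle_mono[of n \<delta> _ _ \<tau>, OF \<delta>] mle_right_continuous mle_at_bot m m0 i\<kappa>] by simp
  also have "\<dots> = \<bar>- h\<bar> *\<^sub>R (LBINT w. mle n \<tau> \<delta> (t + (- h) * w) * \<kappa> (t + (- h) * w))"
    by (rule lborel_integral_real_affine) (use h in auto)
  also have "\<dots> = (LBINT w. \<bar>- h\<bar> * (mle n \<tau> \<delta> (t + (- h) * w) * \<kappa> (t + (- h) * w)))" by simp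
  also have "\<dots> = (LBINT w. \<phi> w * mle n \<tau> \<delta> (t - h * w))"
  proof (rule Bochner_Integration.integral_cong[OF refl])
    fix w have "t / h + (- 1 / h) * (t + (- h) * w) = w" using h by (simp add: field_simps)
    then show "\<bar>- h\<bar> * (mle n \<tau> \<delta> (t + (- h) * w) * \<kappa> (t + (- h) * w)) = \<phi> w * mle n \<tau> \<delta> (t - h * w)"
      using h by (simp add: \<kappa>_def)
  qed
  finally show ?thesis .
qed

lemma smle_F_eq: "smle_F k h n \<tau> \<delta> t = (LBINT w. k w * mle n \<tau> \<delta> (t - h * w))"
  unfolding smle_F_def int_kernel_def set_lebesgue_integral_def real_scaleR_def
  by (rule smoothed_mle[OF bump_k])

lemma smle_f_eq: "smle_f k h n \<tau> \<delta> t = (LBINT w. k' w * mle n \<tau> \<delta> (t - h * w)) / h"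
proof -
  have "smle_f k h n \<tau> \<delta> t = (LINT u|interval_measure (mle n \<tau> \<delta>). (LBINT y. indicator {..(t - u) / h} y * k' y) / h)"
    unfolding smle_f_def by (subst k_eq_integral) simp
  also have "\<dots> = (LINT u|interval_measure (mle n \<tau> \<delta>). (LBINT y. indicator {..(t - u) / h} y * k' y)) / h"
    by (rule integral_divide_zero)
  finally show ?thesis using smoothed_mle[OF bump_k'] by simp
qed

end

end

section \<open>Measurability\<close>

text \<open>The sorted list of indices takes countably many values, so it suffices to treat the comparisons one by one.\<close>

lemma insort_key_measurable:
  fixes \<tau> :: "nat \<Rightarrow> 'a \<Rightarrow> real"
  assumes [measurable]: "\<And>i. \<tau> i \<in> borel_measurable M"
  shows "(\<lambda>\<omega>. insort_key (\<lambda>i. \<tau> i \<omega>) x ys) \<in> measurable M (count_space UNIV)"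
proof (induction ys)
  case (Cons y ys)
  have "(\<lambda>\<omega>. y # insort_key (\<lambda>i. \<tau> i \<omega>) x ys) \<in> measurable M (count_space UNIV)"
    by (rule measurable_compose[OF Cons]) simp
  then show ?case by simp
qed simp

lemma obs_order_measurable:
  fixes \<tau> :: "nat \<Rightarrow> 'a \<Rightarrow> real"
  assumes m: "\<And>i. \<tau> i \<in> borel_measurable M"
  shows "(\<lambda>\<omega>. obs_order n (\<lambda>i. \<tau> i \<omega>)) \<in> measurable M (count_space UNIV)"
proof -
  have "(\<lambda>\<omega>. sort_key (\<lambda>i. \<tau> i \<omega>) xs) \<in> measurable M (count_space UNIV)" for xs
  proof (induction xs)
    case (Cons x xs)
    show ?case unfolding sort_key_simps
      by (rule measurable_compose_countable[OF insort_key_measurable[OF m] Cons])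
  qed simp
  then show ?thesis unfolding obs_order_def .
qed

lemma cusum_measurable:
  fixes \<tau> \<delta> :: "nat \<Rightarrow> 'a \<Rightarrow> real"
  assumes m: "\<And>i. \<tau> i \<in> borel_measurable M" and m': "\<And>i. \<delta> i \<in> borel_measurable M"
  shows "(\<lambda>\<omega>. cusum n (\<lambda>i. \<tau> i \<omega>) (\<lambda>i. \<delta> i \<omega>) j) \<in> borel_measurable M"
proof -
  have [measurable]: "(\<lambda>\<omega>. \<delta> (obs_order n (\<lambda>i. \<tau> i \<omega>) ! l) \<omega>) \<in> borel_measurable M" for l
    by (rule measurable_compose_countable[where f="\<lambda>L \<omega>. \<delta> (L ! l) \<omega>", OF m' obs_order_measurable[OF m]])
  show ?thesis unfolding cusum_eq by measurable
qed

lemma mle_at_measurable: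
  fixes \<tau> \<delta> :: "nat \<Rightarrow> 'a \<Rightarrow> real"
  assumes m: "\<And>i. \<tau> i \<in> borel_measurable M" and m': "\<And>i. \<delta> i \<in> borel_measurable M" and i: "0 < i" "i \<le> n"
  shows "(\<lambda>\<omega>. mle_at n (\<lambda>i. \<tau> i \<omega>) (\<lambda>i. \<delta> i \<omega>) i) \<in> borel_measurable M"
proof -
  note cusum_measurable[OF m m', measurable]
  show ?thesis unfolding mle_at_eq_step[OF i] gcm_step_max_min[OF i]
    by (intro borel_measurable_times borel_measurable_const borel_measurable_Max borel_measurable_Min) auto
qed

lemma mle_measurable:
  fixes \<tau> \<delta> :: "nat \<Rightarrow> 'a \<Rightarrow> real"
  assumes m[measurable]: "\<And>i. \<tau> i \<in> borel_measurable M" and m': "\<And>i. \<delta> i \<in> borel_measurable M"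
  shows "(\<lambda>(\<omega>, x). mle n (\<lambda>i. \<tau> i \<omega>) (\<lambda>i. \<delta> i \<omega>) x) \<in> borel_measurable (M \<Otimes>\<^sub>M borel)"
proof -
  define f where "f N \<omega> = (if 0 < N \<and> N \<le> n then mle_at n (\<lambda>i. \<tau> i \<omega>) (\<lambda>i. \<delta> i \<omega>) N else 0)" for N \<omega>
  have f: "f N \<in> borel_measurable M" for N
    using mle_at_measurable[OF m m', of N n] by (cases "0 < N \<and> N \<le> n") (auto simp: f_def[abs_def])
  have "(\<lambda>z. num_le n (\<lambda>i. \<tau> i (fst z)) (snd z)) = (\<lambda>z. \<Sum>i<n. if \<tau> i (fst z) \<le> snd z then 1 else 0)"
  proof
    fix z :: "'a \<times> real"
    have "{..<n} \<inter> {i. \<tau> i (fst z) \<le> snd z} = {i. i < n \<and> \<tau> i (fst z) \<le> snd z}" by auto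
    then show "num_le n (\<lambda>i. \<tau> i (fst z)) (snd z) = (\<Sum>i<n. if \<tau> i (fst z) \<le> snd z then 1 else 0)"
      by (simp add: num_le_def sum.If_cases)
  qed
  moreover have "(\<lambda>z. \<Sum>i<n. if \<tau> i (fst z) \<le> snd z then 1 else (0::nat)) \<in> measurable (M \<Otimes>\<^sub>M borel) (count_space UNIV)"
    by measurable
  ultimately have N: "(\<lambda>z. num_le n (\<lambda>i. \<tau> i (fst z)) (snd z)) \<in> measurable (M \<Otimes>\<^sub>M borel) (count_space UNIV)" by simp
  have "(\<lambda>z. f (num_le n (\<lambda>i. \<tau> i (fst z)) (snd z)) (fst z)) \<in> borel_measurable (M \<Otimes>\<^sub>M borel)"
    by (rule measurable_compose_countable[OF _ N]) (rule measurable_compose[OF measurable_fst f])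
  moreover have "f (num_le n (\<lambda>i. \<tau> i (fst z)) (snd z)) (fst z) = (\<lambda>(\<omega>, x). mle n (\<lambda>i. \<tau> i \<omega>) (\<lambda>i. \<delta> i \<omega>) x) z" for z
    by (simp add: f_def mle_eq_num_le num_le_le case_prod_beta')
  ultimately show ?thesis by simp
qed

lemma (in kernel) smle_hazard_measurable:
  fixes \<tau> \<delta> :: "nat \<Rightarrow> 'a \<Rightarrow> real"
  assumes m: "\<And>i. \<tau> i \<in> borel_measurable M" and m': "\<And>i. \<delta> i \<in> borel_measurable M"
    and \<delta>: "\<And>i \<omega>. 0 \<le> \<delta> i \<omega> \<and> \<delta> i \<omega> \<le> 1" and h: "n > 0 \<Longrightarrow> 0 < h"
  shows "(\<lambda>\<omega>. smle_hazard k h n (\<lambda>i. \<tau> i \<omega>) (\<lambda>i. \<delta> i \<omega>) t) \<in> borel_measurable M"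
proof (cases "n > 0")
  case False
  then have "mle n (\<lambda>i. \<tau> i \<omega>) (\<lambda>i. \<delta> i \<omega>) = (\<lambda>_. 0)" for \<omega>
    using num_le_le[of n] by (auto simp: mle_eq_num_le fun_eq_iff)
  then show ?thesis by (simp add: smle_hazard_def smle_f_def smle_F_def)
next
  case True
  have int: "(\<lambda>\<omega>. LBINT w. \<phi> w * mle n (\<lambda>i. \<tau> i \<omega>) (\<lambda>i. \<delta> i \<omega>) (t - h * w)) \<in> borel_measurable M"
    if b: "bump \<phi>" for \<phi>
  proof (rule lborel.borel_measurable_lebesgue_integral)
    note bump_measurable[OF b, measurable]
    have "(\<lambda>z. (fst z, t - h * snd z)) \<in> measurable (M \<Otimes>\<^sub>M lborel) (M \<Otimes>\<^sub>M borel)" by measurable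
    from measurable_compose[OF this mle_measurable[OF m m', of n]]
    have [measurable]: "(\<lambda>z. mle n (\<lambda>i. \<tau> i (fst z)) (\<lambda>i. \<delta> i (fst z)) (t - h * snd z)) \<in> borel_measurable (M \<Otimes>\<^sub>M lborel)"
      by simp
    show "(\<lambda>(\<omega>, w). \<phi> w * mle n (\<lambda>i. \<tau> i \<omega>) (\<lambda>i. \<delta> i \<omega>) (t - h * w)) \<in> borel_measurable (M \<Otimes>\<^sub>M lborel)"
      unfolding case_prod_beta' by measurable
  qed
  show ?thesis
    unfolding smle_hazard_def using int[OF bump_k] int[OF bump_k'] \<delta> h[OF True]
    by (simp add: smle_F_eq smle_f_eq)
qed


section \<open>Distribution functions with a density\<close>

text \<open>Used with an interval \<open>A\<close>, this converts bounds for a density near a point into bounds for increments of the distribution function.\<close>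

lemma density_measure_bounds:
  fixes f :: "real \<Rightarrow> real"
  assumes [measurable]: "f \<in> borel_measurable borel" and A[measurable]: "A \<in> sets borel" and sub: "A \<subseteq> {l..r}"
    and b: "\<And>u. u \<in> A \<Longrightarrow> a \<le> f u \<and> f u \<le> b" and a: "0 \<le> a" "a \<le> b"
    and fin: "emeasure (density lborel (\<lambda>x. ennreal (f x))) A \<noteq> \<infinity>"
  shows "a * measure lborel A \<le> measure (density lborel (\<lambda>x. ennreal (f x))) A"
    and "measure (density lborel (\<lambda>x. ennreal (f x))) A \<le> b * measure lborel A"
proof -
  let ?\<nu> = "density lborel (\<lambda>x. ennreal (f x))"
  have "emeasure lborel A \<le> emeasure lborel {l..r}" using sub by (intro emeasure_mono) auto
  also have "\<dots> < \<infinity>" using emeasure_lborel_cbox_finite[of l r] by simp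
  finally have lb: "emeasure lborel A = ennreal (measure lborel A)" by (intro emeasure_eq_ennreal_measure) auto
  have e: "emeasure ?\<nu> A = ennreal (measure ?\<nu> A)" using fin by (intro emeasure_eq_ennreal_measure) (auto simp: top.not_eq_extremum)
  have \<nu>: "emeasure ?\<nu> A = (\<integral>\<^sup>+u. ennreal (f u) * indicator A u \<partial>lborel)" by (rule emeasure_density) auto
  have "(\<integral>\<^sup>+u. ennreal a * indicator A u \<partial>lborel) \<le> emeasure ?\<nu> A"
    unfolding \<nu> using b by (intro nn_integral_mono) (auto simp: indicator_def intro: ennreal_leI)
  then have "ennreal (a * measure lborel A) \<le> ennreal (measure ?\<nu> A)"
    using a by (simp add: nn_integral_cmult_indicator lb e ennreal_mult')
  then show "a * measure lborel A \<le> measure ?\<nu> A" by simp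
  have "emeasure ?\<nu> A \<le> (\<integral>\<^sup>+u. ennreal b * indicator A u \<partial>lborel)"
    unfolding \<nu> using b by (intro nn_integral_mono) (auto simp: indicator_def intro: ennreal_leI)
  then have "ennreal (measure ?\<nu> A) \<le> ennreal (b * measure lborel A)"
    using a by (simp add: nn_integral_cmult_indicator lb e ennreal_mult')
  then show "measure ?\<nu> A \<le> b * measure lborel A" using a by (subst (asm) ennreal_le_iff) auto
qed

lemma DERIV_cdf_density:
  fixes f :: "real \<Rightarrow> real"
  assumes [measurable]: "f \<in> borel_measurable borel" and nn: "\<And>x. 0 \<le> f x" 
    and rd: "real_distribution (density lborel (\<lambda>x. ennreal (f x)))"
    and F: "\<And>x. F x = measure (density lborel (\<lambda>x. ennreal (f x))) {..x}" and c: "isCont f x"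
  shows "DERIV F x :> f x"
proof -
  let ?\<nu> = "density lborel (\<lambda>x. ennreal (f x))"
  interpret N: real_distribution ?\<nu> by fact
  have inc: "F y - F x = measure ?\<nu> {x<..y}" if "x \<le> y" for x y
    using N.cdf_diff_eq[of x y] that by (cases "x = y") (auto simp: cdf_def F)
  have lb: "measure lborel {x<..y} = y - x" if "x \<le> y" for x y :: real using that by simp
  have key: "\<bar>F z - F y - f x * (z - y)\<bar> \<le> e * (z - y)"
    if "y \<le> z" and e: "0 < e" and near: "\<And>u. u \<in> {y<..z} \<Longrightarrow> \<bar>f u - f x\<bar> \<le> e" for y z e
  proof -
    have bd: "\<And>u. u \<in> {y<..z} \<Longrightarrow> max 0 (f x - e) \<le> f u \<and> f u \<le> f x + e" 
      using near nn by (fastforce simp: abs_le_iff)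
    have sub: "{y<..z} \<subseteq> {y..z}" by auto
    have "max 0 (f x - e) * measure lborel {y<..z} \<le> measure ?\<nu> {y<..z}" "measure ?\<nu> {y<..z} \<le> (f x + e) * measure lborel {y<..z}"
      using density_measure_bounds[where f=f and A="{y<..z}" and l=y and r=z and a="max 0 (f x - e)" and b="f x + e", OF _ _ sub bd] nn[of x] e N.emeasure_finite
      by auto
    then have m: "max 0 (f x - e) * (z - y) \<le> F z - F y" "F z - F y \<le> (f x + e) * (z - y)"
      using inc[OF \<open>y \<le> z\<close>] \<open>y \<le> z\<close> by auto
    have "(f x - e) * (z - y) \<le> max 0 (f x - e) * (z - y)" using \<open>y \<le> z\<close> by (intro mult_right_mono) auto
    then show ?thesis using m by (simp add: abs_le_iff algebra_simps)
  qed
  show ?thesis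
    unfolding has_field_derivative_iff
  proof (rule tendstoI)
    fix e :: real assume e: "0 < e"
    then obtain d where d: "0 < d" "\<And>u. \<bar>u - x\<bar> < d \<Longrightarrow> \<bar>f u - f x\<bar> < e / 2"
      using c unfolding continuous_at_eps_delta dist_real_def by (metis half_gt_zero)
    show "\<forall>\<^sub>F y in at x. dist ((F y - F x) / (y - x)) (f x) < e"
      unfolding eventually_at
    proof (intro exI[of _ d] conjI d(1) ballI impI)
      fix y assume "y \<in> UNIV" and y: "y \<noteq> x \<and> dist y x < d"
      have "\<bar>F y - F x - f x * (y - x)\<bar> \<le> e / 2 * \<bar>y - x\<bar>"
      proof (cases "x \<le> y")
        case True
        have "\<bar>F y - F x - f x * (y - x)\<bar> \<le> e / 2 * (y - x)"
        proof (rule key[OF True])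
          fix u assume "u \<in> {x<..y}"
          then have "\<bar>u - x\<bar> < d" using y by (auto simp: dist_real_def)
          then show "\<bar>f u - f x\<bar> \<le> e / 2" by (intro less_imp_le d(2))
        qed (use e in simp)
        then show ?thesis using True by simp
      next
        case False
        have "\<bar>F x - F y - f x * (x - y)\<bar> \<le> e / 2 * (x - y)"
        proof (rule key)
          fix u assume "u \<in> {y<..x}"
          then have "\<bar>u - x\<bar> < d" using y by (auto simp: dist_real_def)
          then show "\<bar>f u - f x\<bar> \<le> e / 2" by (intro less_imp_le d(2))
        qed (use e False in auto)
        moreover have "F x - F y - f x * (x - y) = - (F y - F x - f x * (y - x))" by (simp add: algebra_simps)
        ultimately have "\<bar>F y - F x - f x * (y - x)\<bar> \<le> e / 2 * (x - y)" by (simp only: abs_minus_cancel)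
        then show ?thesis using False by simp
      qed
      moreover have "(F y - F x) / (y - x) - f x = (F y - F x - f x * (y - x)) / (y - x)" using y by (simp add: field_simps)
      ultimately have "\<bar>(F y - F x) / (y - x) - f x\<bar> \<le> e / 2" using y by (simp add: abs_divide divide_le_eq)
      then show "dist ((F y - F x) / (y - x)) (f x) < e" using e by (simp add: dist_real_def)
    qed
  qed
qed

section \<open>Asymptotic normality of the hazard estimator\<close>

lemma (in prob_space) expectation_square_sum:
  fixes Y :: "nat \<Rightarrow> 'a \<Rightarrow> real"
  assumes ind: "indep_vars (\<lambda>_. borel) Y {..<n}" and b: "\<And>i \<omega>. \<bar>Y i \<omega>\<bar> \<le> b"
    and mean: "\<And>i. i < n \<Longrightarrow> expectation (Y i) = 0"
  shows "integrable M (\<lambda>\<omega>. (\<Sum>i<n. Y i \<omega>)\<^sup>2)"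
    and "expectation (\<lambda>\<omega>. (\<Sum>i<n. Y i \<omega>)\<^sup>2) = (\<Sum>i<n. expectation (\<lambda>\<omega>. (Y i \<omega>)\<^sup>2))"
proof -
  have rv: "Y i \<in> borel_measurable M" if "i < n" for i using ind that by (auto simp: indep_vars_def2)
  have b0: "0 \<le> b" using b[of 0 undefined] by simp
  have iYY: "integrable M (\<lambda>\<omega>. Y i \<omega> * Y j \<omega>)" if "i < n" "j < n" for i j
  proof (rule integrable_bounded[where C="b * b"])
    show "(\<lambda>\<omega>. Y i \<omega> * Y j \<omega>) \<in> borel_measurable M" using rv that by simp
    show "\<bar>Y i \<omega> * Y j \<omega>\<bar> \<le> b * b" for \<omega> unfolding abs_mult by (intro mult_mono b b0) auto
  qed
  have iY: "integrable M (Y i)" if "i < n" for i by (rule integrable_bounded[OF rv[OF that] b])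
  have sq: "(\<Sum>i<n. Y i \<omega>)\<^sup>2 = (\<Sum>i<n. \<Sum>j<n. Y i \<omega> * Y j \<omega>)" for \<omega>
    by (simp add: power2_eq_square sum_product)
  show "integrable M (\<lambda>\<omega>. (\<Sum>i<n. Y i \<omega>)\<^sup>2)" unfolding sq by (intro Bochner_Integration.integrable_sum iYY) auto
  have E: "expectation (\<lambda>\<omega>. Y i \<omega> * Y j \<omega>) = (if i = j then expectation (\<lambda>\<omega>. (Y i \<omega>)\<^sup>2) else 0)" if "i < n" "j < n" for i j
  proof (cases "i = j")
    case False
    have ind2: "indep_vars (\<lambda>_. borel) Y {i, j}" by (rule indep_vars_subset[OF ind]) (use that in auto)
    have "expectation (\<lambda>\<omega>. \<Prod>l\<in>{i, j}. Y l \<omega>) = (\<Prod>l\<in>{i, j}. expectation (Y l))"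
      by (rule indep_vars_lebesgue_integral[OF _ ind2]) (use iY that in auto)
    then show ?thesis using False mean that by simp
  qed (simp add: power2_eq_square)
  have "expectation (\<lambda>\<omega>. (\<Sum>i<n. Y i \<omega>)\<^sup>2) = (\<Sum>i<n. \<Sum>j<n. expectation (\<lambda>\<omega>. Y i \<omega> * Y j \<omega>))"
  proof -
    have "expectation (\<lambda>\<omega>. \<Sum>i<n. \<Sum>j<n. Y i \<omega> * Y j \<omega>) = (\<Sum>i<n. expectation (\<lambda>\<omega>. \<Sum>j<n. Y i \<omega> * Y j \<omega>))"
      by (rule Bochner_Integration.integral_sum) (intro Bochner_Integration.integrable_sum iYY; simp)
    also have "\<dots> = (\<Sum>i<n. \<Sum>j<n. expectation (\<lambda>\<omega>. Y i \<omega> * Y j \<omega>))"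
      by (intro sum.cong refl Bochner_Integration.integral_sum iYY) auto
    finally show ?thesis unfolding sq .
  qed
  also have "\<dots> = (\<Sum>i<n. \<Sum>j<n. if i = j then expectation (\<lambda>\<omega>. (Y i \<omega>)\<^sup>2) else 0)"
    using E by (intro sum.cong) auto
  also have "\<dots> = (\<Sum>i<n. expectation (\<lambda>\<omega>. (Y i \<omega>)\<^sup>2))" by (intro sum.cong) auto
  finally show "expectation (\<lambda>\<omega>. (\<Sum>i<n. Y i \<omega>)\<^sup>2) = (\<Sum>i<n. expectation (\<lambda>\<omega>. (Y i \<omega>)\<^sup>2))" .
qed

text \<open>The interval \<open>[l, r]\<close> is a neighbourhood of \<open>t\<close> on which the two densities are bounded from above and from below. The functions
\<open>f\<close>, \<open>f1\<close>, \<open>f2\<close> are the first three derivatives of \<open>F0\<close> near \<open>t\<close>, and \<open>g\<close> is the density of the observation times.\<close>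

locale smle_asymptotics = current_status_cont M X T F0 G + kernel k
  for M :: "'a measure" and X T :: "nat \<Rightarrow> 'a \<Rightarrow> real" and F0 G k :: "real \<Rightarrow> real" +
  fixes f f1 f2 g :: "real \<Rightarrow> real" and t l r p1 p2 q1 q2 Bg c :: real
  assumes lt: "l < t" "t < r" and pos: "0 < p1" "0 < p2" "0 < q1" "0 < q2" "0 < Bg" "0 < c"
    and g_meas [measurable]: "g \<in> borel_measurable borel" and g_nonneg: "\<And>u. 0 \<le> g u"
    and lawT_density: "lawT = density lborel (\<lambda>u. ennreal (g u))"
    and g_lower: "\<And>u. l \<le> u \<Longrightarrow> u \<le> r \<Longrightarrow> p1 \<le> g u"
    and g_lip: "\<And>x y. x \<in> {l..r} \<Longrightarrow> y \<in> {l..r} \<Longrightarrow> \<bar>g x - g y\<bar> \<le> Bg * \<bar>x - y\<bar>"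
    and g_cont: "isCont g t"
    and prob_lower: "\<And>x y. l \<le> x \<Longrightarrow> x \<le> y \<Longrightarrow> y \<le> r \<Longrightarrow> p1 * (y - x) \<le> lawT.prob {x<..y}"
    and prob_upper: "\<And>x y. l \<le> x \<Longrightarrow> x \<le> y \<Longrightarrow> y \<le> r \<Longrightarrow> lawT.prob {x..y} \<le> p2 * (y - x)"
    and F0_lower: "\<And>x y. l \<le> x \<Longrightarrow> x \<le> y \<Longrightarrow> y \<le> r \<Longrightarrow> q1 * (y - x) \<le> F0 y - F0 x"
    and F0_upper: "\<And>x y. l \<le> x \<Longrightarrow> x \<le> y \<Longrightarrow> y \<le> r \<Longrightarrow> F0 y - F0 x \<le> q2 * (y - x)"
    and F0_deriv: "\<forall>\<^sub>F x in nhds t. DERIV F0 x :> f x \<and> DERIV f x :> f1 x \<and> DERIV f1 x :> f2 x"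
    and f2_cont: "isCont f2 t"
    and F0_t: "0 < F0 t" "F0 t < 1"
begin

abbreviation bw :: "nat \<Rightarrow> real" where "bw \<equiv> bandwidth c"
definition norming :: "nat \<Rightarrow> real" where "norming n = real n powr (2 / 7)"
text \<open>The weight that represents the smoothed density: \<open>\<integral> \<theta> n H dP = (1 / bw n) \<integral> k'(w) H(t - bw n w) dw\<close> as soon as the window of
width \<open>bw n\<close> around \<open>t\<close> lies in \<open>[l, r]\<close>. The indicator keeps the weight bounded for the remaining, small \<open>n\<close>.\<close>

definition \<theta> :: "nat \<Rightarrow> real \<Rightarrow> real" where
  "\<theta> n u = indicator {l..r} u * (k' ((t - u) / bw n) / (bw n)\<^sup>2 / g u)"

definition leading :: "nat \<Rightarrow> 'a \<Rightarrow> real" where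
  "leading n \<omega> = (\<Sum>i<n. score (\<lambda>u. norming n / n * \<theta> n u) (X i \<omega>) (T i \<omega>))"

lemma bw_pos: "n > 0 \<Longrightarrow> 0 < bw n"
  using pos by (simp add: bandwidth_def)

lemma k'_measurable [measurable]: "k' \<in> borel_measurable borel"
  by (rule bump_measurable[OF bump_k'])

lemma \<theta>_measurable [measurable]: "\<theta> n \<in> borel_measurable borel"
  unfolding \<theta>_def by measurable

lemma \<theta>_bound:
  assumes B: "\<And>u. \<bar>k' u\<bar> \<le> B"
  shows "\<bar>\<theta> n u\<bar> \<le> B / (bw n)\<^sup>2 / p1"
proof (cases "u \<in> {l..r}")
  case True
  have B0: "0 \<le> B" using B[of 0] by auto
  have "\<bar>\<theta> n u\<bar> = \<bar>k' ((t - u) / bw n)\<bar> / (bw n)\<^sup>2 / g u" using True g_nonneg[of u] by (simp add: \<theta>_def abs_divide)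
  also have "\<dots> \<le> B / (bw n)\<^sup>2 / p1"
    using True g_lower[of u] pos B B0 by (intro frac_le divide_right_mono) auto
  finally show ?thesis .
next
  case False
  have "0 \<le> B" using B[of 0] by auto
  then show ?thesis using False pos by (simp add: \<theta>_def)
qed

definition avar :: real where "avar = F0 t * (1 - F0 t) / (c ^ 3 * g t) * (LBINT u. (k' u)\<^sup>2)"

lemma g_t: "0 < g t" using g_lower[of t] lt pos by simp

lemma avar_pos: "0 < avar"
  using F0_t pos g_t roughness_pos by (simp add: avar_def)

lemma isCont_F0: "isCont F0 t"
  using eventually_nhds_x_imp_x[OF F0_deriv] DERIV_isCont by blast

lemma variance_leading:
  "(\<lambda>n. n * lawT.expectation (\<lambda>u. (norming n / n * \<theta> n u)\<^sup>2 * (F0 u * (1 - F0 u)))) \<longlonglongrightarrow> avar"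
proof -
  define q where "q u = indicator {l..r} u * (F0 u * (1 - F0 u) / g u)" for u
  have [measurable]: "q \<in> borel_measurable borel" unfolding q_def by measurable
  have "\<forall>\<^sub>F u in nhds t. q u = F0 u * (1 - F0 u) / g u"
    unfolding eventually_nhds by (rule exI[of _ "{l<..<r}"]) (use lt in \<open>auto simp: q_def\<close>)
  moreover have "isCont (\<lambda>u. F0 u * (1 - F0 u) / g u) t" using g_t isCont_F0 g_cont by (intro continuous_intros) auto
  ultimately have cq: "isCont q t" by (subst isCont_cong) auto
  have bk: "bump (\<lambda>u. (k' u)\<^sup>2)" using bump_k' by (auto simp: bump_def intro!: continuous_intros)
  have main: "n * lawT.expectation (\<lambda>u. (norming n / n * \<theta> n u)\<^sup>2 * (F0 u * (1 - F0 u))) = (LBINT w. (k' w)\<^sup>2 * q (t - bw n * w)) / c ^ 3"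
    if n: "n > 0" for n
  proof -
    have h: "0 < bw n" by (rule bw_pos[OF n])
    have "lawT.expectation (\<lambda>u. (norming n / n * \<theta> n u)\<^sup>2 * (F0 u * (1 - F0 u))) = (LBINT u. g u *\<^sub>R ((norming n / n * \<theta> n u)\<^sup>2 * (F0 u * (1 - F0 u))))"
      unfolding lawT_density by (rule integral_density) (use g_nonneg in auto)
    also have "\<dots> = (LBINT u. (norming n / n)\<^sup>2 / (bw n) ^ 4 * ((k' ((t - u) / bw n))\<^sup>2 * q u))"
    proof (rule Bochner_Integration.integral_cong[OF refl])
      fix u
      show "g u *\<^sub>R ((norming n / n * \<theta> n u)\<^sup>2 * (F0 u * (1 - F0 u))) = (norming n / n)\<^sup>2 / (bw n) ^ 4 * ((k' ((t - u) / bw n))\<^sup>2 * q u)"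
      proof (cases "u \<in> {l..r}")
        case True
        then have "0 < g u" using g_lower[of u] pos by auto
        have alg: "\<gamma> * ((s * (\<kappa> / d\<^sup>2 / \<gamma>))\<^sup>2 * e) = s\<^sup>2 / d ^ 4 * (\<kappa>\<^sup>2 * (e / \<gamma>))" if "0 < \<gamma>" for \<gamma> s \<kappa> d e :: real
          using that by (simp add: power2_eq_square power4_eq_xxxx ac_simps)
        have "\<theta> n u = k' ((t - u) / bw n) / (bw n)\<^sup>2 / g u" "q u = F0 u * (1 - F0 u) / g u"
          using True by (simp_all add: \<theta>_def q_def)
        then show ?thesis unfolding real_scaleR_def by (simp only: alg[OF \<open>0 < g u\<close>])
      qed (simp add: \<theta>_def q_def)
    qed
    also have "\<dots> = (norming n / n)\<^sup>2 / (bw n) ^ 4 * (LBINT u. (k' ((t - u) / bw n))\<^sup>2 * q u)" by simp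
    also have "(LBINT u. (k' ((t - u) / bw n))\<^sup>2 * q u) = \<bar>- bw n\<bar> *\<^sub>R (LBINT w. (k' ((t - (t + - bw n * w)) / bw n))\<^sup>2 * q (t + - bw n * w))"
      by (rule lborel_integral_real_affine) (use h in auto)
    also have "\<dots> = bw n * (LBINT w. (k' w)\<^sup>2 * q (t - bw n * w))" using h by simp
    finally have "n * lawT.expectation (\<lambda>u. (norming n / n * \<theta> n u)\<^sup>2 * (F0 u * (1 - F0 u)))
      = (n * (norming n / n)\<^sup>2 / (bw n) ^ 4 * bw n) * (LBINT w. (k' w)\<^sup>2 * q (t - bw n * w))" by simp
    also have "n * (norming n / n)\<^sup>2 / (bw n) ^ 4 * bw n = (norming n)\<^sup>2 / (n * (bw n) ^ 3)"
      using h n by (simp add: power2_eq_square power4_eq_xxxx power3_eq_cube field_simps)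
    also have "\<dots> = 1 / c ^ 3"
    proof -
      have "(bw n) ^ 3 = c ^ 3 * n powr (- 3 / 7)" using n by (simp add: bandwidth_def power_mult_distrib powr_power)
      moreover have "(norming n)\<^sup>2 = n powr (4 / 7)" using n by (simp add: norming_def powr_power)
      moreover have "real n * n powr (- 3 / 7) = n powr (4 / 7)" using n powr_mult_base[of "real n" "- 3 / 7"] by simp
      moreover have "real n * (c ^ 3 * n powr (- 3 / 7)) = c ^ 3 * (real n * n powr (- 3 / 7))" by (rule mult.left_commute)
      ultimately have "(norming n)\<^sup>2 / (n * (bw n) ^ 3) = n powr (4 / 7) / (c ^ 3 * n powr (4 / 7))" by (simp only:)
      then show ?thesis using n by simp
    qed
    finally show ?thesis by simp
  qed
  have bw0: "filterlim bw (at_right 0) sequentially"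
    unfolding bandwidth_def using pos(6) by real_asymp
  have "(\<lambda>n. (LBINT w. (k' w)\<^sup>2 * q (t - bw n * w)) / c ^ 3) \<longlonglongrightarrow> q t * (LBINT w. (k' w)\<^sup>2) / c ^ 3"
    by (intro tendsto_divide tendsto_const filterlim_compose[OF bump_concentrates[OF bk _ cq] bw0]) (use pos in auto)
  moreover have "q t * (LBINT w. (k' w)\<^sup>2) / c ^ 3 = avar" using lt by (simp add: q_def avar_def)
  moreover have "\<forall>\<^sub>F n in sequentially. (LBINT w. (k' w)\<^sup>2 * q (t - bw n * w)) / c ^ 3 = n * lawT.expectation (\<lambda>u. (norming n / n * \<theta> n u)\<^sup>2 * (F0 u * (1 - F0 u)))"
    by (intro eventually_sequentiallyI[of 1] main[symmetric]) simp
  ultimately show ?thesis using Lim_transform_eventually by fastforce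
qed

lemma leading_clt:
  "leading n \<in> borel_measurable M"
  "integrable M (\<lambda>\<omega>. (leading n \<omega>)\<^sup>2)"
  "\<exists>C. \<forall>n. expectation (\<lambda>\<omega>. (leading n \<omega>)\<^sup>2) \<le> C"
  "(\<lambda>n. char (distr M borel (leading n)) s) \<longlonglongrightarrow> complex_of_real (exp (- (s\<^sup>2 * avar / 2)))"
proof -
  obtain B where B: "0 < B" "\<And>u. \<bar>k' u\<bar> \<le> B" using bump_bounded[OF bump_k'] by blast
  define Y where "Y n i \<omega> = score (\<lambda>u. norming n / n * \<theta> n u) (X i \<omega>) (T i \<omega>)" for n i \<omega>
  define b where "b n = norming n / n * (B / (bw n)\<^sup>2 / p1)" for n
  define v where "v n = lawT.expectation (\<lambda>u. (norming n / n * \<theta> n u)\<^sup>2 * (F0 u * (1 - F0 u)))" for n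
  have m: "(\<lambda>u. norming n / n * \<theta> n u) \<in> borel_measurable borel" for n by measurable
  have bd: "\<bar>norming n / n * \<theta> n u\<bar> \<le> b n" for n u
    unfolding b_def abs_mult using \<theta>_bound[OF B(2), of n u] by (intro mult_mono) (auto simp: norming_def)
  have ind: "indep_vars (\<lambda>_. borel) (Y n) {..<n}" for n
    unfolding Y_def[abs_def] by (rule indep_pairs[OF score_measurable[OF m]])
  have Yb: "\<bar>Y n i \<omega>\<bar> \<le> b n" for n i \<omega> 
    using score_bound[of "\<lambda>u. norming n / n * \<theta> n u" "X i \<omega>" "T i \<omega>"] bd[of n "T i \<omega>"] unfolding Y_def by linarith
  have mean: "expectation (Y n i) = 0" for n i unfolding Y_def[abs_def] by (rule expectation_score(1)[OF m bd])
  have var: "expectation (\<lambda>\<omega>. (Y n i \<omega>)\<^sup>2) = v n" for n i unfolding Y_def v_def by (rule expectation_score(2)[OF m bd])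
  have lead: "leading n = (\<lambda>\<omega>. \<Sum>i<n. Y n i \<omega>)" for n by (simp add: leading_def Y_def fun_eq_iff)
  show "leading n \<in> borel_measurable M"
    unfolding lead using ind[of n] by (intro borel_measurable_sum) (auto simp: indep_vars_def2)
  show "integrable M (\<lambda>\<omega>. (leading n \<omega>)\<^sup>2)"
    unfolding lead by (rule expectation_square_sum(1)[where Y="Y n", OF ind Yb mean])
  have V: "(\<lambda>n. n * v n) \<longlonglongrightarrow> avar" unfolding v_def by (rule variance_leading)
  have E2: "expectation (\<lambda>\<omega>. (leading n \<omega>)\<^sup>2) = n * v n" for n
    unfolding lead using expectation_square_sum(2)[where Y="Y n", OF ind Yb mean] by (simp add: var)
  have "Bseq (\<lambda>n. n * v n)" using V convergentI convergent_imp_Bseq by blast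
  then obtain C where "\<And>n. norm (n * v n) \<le> C" by (auto simp: Bseq_def)
  then have "expectation (\<lambda>\<omega>. (leading n \<omega>)\<^sup>2) \<le> C" for n using E2[of n] by (metis abs_ge_self order_trans real_norm_def)
  then show "\<exists>C. \<forall>n. expectation (\<lambda>\<omega>. (leading n \<omega>)\<^sup>2) \<le> C" by blast
  have b0: "b \<longlonglongrightarrow> 0" unfolding b_def norming_def bandwidth_def using pos B(1) by real_asymp
  show "(\<lambda>n. char (distr M borel (leading n)) s) \<longlonglongrightarrow> complex_of_real (exp (- (s\<^sup>2 * avar / 2)))"
    unfolding lead by (rule char_triangular_array_tendsto[where Y=Y, OF ind Yb b0 mean var V])
qed

end


text \<open>Linearisation of the quotient \<open>ff / (1 - FF)\<close> at \<open>f0 / Q\<close>, with explicit constants. The estimate \<open>e3\<close> for the error of \<open>FF\<close> also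
appears as the factor of \<open>A\<close>, because \<open>A\<close> gets divided by \<open>1 - FF\<close> instead of \<open>Q\<close>.\<close>

lemma hazard_delta:
  fixes N Q ff FF f0 A b1 b2 e1 e2 :: real
  assumes N: "0 < N" and Q: "0 < Q"
    and U: "\<bar>N * (ff - f0) - A - b1\<bar> \<le> e1" and W: "\<bar>N * (FF - (1 - Q)) - b2\<bar> \<le> e2"
    and e3: "e3 = (\<bar>b2\<bar> + e2) / N" and small: "e3 \<le> Q / 2"
  shows "\<bar>N * (ff / (1 - FF) - f0 / Q) - ((b1 / Q + f0 * b2 / Q\<^sup>2) + 1 / Q * A)\<bar>
    \<le> 2 * e3 / Q\<^sup>2 * \<bar>A\<bar> + (2 * e1 / Q + 2 * e3 / Q\<^sup>2 * \<bar>b1\<bar> + 2 * \<bar>f0\<bar> * e2 / Q\<^sup>2 + 2 * e3 / Q\<^sup>2 * (\<bar>f0\<bar> * \<bar>b2\<bar> / Q))"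
proof -
  define u where "u = FF - (1 - Q)"
  define w where "w = N * u"
  define v where "v = N * (ff - f0)"
  have "\<bar>w\<bar> \<le> \<bar>b2\<bar> + e2" using W by (simp add: w_def u_def)
  then have "\<bar>u\<bar> \<le> e3" using N by (simp add: w_def e3 abs_mult pos_le_divide_eq mult.commute)
  then have uQ: "\<bar>u\<bar> \<le> Q / 2" "\<bar>u\<bar> \<le> e3" using small by auto
  then have Qu: "Q / 2 \<le> Q - u" "0 < Q - u" using Q by auto
  have FF: "1 - FF = Q - u" by (simp add: u_def)
  define \<rho> where "\<rho> = 1 / (Q - u)"
  have r0: "0 < \<rho>" "\<rho> \<le> 2 / Q" using Qu Q by (auto simp: \<rho>_def field_simps)
  have rq: "\<rho> - 1 / Q = u / Q * \<rho>" using Q Qu by (simp add: \<rho>_def field_simps)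
  have r1: "\<bar>\<rho> - 1 / Q\<bar> \<le> 2 * e3 / Q\<^sup>2"
  proof -
    from rq have "\<bar>\<rho> - 1 / Q\<bar> = \<bar>u\<bar> / Q * \<rho>" using Q r0 by (simp add: abs_mult)
    also have "\<dots> \<le> e3 / Q * (2 / Q)" using uQ r0 Q by (intro mult_mono divide_right_mono) auto
    finally show ?thesis by (simp add: power2_eq_square mult.commute)
  qed
  have Y: "N * (ff / (1 - FF) - f0 / Q) = v * \<rho> + f0 * w / Q * \<rho>"
  proof -
    have "ff / (1 - FF) - f0 / Q = ff * \<rho> - f0 * (\<rho> - u / Q * \<rho>)" 
    proof -
      have "ff / (1 - FF) = ff * \<rho>" by (simp add: FF \<rho>_def)
      moreover have "f0 / Q = f0 * (\<rho> - u / Q * \<rho>)" using rq[symmetric] by simp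
      ultimately show ?thesis by simp
    qed
    then show ?thesis unfolding v_def w_def by (simp only:) (simp add: algebra_simps)
  qed
  have "N * (ff / (1 - FF) - f0 / Q) - ((b1 / Q + f0 * b2 / Q\<^sup>2) + 1 / Q * A)
    = (v - A - b1) * \<rho> + (\<rho> - 1 / Q) * A + (\<rho> - 1 / Q) * b1 + f0 * (w - b2) / Q * \<rho> + (\<rho> - 1 / Q) * (f0 * b2 / Q)"
    unfolding Y using Q by (simp add: field_simps power2_eq_square)
  also have "\<bar>\<dots>\<bar> \<le> \<bar>(v - A - b1) * \<rho>\<bar> + \<bar>(\<rho> - 1 / Q) * A\<bar> + \<bar>(\<rho> - 1 / Q) * b1\<bar> + \<bar>f0 * (w - b2) / Q * \<rho>\<bar> + \<bar>(\<rho> - 1 / Q) * (f0 * b2 / Q)\<bar>"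
  proof -
    have "\<bar>x1 + x2 + x3 + x4 + x5\<bar> \<le> \<bar>x1\<bar> + \<bar>x2\<bar> + \<bar>x3\<bar> + \<bar>x4\<bar> + \<bar>x5\<bar>" for x1 x2 x3 x4 x5 :: real by linarith
    then show ?thesis .
  qed
  also have "\<dots> \<le> e1 * (2 / Q) + 2 * e3 / Q\<^sup>2 * \<bar>A\<bar> + 2 * e3 / Q\<^sup>2 * \<bar>b1\<bar> + \<bar>f0\<bar> * e2 / Q * (2 / Q) + 2 * e3 / Q\<^sup>2 * (\<bar>f0\<bar> * \<bar>b2\<bar> / Q)"
  proof (intro add_mono)
    show "\<bar>(v - A - b1) * \<rho>\<bar> \<le> e1 * (2 / Q)"
      unfolding abs_mult using U r0 by (intro mult_mono) (auto simp: v_def)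
    show "\<bar>(\<rho> - 1 / Q) * A\<bar> \<le> 2 * e3 / Q\<^sup>2 * \<bar>A\<bar>" "\<bar>(\<rho> - 1 / Q) * b1\<bar> \<le> 2 * e3 / Q\<^sup>2 * \<bar>b1\<bar>"
      unfolding abs_mult by (intro mult_right_mono r1; simp)+
    have "\<bar>(\<rho> - 1 / Q) * (f0 * b2 / Q)\<bar> = \<bar>\<rho> - 1 / Q\<bar> * (\<bar>f0\<bar> * \<bar>b2\<bar> / Q)" using Q by (simp add: abs_mult)
    also have "\<dots> \<le> 2 * e3 / Q\<^sup>2 * (\<bar>f0\<bar> * \<bar>b2\<bar> / Q)" using Q by (intro mult_right_mono r1) auto
    finally show "\<bar>(\<rho> - 1 / Q) * (f0 * b2 / Q)\<bar> \<le> 2 * e3 / Q\<^sup>2 * (\<bar>f0\<bar> * \<bar>b2\<bar> / Q)" .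
    have "\<bar>f0 * (w - b2) / Q * \<rho>\<bar> = \<bar>f0\<bar> * \<bar>w - b2\<bar> / Q * \<rho>" using Q r0 by (simp add: abs_mult)
    also have "\<dots> \<le> \<bar>f0\<bar> * e2 / Q * (2 / Q)"
      using W r0 Q by (intro mult_mono divide_right_mono mult_left_mono) (auto simp: w_def u_def)
    finally show "\<bar>f0 * (w - b2) / Q * \<rho>\<bar> \<le> \<bar>f0\<bar> * e2 / Q * (2 / Q)" .
  qed
  also have "\<dots> = 2 * e3 / Q\<^sup>2 * \<bar>A\<bar> + (2 * e1 / Q + 2 * e3 / Q\<^sup>2 * \<bar>b1\<bar> + 2 * \<bar>f0\<bar> * e2 / Q\<^sup>2 + 2 * e3 / Q\<^sup>2 * (\<bar>f0\<bar> * \<bar>b2\<bar> / Q))"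
    by (simp add: power2_eq_square ac_simps)
  finally show ?thesis .
qed

context smle_asymptotics
begin

text \<open>The modulus is needed only up to a small power of \<open>n\<close>; an exponent \<open>\<epsilon>\<close> is small enough if \<open>- 2 / 3 + 2 \<epsilon> + 2 / 7 < - 2 / 7\<close>, the
condition coming from the distance between the cumulative sum diagram and its minorant. The averaging length \<open>n\<^sup>-\<^sup>1\<^sup>/\<^sup>3\<close> balances bias
and fluctuation of the estimator. With these choices \<open>mle_err\<close> is \<open>rate\<close>, and \<open>gap_bound\<close> is \<open>cusum_gap\<close>, with the
constant \<open>12\<close> from \<open>sample_modulus_good\<close>.\<close>

definition slack :: "nat \<Rightarrow> real" where "slack n = real n powr (1 / 100)"
definition avg_len :: "nat \<Rightarrow> real" where "avg_len n = real n powr (- 1 / 3)"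
definition mle_err :: "nat \<Rightarrow> real" where "mle_err n = q2 * avg_len n + 4 * (12 * slack n) / sqrt (n * (p1 * avg_len n))"
definition gap_noise :: "nat \<Rightarrow> real" where "gap_noise n = 12 * slack n * (sqrt (n * (p2 * (2 * mle_err n / q1))) + 1)"
definition gap_bound :: "nat \<Rightarrow> real" where "gap_bound n = gap_noise n + mle_err n * (n * (p2 * (2 * mle_err n / q1)) + gap_noise n)"

lemma local_modulus_eventually:
  "\<forall>\<^sub>F n in sequentially. \<forall>\<omega>\<in>good n (slack n). sample_modulus_local lawT n (times \<omega>) (inds \<omega>) F0
     (12 * slack n) l r p1 p2 q1 q2 (avg_len n)"
proof -
  have "\<forall>\<^sub>F n in sequentially. 16 * (12 * slack n)\<^sup>2 \<le> n * (p1 * avg_len n)" 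
    unfolding slack_def avg_len_def using pos(1) by real_asymp
  then show ?thesis using eventually_ge_at_top[of 1]
  proof eventually_elim
    case (elim n)
    then have n: "n > 0" and k1: "1 \<le> slack n" by (auto simp: slack_def ge_one_powr_ge_zero)
    show ?case
    proof
      fix \<omega> assume "\<omega> \<in> good n (slack n)"
      then have "sample_modulus lawT n (times \<omega>) (inds \<omega>) F0 (12 * slack n)"
        by (rule sample_modulus_good[OF n k1])
      then show "sample_modulus_local lawT n (times \<omega>) (inds \<omega>) F0
         (12 * slack n) l r p1 p2 q1 q2 (avg_len n)"
        by (rule sample_modulus_local.intro, intro sample_modulus_local_axioms.intro)
          (use elim pos n prob_lower prob_upper F0_lower F0_upper in \<open>auto simp: avg_len_def\<close>)
    qed
  qed
qed

lemma window_eventually: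
  "\<forall>\<^sub>F n in sequentially. 0 < n \<and> t + bw n \<le> r - avg_len n \<and> l + avg_len n + 2 * mle_err n / q1 < t - bw n"
proof -
  have "(\<lambda>n. t + bw n + avg_len n) \<longlonglongrightarrow> t" unfolding bandwidth_def avg_len_def using pos by real_asymp
  then have "\<forall>\<^sub>F n in sequentially. t + bw n + avg_len n < r" using lt by (intro order_tendstoD(2))
  moreover have "(\<lambda>n. avg_len n + 2 * mle_err n / q1 + bw n) \<longlonglongrightarrow> 0" unfolding bandwidth_def avg_len_def mle_err_def slack_def using pos by real_asymp
  then have "\<forall>\<^sub>F n in sequentially. avg_len n + 2 * mle_err n / q1 + bw n < t - l" using lt by (intro order_tendstoD(2)) auto
  ultimately show ?thesis using eventually_gt_at_top[of 0] by eventually_elim auto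
qed

text \<open>The quotient rule for difference quotients; \<open>k'\<close> and \<open>g\<close> are Lipschitz and \<open>g\<close> is bounded away from zero.\<close>

lemma \<theta>_lipschitz: "\<exists>C B. 0 < C \<and> 0 < B \<and> (\<forall>n>0. \<forall>x\<in>{l..r}. \<forall>y\<in>{l..r}. \<bar>\<theta> n x - \<theta> n y\<bar> \<le> (C / bw n + B) / (bw n)\<^sup>2 * \<bar>x - y\<bar>)"
proof -
  obtain B where B: "0 < B" "\<And>u. \<bar>k' u\<bar> \<le> B" using bump_bounded[OF bump_k'] by blast
  obtain C where C: "0 < C" "\<And>x y. \<bar>k' x - k' y\<bar> \<le> C * \<bar>x - y\<bar>" using k'_lipschitz by blast
  have "\<bar>\<theta> n x - \<theta> n y\<bar> \<le> (C / p1 / bw n + B * Bg / p1\<^sup>2) / (bw n)\<^sup>2 * \<bar>x - y\<bar>" if n: "n > 0" and x: "x \<in> {l..r}" and y: "y \<in> {l..r}" for n x y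
  proof -
    define h where "h = bw n"
    have h: "0 < h" using bw_pos[OF n] by (simp add: h_def)
    define K where "K z = k' ((t - z) / h)" for z
    have gp: "p1 \<le> g x" "p1 \<le> g y" "0 < g x" "0 < g y" using g_lower x y pos by (auto intro: less_le_trans)
    have K: "\<bar>K x - K y\<bar> \<le> C / h * \<bar>x - y\<bar>"
    proof -
      have "(t - x) / h - (t - y) / h = - ((x - y) / h)" by (simp add: diff_divide_distrib)
      then have "\<bar>(t - x) / h - (t - y) / h\<bar> = \<bar>x - y\<bar> / h" using h by (simp add: abs_divide)
      then show ?thesis using C(2)[of "(t - x) / h" "(t - y) / h"] by (simp add: K_def)
    qed
    have "K x / g x - K y / g y = (K x - K y) / g x + K y * (g y - g x) / (g x * g y)"
      using gp by (simp add: field_simps)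
    also have "\<bar>\<dots>\<bar> \<le> \<bar>K x - K y\<bar> / g x + \<bar>K y\<bar> * \<bar>g y - g x\<bar> / (g x * g y)"
      using gp by (intro order_trans[OF abs_triangle_ineq]) (simp add: abs_mult abs_divide)
    also have "\<dots> \<le> C / h * \<bar>x - y\<bar> / p1 + B * (Bg * \<bar>x - y\<bar>) / (p1 * p1)"
      using gp pos K B C h g_lip[OF y x] unfolding K_def
      by (intro add_mono frac_le mult_mono) (auto simp: abs_minus_commute)
    also have "\<dots> = (C / p1 / h + B * Bg / p1\<^sup>2) * \<bar>x - y\<bar>"
      by (simp add: power2_eq_square distrib_right mult.commute[of h p1])
    finally have "\<bar>K x / g x - K y / g y\<bar> \<le> (C / p1 / h + B * Bg / p1\<^sup>2) * \<bar>x - y\<bar>" .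
    moreover have "\<theta> n x - \<theta> n y = (K x / g x - K y / g y) / h\<^sup>2"
      using x y by (simp add: \<theta>_def K_def h_def diff_divide_distrib mult.commute)
    ultimately show ?thesis using h by (simp add: h_def[symmetric] abs_divide divide_right_mono)
  qed
  then show ?thesis using C(1) B(1) pos by (intro exI[of _ "C / p1"] exI[of _ "B * Bg / p1\<^sup>2"]) auto
qed

definition centre_f :: "nat \<Rightarrow> real" where "centre_f n = (LBINT w. k' w * F0 (t - bw n * w)) / bw n"
definition centre_F :: "nat \<Rightarrow> real" where "centre_F n = (LBINT w. k w * F0 (t - bw n * w))"

text \<open>The first part identifies the difference between the smoothed density and its centring with the leading term plus a residual. The
second needs only the uniform rate, because the kernel integrates to one.\<close>

lemma smle_expansion:
  assumes S: "sample_modulus_local lawT n (times \<omega>) (inds \<omega>) F0 (12 * slack n) l r p1 p2 q1 q2 (avg_len n)"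
    and win: "0 < n \<and> t + bw n \<le> r - avg_len n \<and> l + avg_len n + 2 * mle_err n / q1 < t - bw n"
    and lip: "\<And>x y. x \<in> {l..r} \<Longrightarrow> y \<in> {l..r} \<Longrightarrow> \<bar>\<theta> n x - \<theta> n y\<bar> \<le> L * \<bar>x - y\<bar>"
  shows "\<bar>norming n * (smle_f k (bw n) n (times \<omega>) (inds \<omega>) t - centre_f n) - leading n \<omega>\<bar>
      \<le> norming n * (L * (2 * bw n) * (((2 * q2 * (2 * bw n) + 3 * mle_err n) * (12 * slack n * (sqrt n + 1)) + 2 * gap_bound n) / n))"
    and "\<bar>smle_F k (bw n) n (times \<omega>) (inds \<omega>) t - centre_F n\<bar> \<le> mle_err n"
proof -
  interpret S: sample_modulus_local lawT n "times \<omega>" "inds \<omega>" F0 "12 * slack n" l r p1 p2 q1 q2 "avg_len n"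
    by (rule S)
  have n: "n > 0" using win by simp
  have h: "0 < bw n" by (rule bw_pos[OF n])
  have d: "0 < avg_len n" using n by (simp add: avg_len_def)
  have rate: "S.rate = mle_err n" by (simp add: S.rate_def mle_err_def)
  have gap_bound: "S.cusum_gap = gap_bound n" by (simp add: S.cusum_gap_def gap_bound_def gap_noise_def Let_def rate)
  have r0: "0 \<le> mle_err n / q1" using S.rate_nonneg pos by (simp add: rate)
  have sub: "u \<in> {l + avg_len n..r - avg_len n}" if "\<bar>t - u\<bar> \<le> bw n" for u using that win r0 d by (auto simp: abs_le_iff)
  have zero: "k' ((t - u) / bw n) = 0" if "bw n \<le> \<bar>t - u\<bar>" for u
    by (rule bump_zero[OF bump_k']) (use that h in \<open>simp add: abs_divide\<close>)
  have int: "integrable lborel (\<lambda>w. \<phi> w * H (t - bw n * w))"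
    if "bump \<phi>" "H \<in> borel_measurable borel" "\<And>u. \<bar>H u\<bar> \<le> 1" for \<phi> H
    by (rule bump_integral_bound(1)[OF that(1), where B=1]) (use that(2,3) in auto)
  have abs1: "\<bar>S.Fh u\<bar> \<le> 1" "\<bar>F0 u\<bar> \<le> 1" for u using S.Fh_01[of u] F0_01[of u] by auto
  have diff: "(LBINT w. \<phi> w * S.Fh (t - bw n * w)) - (LBINT w. \<phi> w * F0 (t - bw n * w)) = (LBINT w. \<phi> w * (S.Fh (t - bw n * w) - F0 (t - bw n * w)))"
    if "bump \<phi>" for \<phi>
    using int[OF that S.Fh_measurable abs1(1)] int[OF that F0_measurable abs1(2)] by (simp add: right_diff_distrib)
  have sF: "smle_F k (bw n) n (times \<omega>) (inds \<omega>) t = (LBINT w. k w * S.Fh (t - bw n * w))"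
    by (rule smle_F_eq) (use h in auto)
  have sf: "smle_f k (bw n) n (times \<omega>) (inds \<omega>) t = (LBINT w. k' w * S.Fh (t - bw n * w)) / bw n"
    by (rule smle_f_eq) (use h in auto)

  have "\<bar>smle_F k (bw n) n (times \<omega>) (inds \<omega>) t - centre_F n\<bar>
     = \<bar>LBINT w. k w * (S.Fh (t - bw n * w) - F0 (t - bw n * w))\<bar>"
    unfolding sF centre_F_def diff[OF bump_k] ..
  also have "\<dots> \<le> mle_err n * (LBINT w. \<bar>k w\<bar>)"
  proof (rule bump_integral_bound(2)[OF bump_k])
    fix w :: real assume "\<bar>w\<bar> < 1"
    then have "\<bar>t - (t - bw n * w)\<bar> \<le> bw n" using h by (simp add: abs_mult mult_left_le)
    then show "\<bar>S.Fh (t - bw n * w) - F0 (t - bw n * w)\<bar> \<le> mle_err n" using S.mle_rate[OF sub] by (simp add: rate)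
  next
    show "0 \<le> mle_err n" using S.rate_nonneg by (simp add: rate)
  qed measurable
  also have "(LBINT w. \<bar>k w\<bar>) = 1" using integral_k k_nonneg by simp
  finally show "\<bar>smle_F k (bw n) n (times \<omega>) (inds \<omega>) t - centre_F n\<bar> \<le> mle_err n" by simp

  have "lawT.expectation (\<lambda>u. \<theta> n u * (S.Fh u - F0 u)) = (LBINT u. g u *\<^sub>R (\<theta> n u * (S.Fh u - F0 u)))"
    unfolding lawT_density by (rule integral_density) (use g_nonneg in auto)
  also have "\<dots> = (LBINT u. k' ((t - u) / bw n) / (bw n)\<^sup>2 * (S.Fh u - F0 u))"
  proof (rule Bochner_Integration.integral_cong[OF refl])
    fix u show "g u *\<^sub>R (\<theta> n u * (S.Fh u - F0 u)) = k' ((t - u) / bw n) / (bw n)\<^sup>2 * (S.Fh u - F0 u)"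
    proof (cases "\<bar>t - u\<bar> < bw n")
      case True
      then have "u \<in> {l..r}" using sub[of u] d by auto
      then have "0 < g u" using g_lower[of u] pos by auto
      then show ?thesis using \<open>u \<in> {l..r}\<close> by (simp add: \<theta>_def)
    next
      case False then show ?thesis using zero[of u] by (simp add: \<theta>_def)
    qed
  qed
  also have "\<dots> = \<bar>- bw n\<bar> *\<^sub>R (LBINT w. k' ((t - (t + - bw n * w)) / bw n) / (bw n)\<^sup>2 * (S.Fh (t + - bw n * w) - F0 (t + - bw n * w)))"
    by (rule lborel_integral_real_affine) (use h in auto)
  also have "\<dots> = bw n * (LBINT w. k' w * (S.Fh (t - bw n * w) - F0 (t - bw n * w)) / (bw n)\<^sup>2)" using h by simp
  also have "\<dots> = (LBINT w. k' w * (S.Fh (t - bw n * w) - F0 (t - bw n * w))) / bw n"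
    using h by (simp add: power2_eq_square)
  also have "\<dots> = smle_f k (bw n) n (times \<omega>) (inds \<omega>) t - centre_f n"
    unfolding sf centre_f_def diff[OF bump_k', symmetric] by (rule diff_divide_distrib)
  finally have e: "smle_f k (bw n) n (times \<omega>) (inds \<omega>) t - centre_f n = lawT.expectation (\<lambda>u. \<theta> n u * (S.Fh u - F0 u))" ..
  have lead: "leading n \<omega> = norming n * ((\<Sum>i<n. \<theta> n (T i \<omega>) * (of_bool (X i \<omega> \<le> T i \<omega>) - F0 (T i \<omega>))) / n)"
    by (simp add: leading_def score_def sum_distrib_left sum_divide_distrib mult.assoc)
  have "norming n * (smle_f k (bw n) n (times \<omega>) (inds \<omega>) t - centre_f n) - leading n \<omega> = norming n * S.residual (\<theta> n)"
    unfolding e lead S.residual_def by (simp add: right_diff_distrib)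
  then have eq: "\<bar>norming n * (smle_f k (bw n) n (times \<omega>) (inds \<omega>) t - centre_f n) - leading n \<omega>\<bar> = norming n * \<bar>S.residual (\<theta> n)\<bar>"
    by (simp add: abs_mult norming_def)
  have w2: "t + bw n - (t - bw n) = 2 * bw n" by simp
  have "\<bar>S.residual (\<theta> n)\<bar> \<le> L * (t + bw n - (t - bw n)) * (((2 * q2 * (t + bw n - (t - bw n)) + 3 * S.rate) * (12 * slack n * (sqrt n + 1)) + 2 * S.cusum_gap) / n)"
  proof (rule S.residual_small)
    show "\<theta> n \<in> borel_measurable borel" by measurable
    show "\<theta> n u = 0" if "u \<le> t - bw n \<or> t + bw n \<le> u" for u
      using zero[of u] that h by (auto simp: \<theta>_def abs_real_def)
    show "\<bar>\<theta> n x - \<theta> n y\<bar> \<le> L * \<bar>x - y\<bar>" if "x \<in> {t - bw n..t + bw n}" "y \<in> {t - bw n..t + bw n}" for x y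
      using sub[of x] sub[of y] that d by (intro lip) (auto simp: abs_le_iff)
  qed (use win h in \<open>auto simp: rate\<close>)
  then show "\<bar>norming n * (smle_f k (bw n) n (times \<omega>) (inds \<omega>) t - centre_f n) - leading n \<omega>\<bar>
      \<le> norming n * (L * (2 * bw n) * (((2 * q2 * (2 * bw n) + 3 * mle_err n) * (12 * slack n * (sqrt n + 1)) + 2 * gap_bound n) / n))"
    unfolding eq w2 rate gap_bound by (intro mult_left_mono) (auto simp: norming_def)
qed

lemma bw_at_right: "filterlim bw (at_right 0) sequentially"
  unfolding bandwidth_def using pos(6) by real_asymp

lemma norming_eq: "n > 0 \<Longrightarrow> norming n = c\<^sup>2 / (bw n)\<^sup>2"
proof -
  assume n: "n > 0"
  have "(bw n)\<^sup>2 = c\<^sup>2 * n powr (- 2 / 7)" using n by (simp add: bandwidth_def power_mult_distrib powr_power)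
  moreover have "real n powr (- 2 / 7) = inverse (real n powr (2 / 7))" using powr_minus[of "real n" "2 / 7"] by simp
  ultimately have "(bw n)\<^sup>2 = c\<^sup>2 * inverse (norming n)" by (simp only: norming_def)
  moreover have "0 < norming n" using n by (simp add: norming_def)
  ultimately have "norming n * (bw n)\<^sup>2 = c\<^sup>2" by simp
  then show ?thesis using bw_pos[OF n] by (simp add: eq_divide_eq)
qed

lemma bias_limits:
  "(\<lambda>n. norming n * (centre_f n - f t)) \<longlonglongrightarrow> c\<^sup>2 * (f2 t * second_moment k / 2)"
  "(\<lambda>n. norming n * (centre_F n - F0 t)) \<longlonglongrightarrow> c\<^sup>2 * (f1 t * second_moment k / 2)"
proof -
  have ev: "\<forall>\<^sub>F n in sequentially. c\<^sup>2 * (x n / (bw n)\<^sup>2) = norming n * x n" for x :: "nat \<Rightarrow> real"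
    by (intro eventually_sequentiallyI[of 1]) (simp add: norming_eq)
  have "(\<lambda>n. c\<^sup>2 * ((centre_f n - f t) / (bw n)\<^sup>2)) \<longlonglongrightarrow> c\<^sup>2 * (f2 t * second_moment k / 2)"
    unfolding centre_f_def
    by (intro tendsto_mult tendsto_const filterlim_compose[OF bias_f[OF F0_measurable F0_deriv f2_cont] bw_at_right])
  then show "(\<lambda>n. norming n * (centre_f n - f t)) \<longlonglongrightarrow> c\<^sup>2 * (f2 t * second_moment k / 2)"
    by (rule Lim_transform_eventually[OF _ ev])
  have "(\<lambda>n. c\<^sup>2 * ((centre_F n - F0 t) / (bw n)\<^sup>2)) \<longlonglongrightarrow> c\<^sup>2 * (f1 t * second_moment k / 2)"
    unfolding centre_F_def
    by (intro tendsto_mult tendsto_const filterlim_compose[OF bias_F[OF F0_measurable F0_deriv f2_cont] bw_at_right])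
  then show "(\<lambda>n. norming n * (centre_F n - F0 t)) \<longlonglongrightarrow> c\<^sup>2 * (f1 t * second_moment k / 2)"
    by (rule Lim_transform_eventually[OF _ ev])
qed

lemma prob_good_tendsto: "(\<lambda>n. prob (good n (slack n))) \<longlonglongrightarrow> 1"
proof (rule tendsto_sandwich)
  show "\<forall>\<^sub>F n in sequentially. 1 - 4 * (real n + 1)\<^sup>2 * exp (1 - slack n) \<le> prob (good n (slack n))"
    using eventually_gt_at_top[of 0] by eventually_elim (rule prob_good)
  show "(\<lambda>n. 1 - 4 * (real n + 1)\<^sup>2 * exp (1 - slack n)) \<longlonglongrightarrow> 1" unfolding slack_def by real_asymp
qed auto

text \<open>The deterministic errors \<open>e1\<close> and \<open>e2\<close> of the density and the distribution function, after multiplication with \<open>n\<^sup>2\<^sup>/\<^sup>7\<close>, vanish in the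
limit; \<open>e3\<close> is the resulting error of the denominator.\<close>

lemma hazard_conv:
  "conv_in_distribution M
     (\<lambda>n \<omega>. norming n * (smle_hazard k (bw n) n (times \<omega>) (inds \<omega>) t - f t / (1 - F0 t)))
     (normal_law (c\<^sup>2 * second_moment k / 2 / (1 - F0 t) * (f2 t + f t * f1 t / (1 - F0 t))) ((1 / (1 - F0 t))\<^sup>2 * avar))"
proof -
  define Q where "Q = 1 - F0 t"
  have Q: "0 < Q" using F0_t by (simp add: Q_def)
  define b1 where "b1 = c\<^sup>2 * (f2 t * second_moment k / 2)"
  define b2 where "b2 = c\<^sup>2 * (f1 t * second_moment k / 2)"
  obtain C B where CB: "0 < C" "0 < B" and lip: "\<And>n x y. n > 0 \<Longrightarrow> x \<in> {l..r} \<Longrightarrow> y \<in> {l..r} \<Longrightarrow> \<bar>\<theta> n x - \<theta> n y\<bar> \<le> (C / bw n + B) / (bw n)\<^sup>2 * \<bar>x - y\<bar>"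
    using \<theta>_lipschitz by blast
  define R where "R n = norming n * ((C / bw n + B) / (bw n)\<^sup>2 * (2 * bw n) * (((2 * q2 * (2 * bw n) + 3 * mle_err n) * (12 * slack n * (sqrt n + 1)) + 2 * gap_bound n) / n))" for n
  define e1 where "e1 n = R n + \<bar>norming n * (centre_f n - f t) - b1\<bar>" for n
  define e2 where "e2 n = norming n * mle_err n + \<bar>norming n * (centre_F n - F0 t) - b2\<bar>" for n
  define e3 where "e3 n = (\<bar>b2\<bar> + e2 n) / norming n" for n
  have "R \<longlonglongrightarrow> 0" unfolding R_def norming_def bandwidth_def gap_bound_def gap_noise_def mle_err_def slack_def avg_len_def
    using pos CB by real_asymp
  then have "e1 \<longlonglongrightarrow> 0 + \<bar>b1 - b1\<bar>" unfolding e1_def b1_def by (intro tendsto_intros bias_limits)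
  then have e1: "e1 \<longlonglongrightarrow> 0" by simp
  have "(\<lambda>n. norming n * mle_err n) \<longlonglongrightarrow> 0" unfolding norming_def mle_err_def slack_def avg_len_def using pos by real_asymp
  then have "e2 \<longlonglongrightarrow> 0 + \<bar>b2 - b2\<bar>" unfolding e2_def b2_def by (intro tendsto_intros bias_limits)
  then have e2: "e2 \<longlonglongrightarrow> 0" by simp
  have "filterlim norming at_top sequentially" unfolding norming_def by real_asymp
  then have e3: "e3 \<longlonglongrightarrow> 0" unfolding e3_def
    by (intro tendsto_divide_0[OF tendsto_add[OF tendsto_const e2]] filterlim_at_top_imp_at_infinity)
  obtain V where V: "\<And>n. expectation (\<lambda>\<omega>. (leading n \<omega>)\<^sup>2) \<le> V" using leading_clt(3) by blast
  have "conv_in_distribution M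
     (\<lambda>n \<omega>. norming n * (smle_hazard k (bw n) n (times \<omega>) (inds \<omega>) t - f t / (1 - F0 t)))
     (normal_law (b1 / Q + f t * b2 / Q\<^sup>2) ((1 / Q)\<^sup>2 * avar))"
  proof (rule conv_in_distribution_normal_perturbed[where A=leading and E="\<lambda>n. good n (slack n)" and C=V
      and \<alpha>="\<lambda>n. 2 * e3 n / Q\<^sup>2" and \<beta>="\<lambda>n. 2 * e1 n / Q + 2 * e3 n / Q\<^sup>2 * \<bar>b1\<bar> + 2 * \<bar>f t\<bar> * e2 n / Q\<^sup>2 + 2 * e3 n / Q\<^sup>2 * (\<bar>f t\<bar> * \<bar>b2\<bar> / Q)"])
    show "(\<lambda>\<omega>. norming n * (smle_hazard k (bw n) n (times \<omega>) (inds \<omega>) t - f t / (1 - F0 t))) \<in> borel_measurable M" for n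
      by (intro borel_measurable_times borel_measurable_diff borel_measurable_const smle_hazard_measurable) (auto intro: bw_pos)
    show "(\<lambda>n. 2 * e3 n / Q\<^sup>2) \<longlonglongrightarrow> 0"
      using tendsto_mult[OF tendsto_const e3, of "2 / Q\<^sup>2"] by simp
    have "(\<lambda>n. 2 * e1 n / Q + 2 * e3 n / Q\<^sup>2 * \<bar>b1\<bar> + 2 * \<bar>f t\<bar> * e2 n / Q\<^sup>2 + 2 * e3 n / Q\<^sup>2 * (\<bar>f t\<bar> * \<bar>b2\<bar> / Q))
      \<longlonglongrightarrow> 2 * 0 / Q + 2 * 0 / Q\<^sup>2 * \<bar>b1\<bar> + 2 * \<bar>f t\<bar> * 0 / Q\<^sup>2 + 2 * 0 / Q\<^sup>2 * (\<bar>f t\<bar> * \<bar>b2\<bar> / Q)"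
      using Q by (intro tendsto_intros e1 e2 e3) auto
    then show "(\<lambda>n. 2 * e1 n / Q + 2 * e3 n / Q\<^sup>2 * \<bar>b1\<bar> + 2 * \<bar>f t\<bar> * e2 n / Q\<^sup>2 + 2 * e3 n / Q\<^sup>2 * (\<bar>f t\<bar> * \<bar>b2\<bar> / Q)) \<longlonglongrightarrow> 0"
      by simp
    have "\<forall>\<^sub>F n in sequentially. e3 n < Q / 2" using e3 Q by (intro order_tendstoD(2)) auto
    then show "\<forall>\<^sub>F n in sequentially. 0 \<le> 2 * e3 n / Q\<^sup>2 \<and> 
       0 \<le> 2 * e1 n / Q + 2 * e3 n / Q\<^sup>2 * \<bar>b1\<bar> + 2 * \<bar>f t\<bar> * e2 n / Q\<^sup>2 + 2 * e3 n / Q\<^sup>2 * (\<bar>f t\<bar> * \<bar>b2\<bar> / Q) \<and>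
       (\<forall>\<omega>\<in>good n (slack n). \<bar>norming n * (smle_hazard k (bw n) n (times \<omega>) (inds \<omega>) t - f t / (1 - F0 t)) - ((b1 / Q + f t * b2 / Q\<^sup>2) + 1 / Q * leading n \<omega>)\<bar>
         \<le> 2 * e3 n / Q\<^sup>2 * \<bar>leading n \<omega>\<bar> + (2 * e1 n / Q + 2 * e3 n / Q\<^sup>2 * \<bar>b1\<bar> + 2 * \<bar>f t\<bar> * e2 n / Q\<^sup>2 + 2 * e3 n / Q\<^sup>2 * (\<bar>f t\<bar> * \<bar>b2\<bar> / Q)))"
      using window_eventually local_modulus_eventually
    proof eventually_elim
      case (elim n)
      have n: "n > 0" using elim by simp
      have h: "0 < bw n" by (rule bw_pos[OF n])
      have sc: "0 < norming n" using n by (simp add: norming_def)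
      have mle_err0: "0 \<le> mle_err n" and w0: "0 \<le> gap_noise n" using pos by (auto simp: mle_err_def gap_noise_def avg_len_def slack_def)
      then have gap_bound0: "0 \<le> gap_bound n" using pos by (simp add: gap_bound_def)
      have "0 \<le> R n" unfolding R_def using sc h mle_err0 gap_bound0 pos CB by (simp add: slack_def)
      then have nn: "0 \<le> e1 n" "0 \<le> e2 n" using sc mle_err0 by (auto simp: e1_def e2_def)
      then have nn3: "0 \<le> e3 n" using sc by (simp add: e3_def)
      have main: "\<bar>norming n * (smle_hazard k (bw n) n (times \<omega>) (inds \<omega>) t - f t / (1 - F0 t)) - ((b1 / Q + f t * b2 / Q\<^sup>2) + 1 / Q * leading n \<omega>)\<bar>
         \<le> 2 * e3 n / Q\<^sup>2 * \<bar>leading n \<omega>\<bar> + (2 * e1 n / Q + 2 * e3 n / Q\<^sup>2 * \<bar>b1\<bar> + 2 * \<bar>f t\<bar> * e2 n / Q\<^sup>2 + 2 * e3 n / Q\<^sup>2 * (\<bar>f t\<bar> * \<bar>b2\<bar> / Q))"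
        if \<omega>: "\<omega> \<in> good n (slack n)" for \<omega>
      proof -
        have S: "sample_modulus_local lawT n (times \<omega>) (inds \<omega>) F0 (12 * slack n) l r p1 p2 q1 q2 (avg_len n)"
          using elim \<omega> by blast
        note ex = smle_expansion[OF S _ lip[OF n]]
        let ?f = "smle_f k (bw n) n (times \<omega>) (inds \<omega>) t"
        let ?F = "smle_F k (bw n) n (times \<omega>) (inds \<omega>) t"
        have x1: "\<bar>norming n * (?f - centre_f n) - leading n \<omega>\<bar> \<le> R n" unfolding R_def by (rule ex(1)) (use elim in auto)
        have "norming n * (?f - f t) - leading n \<omega> - b1 = (norming n * (?f - centre_f n) - leading n \<omega>) + (norming n * (centre_f n - f t) - b1)"
          by (simp add: algebra_simps)
        then have 1: "\<bar>norming n * (?f - f t) - leading n \<omega> - b1\<bar> \<le> e1 n" using x1 unfolding e1_def by linarith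
        have "\<bar>?F - centre_F n\<bar> \<le> mle_err n" by (rule ex(2)) (use elim in auto)
        then have x2: "\<bar>norming n * (?F - centre_F n)\<bar> \<le> norming n * mle_err n" using sc by (simp add: abs_mult)
        have "norming n * (?F - (1 - Q)) - b2 = norming n * (?F - centre_F n) + (norming n * (centre_F n - F0 t) - b2)"
          by (simp add: Q_def algebra_simps)
        then have 2: "\<bar>norming n * (?F - (1 - Q)) - b2\<bar> \<le> e2 n" using x2 unfolding e2_def by linarith
        show ?thesis
          using hazard_delta[OF sc Q 1 2 e3_def] elim by (simp add: smle_hazard_def Q_def)
      qed
      show ?case
      proof (intro conjI ballI main)
        show "0 \<le> 2 * e3 n / Q\<^sup>2" using nn3 by simp
        show "0 \<le> 2 * e1 n / Q + 2 * e3 n / Q\<^sup>2 * \<bar>b1\<bar> + 2 * \<bar>f t\<bar> * e2 n / Q\<^sup>2 + 2 * e3 n / Q\<^sup>2 * (\<bar>f t\<bar> * \<bar>b2\<bar> / Q)"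
          using nn nn3 Q by (intro add_nonneg_nonneg mult_nonneg_nonneg divide_nonneg_nonneg) auto
      qed
    qed
  qed (use leading_clt V avar_pos Q prob_good_tendsto in auto)
  moreover have "b1 / Q + f t * b2 / Q\<^sup>2 = c\<^sup>2 * second_moment k / 2 / (1 - F0 t) * (f2 t + f t * f1 t / (1 - F0 t))"
    using Q unfolding Q_def[symmetric] b1_def b2_def by (simp add: field_simps power2_eq_square)
  ultimately show ?thesis by (simp add: Q_def)
qed

end


section \<open>The optimal bandwidth constant\<close>

text \<open>With \<open>\<beta>\<close> expressed by \<open>s\<close>, the difference \<open>A c - A s\<close> is a positive multiple of \<open>3 c\<^sup>7 - 7 s\<^sup>4 c\<^sup>3 + 4 s\<^sup>7\<close>, which has a double zero
at \<open>c = s\<close> and a cofactor with positive coefficients.\<close>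

lemma quartic_argmin:
  fixes \<alpha> \<beta> s :: real
  assumes \<alpha>: "0 < \<alpha>" and s: "0 < s" "4 * \<alpha> * s ^ 7 = 3 * \<beta>" and A: "\<And>c. 0 < c \<Longrightarrow> A c = \<alpha> * c ^ 4 + \<beta> / c ^ 3"
  shows "is_arg_min A (\<lambda>c. 0 < c) c \<longleftrightarrow> c = s"
proof -
  have diff: "A c - A s = \<alpha> / (3 * c ^ 3) * ((c - s)\<^sup>2 * (3 * c ^ 5 + 6 * s * c ^ 4 + 9 * s\<^sup>2 * c ^ 3 + 12 * s ^ 3 * c\<^sup>2 + 8 * s ^ 4 * c + 4 * s ^ 5))"
    if c: "0 < c" for c
  proof -
    have b: "\<beta> = 4 * \<alpha> * s ^ 7 / 3" using s by simp
    have "A c - A s = \<alpha> / (3 * c ^ 3) * (3 * c ^ 7 - 7 * s ^ 4 * c ^ 3 + 4 * s ^ 7)"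
      unfolding A[OF c] A[OF s(1)] b using c s(1) by (simp add: field_simps eval_nat_numeral)
    also have "3 * c ^ 7 - 7 * s ^ 4 * c ^ 3 + 4 * s ^ 7 = (c - s)\<^sup>2 * (3 * c ^ 5 + 6 * s * c ^ 4 + 9 * s\<^sup>2 * c ^ 3 + 12 * s ^ 3 * c\<^sup>2 + 8 * s ^ 4 * c + 4 * s ^ 5)"
      by (simp add: algebra_simps eval_nat_numeral)
    finally show ?thesis .
  qed
  have less: "A s < A c" if c: "0 < c" "c \<noteq> s" for c
  proof -
    have "0 < 3 * c ^ 5 + 6 * s * c ^ 4 + 9 * s\<^sup>2 * c ^ 3 + 12 * s ^ 3 * c\<^sup>2 + 8 * s ^ 4 * c + 4 * s ^ 5"
      using c s(1) by (intro add_pos_pos mult_pos_pos zero_less_power) auto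
    then have "0 < A c - A s" unfolding diff[OF c(1)] using c \<alpha> by (intro mult_pos_pos) auto
    then show ?thesis by simp
  qed
  show ?thesis unfolding is_arg_min_def using less s(1) by (metis less_asym order_less_irrefl)
qed

lemma amse_argmin:
  assumes k: "kernel k" and F: "0 < F0 t" "F0 t < 1" and g: "0 < g t"
    and D: "(1 - F0 t) * deriv (deriv f0) t + f0 t * deriv f0 t \<noteq> 0"
  shows "is_arg_min (amse_hazard k F0 f0 g t) (\<lambda>c. c > 0) c \<longleftrightarrow> c = c_hazard k F0 f0 g t"
proof -
  interpret kernel k by fact
  define Q where "Q = 1 - F0 t"
  define E where "E = deriv (deriv f0) t + f0 t * deriv f0 t / Q"
  define I where "I = (LBINT u. (k' u)\<^sup>2)"
  define m where "m = second_moment k"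
  have Q: "0 < Q" using F by (simp add: Q_def)
  have "Q * E = (1 - F0 t) * deriv (deriv f0) t + f0 t * deriv f0 t" using Q by (simp add: E_def Q_def[symmetric] field_simps)
  then have E: "E \<noteq> 0" using D by auto
  have I: "0 < I" and m: "0 < m" using roughness_pos second_moment_pos by (auto simp: I_def m_def)
  define \<alpha> where "\<alpha> = m\<^sup>2 / Q\<^sup>2 * E\<^sup>2 / 4"
  define \<beta> where "\<beta> = F0 t / (g t * Q) * I"
  have \<alpha>: "0 < \<alpha>" and \<beta>: "0 < \<beta>" using Q E I m F g by (auto simp: \<alpha>_def \<beta>_def)
  have c: "c_hazard k F0 f0 g t = (3 * \<beta>) powr (1 / 7) * (4 * \<alpha>) powr (- 1 / 7)"
    by (simp add: c_hazard_def \<alpha>_def \<beta>_def Q_def E_def I_def m_def mult.assoc)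
  show ?thesis
  proof (rule quartic_argmin[OF \<alpha>])
    show "0 < c_hazard k F0 f0 g t" using \<alpha> \<beta> by (simp add: c)
    have "(c_hazard k F0 f0 g t) ^ 7 = (3 * \<beta>) powr 1 * (4 * \<alpha>) powr - 1"
      unfolding c power_mult_distrib using \<alpha> \<beta> by (simp add: powr_power)
    then show "4 * \<alpha> * c_hazard k F0 f0 g t ^ 7 = 3 * \<beta>" using \<alpha> \<beta> by (simp add: powr_minus field_simps)
    fix c :: real assume c: "0 < c"
    show "amse_hazard k F0 f0 g t c = \<alpha> * c ^ 4 + \<beta> / c ^ 3"
      unfolding amse_hazard_def mu_hazard_def var_hazard_def Q_def[symmetric] E_def[symmetric] I_def[symmetric] m_def[symmetric] \<alpha>_def \<beta>_def
      using c Q g by (simp add: power_mult_distrib power_divide) (simp add: field_simps eval_nat_numeral)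
  qed
qed

section \<open>The asymptotic distribution\<close>

lemma (in real_distribution) interval_measure_cdf: "interval_measure (cdf M) = M"
proof (rule cdf_unique)
  show "real_distribution (interval_measure (cdf M))"
    by (rule real_distribution_interval_measure) (auto intro: cdf_nondecreasing cdf_is_right_cont cdf_lim_at_bot cdf_lim_at_top_prob)
  show "cdf (interval_measure (cdf M)) = cdf M"
    by (rule cdf_interval_measure) (auto intro: cdf_nondecreasing cdf_is_right_cont cdf_lim_at_bot)
qed (rule real_distribution_axioms)

text \<open>What has to be found is the neighbourhood of \<open>t\<close>. First, \<open>t \<le> M0\<close>: the right end of the level set of \<open>F0\<close> at height \<open>F0 t < 1\<close> is a
point of increase. Hence the density \<open>f0\<close> is positive at \<open>t\<close> and, being continuous there, in a neighbourhood; all points of it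
belong to the support, so that \<open>t < M0\<close>. Then \<open>g\<close> is continuous at \<open>t\<close> and bounded from below nearby.\<close>

lemma smle_asymptotics_intro:
  fixes M :: "'a measure" and X T :: "nat \<Rightarrow> 'a \<Rightarrow> real" and F0 f0 G g k :: "real \<Rightarrow> real" and M0 t c :: real
  assumes model: "current_status_model M X T F0 G"
    and F: "condition_F F0 f0 M0"
    and G: "condition_G G g M0"
    and kernel: "smoothing_kernel k"
    and t: "t > 0" "F0 t < 1"
    and f0_twice_diff: "\<forall>\<^sub>F x in nhds t. f0 differentiable (at x) \<and> deriv f0 differentiable (at x)"
    and f0''_cont: "isCont (deriv (deriv f0)) t"
  obtains l r p1 p2 q1 q2 Bg where
    "\<And>c. 0 < c \<Longrightarrow> smle_asymptotics M X T F0 G k f0 (deriv f0) (deriv (deriv f0)) g t l r p1 p2 q1 q2 Bg c"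
proof -
  interpret current_status M X T F0 G
    using model unfolding current_status_model_def
    by (intro current_status.intro current_status_axioms.intro) blast+
  have lX: "lawX = density lborel (\<lambda>x. ennreal (f0 x))" and f0m[measurable]: "f0 \<in> borel_measurable borel" and f0nn: "\<And>x. 0 \<le> f0 x"
    using F lawX.interval_measure_cdf cdf_X[of 0] by (auto simp: condition_F_def has_density_def)
  have lT: "lawT = density lborel (\<lambda>x. ennreal (g x))" and gm[measurable]: "g \<in> borel_measurable borel" and gnn: "\<And>x. 0 \<le> g x"
    using G lawT.interval_measure_cdf cdf_T[of 0] by (auto simp: condition_G_def has_density_def)
  have supF: "cdf_support F0 = {0..M0}" and supG: "cdf_support G = {0..}"
    using F G by (auto simp: condition_F_def condition_G_def)
  have contG: "isCont G x" for x
  proof -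
    have "emeasure lawT {x} = (\<integral>\<^sup>+u. ennreal (g u) * indicator {x} u \<partial>lborel)" unfolding lT by (rule emeasure_density) auto
    also have "\<dots> = 0" by (rule nn_integral_null_set) (simp add: null_sets_def)
    finally have "lawT.prob {x} = 0" by (simp add: measure_def)
    then show ?thesis using lawT.isCont_cdf[of x] cdf_T[of 0] by simp
  qed
  have strictG: "G x < G y" if "0 \<le> x" "x < y" for x y
  proof -
    have "(x + y) / 2 \<in> cdf_support G" using that by (simp add: supG)
    then have "G ((x + y) / 2 - (y - x) / 2) < G ((x + y) / 2 + (y - x) / 2)" using that unfolding cdf_support_def by simp
    then show ?thesis by (simp add: field_simps)
  qed
  have cont: "current_status_cont M X T F0 G"
  proof (intro current_status_cont.intro current_status_axioms current_status_cont_axioms.intro contG strictG)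
    show "G x = 0" if "x < 0" for x using model that by (simp add: current_status_model_def)
  qed
  obtain ef where ef: "0 < ef" "\<And>x. x \<in> {0..M0} \<Longrightarrow> ef \<le> f0 x" using F by (auto simp: condition_F_def)
  obtain eg where eg: "0 < eg" "\<And>x. x \<in> {0..M0} \<Longrightarrow> eg \<le> g x" using G by (auto simp: condition_G_def)
  obtain g' where g': "\<And>x. x \<in> {0..M0} \<Longrightarrow> (g has_real_derivative g' x) (at x within {0..M0})" and bg': "bounded (g' ` {0..M0})"
    using G unfolding condition_G_def by blast
  obtain Bg where Bg: "0 < Bg" "\<And>x. x \<in> {0..M0} \<Longrightarrow> \<bar>g' x\<bar> \<le> Bg" using bg' by (auto simp: bounded_pos)
  have g_lip: "\<bar>g x - g y\<bar> \<le> Bg * \<bar>x - y\<bar>" if "x \<in> {0..M0}" "y \<in> {0..M0}" for x y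
  proof -
    have "norm (g x - g y) \<le> Bg * norm (x - y)"
      by (rule field_differentiable_bound[where S="{0..M0}" and f'=g']) (use g' Bg that in auto)
    then show ?thesis by simp
  qed
  have incF: "F0 y - F0 x = lawX.prob {x<..y}" and incG: "G y - G x = lawT.prob {x<..y}" if "x \<le> y" for x y
    using lawX.cdf_diff_eq[of x y] lawT.cdf_diff_eq[of x y] cdf_X[of 0] cdf_T[of 0] that by (cases "x = y"; simp)+
  have tM: "t \<le> M0"
  proof -
    have "(F0 \<longlongrightarrow> 1) at_top" using lawX.cdf_lim_at_top_prob cdf_X[of 0] by simp
    then have "eventually (\<lambda>x. F0 t < F0 x) at_top" using t by (intro order_tendstoD(1)) auto
    then obtain b where b: "\<And>x. b \<le> x \<Longrightarrow> F0 t < F0 x" by (auto simp: eventually_at_top_linorder)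
    define S where "S = {x. F0 x \<le> F0 t}"
    have "x \<le> b" if "x \<in> S" for x using b[of x] that by (force simp: S_def)
    then have bdd: "bdd_above S" by (rule bdd_aboveI)
    have tS: "t \<in> S" by (simp add: S_def)
    have "Sup S \<in> cdf_support F0"
      unfolding cdf_support_def
    proof (intro CollectI allI impI)
      fix e :: real assume e: "0 < e"
      have "Sup S + e \<notin> S" using cSup_upper[OF _ bdd, of "Sup S + e"] e by auto
      then have 1: "F0 t < F0 (Sup S + e)" by (simp add: S_def)
      obtain x where "x \<in> S" "Sup S - e < x" using less_cSup_iff[OF _ bdd, of "Sup S - e"] tS e by auto
      then have "F0 (Sup S - e) \<le> F0 t" using F0_mono[of "Sup S - e" x] by (simp add: S_def)
      then show "F0 (Sup S - e) < F0 (Sup S + e)" using 1 by simp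
    qed
    then show ?thesis using cSup_upper[OF tS bdd] supF by auto
  qed
  have f0t: "0 < f0 t" using ef t tM by (intro less_le_trans[OF ef(1)]) auto
  have dif: "\<forall>\<^sub>F x in nhds t. DERIV f0 x :> deriv f0 x \<and> DERIV (deriv f0) x :> deriv (deriv f0) x"
    using f0_twice_diff by eventually_elim (simp add: DERIV_deriv_iff_real_differentiable)
  have derivs: "\<forall>\<^sub>F x in nhds t. DERIV F0 x :> f0 x \<and> DERIV f0 x :> deriv f0 x \<and> DERIV (deriv f0) x :> deriv (deriv f0) x"
    using dif
  proof eventually_elim
    case (elim x)
    then have "isCont f0 x" using DERIV_isCont by blast
    then have "DERIV F0 x :> f0 x"
      using lawX.real_distribution_axioms F0_eq by (intro DERIV_cdf_density) (auto simp: lX f0nn)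
    then show ?case using elim by simp
  qed
  have "isCont f0 t" using eventually_nhds_x_imp_x[OF dif] DERIV_isCont by blast
  then obtain \<eta>1 where \<eta>1: "0 < \<eta>1" "\<And>x. \<bar>x - t\<bar> < \<eta>1 \<Longrightarrow> \<bar>f0 x - f0 t\<bar> < f0 t / 2"
    unfolding continuous_at_eps_delta dist_real_def using f0t by (meson half_gt_zero)
  define q1 where "q1 = f0 t / 2"
  define q2 where "q2 = 2 * f0 t"
  have q: "0 < q1" "0 < q2" using f0t by (auto simp: q1_def q2_def)
  have fb: "q1 \<le> f0 x \<and> f0 x \<le> q2" if "\<bar>x - t\<bar> < \<eta>1" for x
    using \<eta>1(2)[OF that] f0t unfolding q1_def q2_def by (intro conjI; linarith)
  have F0_bounds: "q1 * (y - x) \<le> F0 y - F0 x" "F0 y - F0 x \<le> q2 * (y - x)"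
    if "t - \<eta>1 < x" "x \<le> y" "y < t + \<eta>1" for x y
  proof -
    have sub: "{x<..y} \<subseteq> {x..y}" by auto
    have b: "\<And>u. u \<in> {x<..y} \<Longrightarrow> q1 \<le> f0 u \<and> f0 u \<le> q2" using that by (intro fb) auto
    have "measure lborel {x<..y} = y - x" using that by simp
    then show "q1 * (y - x) \<le> F0 y - F0 x" "F0 y - F0 x \<le> q2 * (y - x)"
      using density_measure_bounds[of f0 "{x<..y}" x y q1 q2, OF _ _ sub b] q f0t incF[OF that(2)] lawX.emeasure_finite
      unfolding lX[symmetric] by (auto simp: q1_def q2_def)
  qed
  have tM': "t < M0"
  proof -
      \<comment> \<open>A point beyond \<open>t\<close> that still belongs to the support.\<close>
  define x where "x = t + \<eta>1 / 2"
    have "x \<in> cdf_support F0"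
      unfolding cdf_support_def
    proof (intro CollectI allI impI)
      fix e :: real assume e: "0 < e"
      define e' where "e' = min e (\<eta>1 / 4)"
      have e': "0 < e'" "e' \<le> e" "e' \<le> \<eta>1 / 4" using e \<eta>1 by (auto simp: e'_def)
      have "0 < q1 * ((x + e') - (x - e'))" using q e' by simp
      also have "\<dots> \<le> F0 (x + e') - F0 (x - e')" using e' \<eta>1 by (intro F0_bounds) (auto simp: x_def)
      also have "\<dots> \<le> F0 (x + e) - F0 (x - e)" using e' by (intro diff_mono F0_mono) auto
      finally show "F0 (x - e) < F0 (x + e)" by simp
    qed
    then show ?thesis using supF \<eta>1 by (auto simp: x_def)
  qed
  define \<eta> where "\<eta> = min (\<eta>1 / 2) (min (t / 2) ((M0 - t) / 2))"
  have \<eta>: "0 < \<eta>" "\<eta> < \<eta>1" "\<eta> < t" "\<eta> < M0 - t" using \<eta>1 t tM' by (auto simp: \<eta>_def min_def)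
  define p2 where "p2 = g t + Bg * \<eta>"
  have gb: "eg \<le> g x \<and> g x \<le> p2" if "x \<in> {t - \<eta>..t + \<eta>}" for x
  proof -
    have x: "x \<in> {0..M0}" "t \<in> {0..M0}" using that \<eta> t tM by auto
    have "\<bar>g x - g t\<bar> \<le> Bg * \<bar>x - t\<bar>" by (rule g_lip[OF x])
    also have "\<dots> \<le> Bg * \<eta>" using that Bg by (intro mult_left_mono) (auto simp: abs_le_iff)
    finally show ?thesis using eg(2)[OF x(1)] by (auto simp: p2_def)
  qed
  have p2: "eg \<le> p2" using gb[of t] \<eta> by auto
  have G_bounds: "eg * (y - x) \<le> lawT.prob {x<..y}" "lawT.prob {x..y} \<le> p2 * (y - x)"
    if "t - \<eta> \<le> x" "x \<le> y" "y \<le> t + \<eta>" for x y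
  proof -
    have b: "\<And>u. u \<in> {x<..y} \<Longrightarrow> eg \<le> g u \<and> g u \<le> p2" "\<And>u. u \<in> {x..y} \<Longrightarrow> eg \<le> g u \<and> g u \<le> p2"
      using that by (intro gb; auto)+
    have sub: "{x<..y} \<subseteq> {x..y}" by auto
    have "measure lborel {x<..y} = y - x" "measure lborel {x..y} = y - x" using that by simp_all
    then show "eg * (y - x) \<le> lawT.prob {x<..y}" "lawT.prob {x..y} \<le> p2 * (y - x)"
      using density_measure_bounds(1)[of g "{x<..y}" x y eg p2, OF _ _ sub b(1)]
        density_measure_bounds(2)[of g "{x..y}" x y eg p2, OF _ _ order_refl b(2)] eg(1) p2 lawT.emeasure_finite
      unfolding lT[symmetric] by auto
  qed
  have cg: "isCont g t"
  proof -
    have "at t within {0..M0} = at t" using t tM' by (intro at_within_interior) (simp add: interior_atLeastAtMost_real)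
    then show ?thesis using g'[of t] t tM' DERIV_isCont[of g "g' t" t] by auto
  qed
  have F0t: "0 < F0 t"
  proof -
    have "0 < q1 * (t - (t - \<eta>))" using q \<eta> by simp
    also have "\<dots> \<le> F0 t - F0 (t - \<eta>)" using \<eta> \<eta>1 by (intro F0_bounds) auto
    finally show ?thesis using F0_01[of "t - \<eta>"] by simp
  qed
  show ?thesis
  proof (rule that)
    fix c :: real assume c: "0 < c"
    show "smle_asymptotics M X T F0 G k f0 (deriv f0) (deriv (deriv f0)) g t (t - \<eta>) (t + \<eta>) eg p2 q1 q2 Bg c"
    proof (intro smle_asymptotics.intro cont kernel.intro kernel smle_asymptotics_axioms.intro lT derivs f0''_cont cg F0t t)
      show "\<bar>g x - g y\<bar> \<le> Bg * \<bar>x - y\<bar>" if "x \<in> {t - \<eta>..t + \<eta>}" "y \<in> {t - \<eta>..t + \<eta>}" for x y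
        using that \<eta> by (intro g_lip) auto
      show "q1 * (y - x) \<le> F0 y - F0 x" "F0 y - F0 x \<le> q2 * (y - x)" if "t - \<eta> \<le> x" "x \<le> y" "y \<le> t + \<eta>" for x y
        using that \<eta> by (intro F0_bounds; simp)+
      show "eg * (y - x) \<le> lawT.prob {x<..y}" "lawT.prob {x..y} \<le> p2 * (y - x)" if "t - \<eta> \<le> x" "x \<le> y" "y \<le> t + \<eta>" for x y
        using G_bounds[OF that] by auto
    qed (use \<eta> eg p2 q Bg c gnn gb gm in auto)
  qed
qed

theorem corollary4p4:
  fixes M :: "'a measure"
    and X T :: "nat \<Rightarrow> 'a \<Rightarrow> real"
    and F0 f0 G g k :: "real \<Rightarrow> real"
    and M0 t :: real
  assumes model: "current_status_model M X T F0 G"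
    and F: "condition_F F0 f0 M0"
    and G: "condition_G G g M0"
    and kernel: "smoothing_kernel k"
    and t: "t > 0" "F0 t < 1"
    and f0_twice_diff:
      "\<forall>\<^sub>F x in nhds t. f0 differentiable (at x) \<and> deriv f0 differentiable (at x)"
    and f0''_cont: "isCont (deriv (deriv f0)) t"
    and f0''_nz: "deriv (deriv f0) t \<noteq> 0"
    and bias_nz: "(1 - F0 t) * deriv (deriv f0) t + f0 t * deriv f0 t \<noteq> 0"
  shows "(\<forall>c>0. conv_in_distribution M
           (\<lambda>n \<omega>. real n powr (2 / 7) *
             (smle_hazard k (bandwidth c n) n
                (\<lambda>i. T i \<omega>) (\<lambda>i. of_bool (X i \<omega> \<le> T i \<omega>)) t
              - hazard F0 f0 t))
           (normal_law (mu_hazard k F0 f0 t c) (var_hazard k F0 g t c))) \<and>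
         (\<forall>c. is_arg_min (amse_hazard k F0 f0 g t) (\<lambda>c. c > 0) c
              \<longleftrightarrow> c = c_hazard k F0 f0 g t) \<and>
         (\<forall>h. amse_optimal_bandwidth k F0 f0 g t h
              \<longleftrightarrow> h = bandwidth (c_hazard k F0 f0 g t))"
proof -
  obtain l r p1 p2 q1 q2 Bg where S:
    "\<And>c. 0 < c \<Longrightarrow> smle_asymptotics M X T F0 G k f0 (deriv f0) (deriv (deriv f0)) g t l r p1 p2 q1 q2 Bg c"
    using smle_asymptotics_intro[OF model F G kernel t f0_twice_diff f0''_cont] by blast
  have conv: "conv_in_distribution M
           (\<lambda>n \<omega>. real n powr (2 / 7) *
             (smle_hazard k (bandwidth c n) n
                (\<lambda>i. T i \<omega>) (\<lambda>i. of_bool (X i \<omega> \<le> T i \<omega>)) t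
              - hazard F0 f0 t))
           (normal_law (mu_hazard k F0 f0 t c) (var_hazard k F0 g t c))" if c: "0 < c" for c
  proof -
    interpret smle_asymptotics M X T F0 G k f0 "deriv f0" "deriv (deriv f0)" g t l r p1 p2 q1 q2 Bg c
      by (rule S[OF c])
    have "(1 / (1 - F0 t))\<^sup>2 * avar = var_hazard k F0 g t c"
      using F0_t g_t c by (simp add: avar_def var_hazard_def power2_eq_square)
    moreover have "c\<^sup>2 * second_moment k / 2 / (1 - F0 t) * (deriv (deriv f0) t + f0 t * deriv f0 t / (1 - F0 t)) = mu_hazard k F0 f0 t c"
      by (simp add: mu_hazard_def)
    ultimately show ?thesis using hazard_conv by (simp add: norming_def hazard_def)
  qed
  interpret smle_asymptotics M X T F0 G k f0 "deriv f0" "deriv (deriv f0)" g t l r p1 p2 q1 q2 Bg 1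
    by (rule S) simp
  have argmin: "is_arg_min (amse_hazard k F0 f0 g t) (\<lambda>c. c > 0) c \<longleftrightarrow> c = c_hazard k F0 f0 g t" for c
    by (rule amse_argmin[where k=k and ?F0.0=F0 and ?f0.0=f0 and g=g and t=t]) (fact kernel_axioms F0_t g_t bias_nz)+
  then have "amse_optimal_bandwidth k F0 f0 g t h \<longleftrightarrow> h = bandwidth (c_hazard k F0 f0 g t)" for h
    unfolding amse_optimal_bandwidth_def by auto
  with conv argmin show ?thesis by blast
qed

end
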